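(* Let $p=p(n)\in(0,1)$, $q=1-p$, let $K_{n,p}$ be the number of edges of the random symmetric edge polytope $P_{n,p}$, and let $N$ be a standard Gaussian random variable. If $p\gg n^{-2}$, then $$d_K\left(\frac{K_{n,p}-\mathbb{E}[K_{n,p}]}{\sqrt{\mathbb{V}(K_{n,p})}},\,N\right)\lesssim\min\Bigl\{\frac{1}{n\sqrt{pq}\,(1-\sqrt2\,p)^2}\,,\ \frac{1}{\sqrt{pq}}\Bigr\}.$$ In particular, if additionally $q\gg n^{-2}$ and $|p-\tfrac{1}{\sqrt2}|\gg n^{-1/2}$, then $K_{n,p}$ satisfies a central limit theorem as $n\to\infty$, that is, $\bigl(K_{n,p}-\mathbb{E}[K_{n,p}]\bigr)/\sqrt{\mathbb{V}(K_{n,p})}$ converges in distribution to $\mathcal{N}(0,1)$.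
   Context: For a finite simple graph $G=(V,E)$ (elements of $V$ are nodes, elements of $E\subseteq\binom V2$ are arcs), with $(\mathbf{e}_i)_{i\in V}$ the standard basis of $\mathbb{R}^V$, the symmetric edge polytope is $P_G:=\operatorname{conv}\{\pm(\mathbf{e}_i-\mathbf{e}_j):\{i,j\}\in E\}\subset\mathbb{R}^V$ (empty if $E=\emptyset$). A face of a polytope is its intersection with a supporting hyperplane; the polytope itself is not regarded as a face. Edges of a polytope are its $1$-dimensional faces (so if $G$ has exactly one arc, $P_G$ has no edges). $G_{n,p}$ is the Erdős–Rényi random graph on node set $[n]$, each arc of the complete graph being retained independently with probability $p=p(n)\in(0,1)$; $P_{n,p}:=P_{G_{n,p}}$. $\mathbb{V}$ denotes variance. The Kolmogorov distance is $d_K(X,Y):=\sup_{z\in\mathbb{R}}|\mathbb{P}(X\le z)-\mathbb{P}(Y\le z)|$. Asymptotic notation for sequences: $a_n\gg b_n$ means $\liminf|a_n/b_n|=\infty$; $a_n\lesssim b_n$ means $\limsup|a_n/b_n|<\infty$. If $p=1/\sqrt2$, the first entry of the minimum is read as $+\infty$. *)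

theory Defs
  imports "HOL-Probability.Probability" "HOL-Analysis.Finite_Function_Topology" "HOL-Library.Ramsey"
begin

text \<open>
  The space \<open>\<real>\<^sup>V\<close> is rendered as the set of finitely supported functions whose support lies
  in \<open>V\<close>.  A fixed ambient type is needed since the node set \<open>{1..n}\<close> varies with \<open>n\<close>; \<open>V\<close> is
  always meant to be finite.
\<close>

definition coord_space :: "'v set \<Rightarrow> ('v \<Rightarrow>\<^sub>0 real) set" where
  "coord_space V = {x. Poly_Mapping.keys x \<subseteq> V}"

definition basis_vec :: "'v \<Rightarrow> ('v \<Rightarrow>\<^sub>0 real)" where
  "basis_vec i = Poly_Mapping.single i 1"

text \<open>A simple graph on a given node set is identified with its set \<open>E\<close> of two-element arcs.\<close>

definition sym_edge_polytope :: "'v set set \<Rightarrow> ('v \<Rightarrow>\<^sub>0 real) set" where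
  "sym_edge_polytope E =
     convex hull (\<Union>(i, j) \<in> {(i, j). {i, j} \<in> E}.
       {basis_vec i - basis_vec j, - (basis_vec i - basis_vec j)})"

definition linear_form :: "'v set \<Rightarrow> ('v \<Rightarrow> real) \<Rightarrow> ('v \<Rightarrow>\<^sub>0 real) \<Rightarrow> real" where
  "linear_form V a x = (\<Sum>i\<in>V. a i * Poly_Mapping.lookup x i)"

definition supporting_hyperplane ::
  "'v set \<Rightarrow> ('v \<Rightarrow>\<^sub>0 real) set \<Rightarrow> ('v \<Rightarrow>\<^sub>0 real) set \<Rightarrow> bool" where
  "supporting_hyperplane V P H \<longleftrightarrow>
     (\<exists>a b. (\<exists>i\<in>V. a i \<noteq> 0) \<and> H = {x \<in> coord_space V. linear_form V a x = b} \<and>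
            (\<forall>x\<in>P. linear_form V a x \<le> b) \<and> P \<inter> H \<noteq> {})"

text \<open>
  The polytope is not a face of itself; this has to be demanded explicitly because a polytope that
  is not full-dimensional may be contained in a supporting hyperplane.
\<close>

definition polytope_face ::
  "'v set \<Rightarrow> ('v \<Rightarrow>\<^sub>0 real) set \<Rightarrow> ('v \<Rightarrow>\<^sub>0 real) set \<Rightarrow> bool" where
  "polytope_face V P F \<longleftrightarrow> F \<noteq> P \<and> (\<exists>H. supporting_hyperplane V P H \<and> F = P \<inter> H)"

text \<open>
  The condition defining \<^const>\<open>aff_dim\<close>, which itself is available for Euclidean spaces only.
\<close>

definition has_aff_dim :: "'a::real_vector set \<Rightarrow> int \<Rightarrow> bool" where
  "has_aff_dim S d \<longleftrightarrow>
     (\<exists>B. finite B \<and> affine hull B = affine hull S \<and> \<not> affine_dependent B \<and> int (card B) = d + 1)"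

definition polytope_edges :: "'v set \<Rightarrow> ('v \<Rightarrow>\<^sub>0 real) set \<Rightarrow> ('v \<Rightarrow>\<^sub>0 real) set set" where
  "polytope_edges V P = {F. polytope_face V P F \<and> has_aff_dim F 1}"

definition random_graph :: "nat \<Rightarrow> real \<Rightarrow> nat set set pmf" where
  "random_graph n p =
     map_pmf (\<lambda>\<omega>. {e \<in> nsets {1..n} 2. \<omega> e})
       (Pi_pmf (nsets {1..n} 2) False (\<lambda>_. bernoulli_pmf p))"

text \<open>\<open>K\<^sub>n\<^sub>,\<^sub>p\<close> as a random variable on the probability space \<^term>\<open>random_graph n p\<close>.\<close>

definition edge_count :: "nat \<Rightarrow> nat set set \<Rightarrow> real" where
  "edge_count n E = real (card (polytope_edges {1..n} (sym_edge_polytope E)))"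

definition std_edge_count :: "nat \<Rightarrow> real \<Rightarrow> nat set set \<Rightarrow> real" where
  "std_edge_count n p E =
     (edge_count n E - measure_pmf.expectation (random_graph n p) (edge_count n))
       / sqrt (measure_pmf.variance (random_graph n p) (edge_count n))"

definition kolmogorov_dist ::
  "'a measure \<Rightarrow> ('a \<Rightarrow> real) \<Rightarrow> 'b measure \<Rightarrow> ('b \<Rightarrow> real) \<Rightarrow> real" where
  "kolmogorov_dist M X M' Y =
     (SUP z. \<bar>measure M {\<omega> \<in> space M. X \<omega> \<le> z} - measure M' {\<omega> \<in> space M'. Y \<omega> \<le> z}\<bar>)"

definition much_greater :: "(nat \<Rightarrow> real) \<Rightarrow> (nat \<Rightarrow> real) \<Rightarrow> bool" where
  "much_greater a b \<longleftrightarrow> liminf (\<lambda>n. ereal \<bar>a n / b n\<bar>) = \<infinity>"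

definition asymp_bounded_by :: "(nat \<Rightarrow> real) \<Rightarrow> (nat \<Rightarrow> real) \<Rightarrow> bool" where
  "asymp_bounded_by a b \<longleftrightarrow> limsup (\<lambda>n. ereal \<bar>a n / b n\<bar>) < \<infinity>"

text \<open>For \<open>p = 1 / \<surd>2\<close> the first entry of the minimum is read as \<open>\<infinity>\<close>.\<close>

definition rate_bound :: "nat \<Rightarrow> real \<Rightarrow> real" where
  "rate_bound n p =
     (if p = 1 / sqrt 2 then 1 / sqrt (p * (1 - p))
      else min (1 / (real n * sqrt (p * (1 - p)) * (1 - sqrt 2 * p)\<^sup>2)) (1 / sqrt (p * (1 - p))))"

end

theory Submission
  imports Defs
begin

text \<open>
  Two vertices of the symmetric edge polytope, that is, two directed arcs, span an edge iff some
  potential on the nodes has slope 1 along exactly these two arcs and smaller slope along all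
  others.  Solving for the potential shows that the number of edges is
  \<open>4 * (S choose 2) - T / 2 + L - C\<close>, where \<open>S\<close> is the number of arcs, \<open>T\<close> counts ordered 4-cycles,
  \<open>C\<close> ordered paths with two arcs, and \<open>L\<close> ordered pairs of non-adjacent nodes with exactly one common
  neighbour.  The second entry of the minimum is at least \<open>1\<close>, so only the first one matters.

  The bound comes from Stein's method on the product space of the arc indicators.  The centred count
  is \<open>c * (S - E S) + H + V + B\<close> where \<open>c\<close> carries the factor \<open>1 - 2 * p\<^sup>2\<close>.  Here \<open>H\<close>, a function
  of \<open>S\<close>, and \<open>B = L - C\<close> have relative size of the order of the rate \<open>r\<close>, but the fluctuation \<open>V\<close> of
  the 4-cycles given \<open>S\<close> only has relative size \<open>sqrt r\<close>.  As \<open>V\<close> is orthogonal to every function of \<open>S\<close>,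
  one may replace \<open>f W\<close> by \<open>f W - f (c * (S - E S))\<close> when testing \<open>V\<close> against the Stein solution \<open>f\<close>,
  which gains the missing factor \<open>sqrt r\<close>.  The discontinuity of \<open>f'\<close> is handled by rewriting the
  resulting term as a discrete divergence, whose second moment is explicit.
\<close>

section \<open>Random subsets of a finite set\<close>

text \<open>The rate is a ratio of variances. Write k = |1 - sqrt 2 * p| and w = sqrt (p * q). One
  arc shifts the conditional mean given S by about 2 * n^2 * p * (1 - 2 * p^2), and 1 - 2 * p^2 = (1
  - sqrt 2 * p) * (1 + sqrt 2 * p), so the linear term has standard deviation at least of order n^3
  * p * k * w. Two arcs with a common node lie on order n 4-cycles, two disjoint arcs on boundedly
  many. There are order n^3 pairs of the first kind and n^4 of the second, and a second-order
  Poincare inequality bounds the second moment of V by order (p * q)^2 * (n^5 * p^2 + n^4). Divided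
  by the variance of the linear term this is at most of order r = 1 / (n * w * k^2), which explains
  the square of 1 - sqrt 2 * p in the rate. The argument is non-asymptotic: for r > 1/200 the bound
  10^10 * r exceeds 1, and r <= 1/200 itself forces n * k >= 400 and n^2 * p >= 40000. Powers of 10
  among the constants are slack. All expectations are finite weighted sums over subsets, so
  resampling, integration by parts and conditioning are plain algebra.\<close>

definition bexp :: "'a set \<Rightarrow> real \<Rightarrow> ('a set \<Rightarrow> real) \<Rightarrow> real" where
  "bexp I p F = (\<Sum>E\<in>Pow I. p ^ card E * (1 - p) ^ card (I - E) * F E)"

text \<open>Adding and removing \<open>e\<close>, instead of toggling it, makes the discrete
  derivative a function of the other elements only, hence independent of the membership of
  \<open>e\<close>.\<close>

definition ddiff :: "'a \<Rightarrow> ('a set \<Rightarrow> real) \<Rightarrow> 'a set \<Rightarrow> real" where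
  "ddiff e F E = F (insert e E) - F (E - {e})"

lemma bexp_cong:
  assumes "\<And>E. E \<subseteq> I \<Longrightarrow> F E = G E"
  shows "bexp I p F = bexp I p G"
  unfolding bexp_def by (intro sum.cong) (use assms in auto)

lemma bexp_add: "bexp I p (\<lambda>E. F E + G E) = bexp I p F + bexp I p G"
  by (simp add: bexp_def ring_distribs sum.distrib)

lemma bexp_diff: "bexp I p (\<lambda>E. F E - G E) = bexp I p F - bexp I p G"
  by (simp add: bexp_def ring_distribs sum_subtractf)

lemma bexp_uminus: "bexp I p (\<lambda>E. - F E) = - bexp I p F"
  by (simp add: bexp_def sum_negf)

lemma bexp_cmult: "bexp I p (\<lambda>E. c * F E) = c * bexp I p F"
  by (simp add: bexp_def sum_distrib_left mult_ac)

lemma bexp_sum: "bexp I p (\<lambda>E. \<Sum>x\<in>A. F x E) = (\<Sum>x\<in>A. bexp I p (F x))"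
  unfolding bexp_def by (simp add: sum_distrib_left sum.swap[of _ A])

lemma bexp_empty [simp]: "bexp {} p F = F {}"
  by (simp add: bexp_def)

text \<open>Conditioning on the membership of \<open>e\<close>. This recursion drives the inductions
  over the ground set.\<close>

lemma bexp_insert:
  assumes "finite I" "e \<notin> I"
  shows "bexp (insert e I) p F = bexp I p (\<lambda>E. p * F (insert e E) + (1 - p) * F E)"
proof -
  let ?w = "\<lambda>J E. p ^ card E * (1 - p) ^ card (J - E)"
  have disj: "Pow I \<inter> insert e ` Pow I = {}" using assms by auto
  have inj: "inj_on (insert e) (Pow I)" using assms by (auto simp: inj_on_def)
  have "bexp (insert e I) p F = (\<Sum>E\<in>Pow I. ?w (insert e I) E * F E)
      + (\<Sum>E\<in>insert e ` Pow I. ?w (insert e I) E * F E)"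
    unfolding bexp_def Pow_insert using assms by (intro sum.union_disjoint disj) auto
  also have "(\<Sum>E\<in>insert e ` Pow I. ?w (insert e I) E * F E)
      = (\<Sum>E\<in>Pow I. ?w (insert e I) (insert e E) * F (insert e E))"
    using inj by (simp add: sum.reindex)
  also have "\<dots> = (\<Sum>E\<in>Pow I. ?w I E * (p * F (insert e E)))"
  proof (intro sum.cong refl)
    fix E assume "E \<in> Pow I"
    then have "finite E" "e \<notin> E" using assms by (auto intro: finite_subset)
    moreover have "insert e I - insert e E = I - E" using assms by auto
    ultimately show "?w (insert e I) (insert e E) * F (insert e E) = ?w I E * (p * F (insert e E))"
      by simp
  qed
  also have "(\<Sum>E\<in>Pow I. ?w (insert e I) E * F E) = (\<Sum>E\<in>Pow I. ?w I E * ((1 - p) * F E))"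
  proof (intro sum.cong refl)
    fix E assume "E \<in> Pow I"
    then have "finite (I - E)" "e \<notin> I - E" "insert e I - E = insert e (I - E)" using assms by auto
    then show "?w (insert e I) E * F E = ?w I E * ((1 - p) * F E)" by simp
  qed
  finally show ?thesis unfolding bexp_def by (simp add: ring_distribs sum.distrib)
qed

lemma bexp_const: "finite I \<Longrightarrow> bexp I p (\<lambda>_. c) = c"
proof (induction I rule: finite_induct)
  case (insert x I)
  have "p * c + (1 - p) * c = c" by (simp add: algebra_simps)
  then show ?case using insert by (simp add: bexp_insert)
qed simp

lemma ddiff_sum: "ddiff e (\<lambda>E. \<Sum>x\<in>A. F x E) E = (\<Sum>x\<in>A. ddiff e (F x) E)"
  by (simp add: ddiff_def sum_subtractf)

lemma ddiff_commute: "ddiff e (ddiff f F) E = ddiff f (ddiff e F) E"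
proof (cases "e = f")
  case False
  then have "insert f E - {e} = insert f (E - {e})" "insert e E - {f} = insert e (E - {f})" by auto
  moreover have "E - {f} - {e} = E - {e} - {f}" by auto
  ultimately show ?thesis by (simp add: ddiff_def insert_commute)
qed simp

lemma ddiff_same [simp]: "ddiff e F (insert e E) = ddiff e F E" "ddiff e F (E - {e}) = ddiff e F E"
  by (simp_all add: ddiff_def)

lemma ddiff_zero_remove:
  assumes "F (insert e E) = F (E - {e})"
  shows "F (E - {e}) = F E"
  using assms by (cases "e \<in> E") (simp_all add: insert_absorb)

section \<open>Expectations over a random subset: resampling and integration by parts\<close>

locale bernoulli_subset =
  fixes I :: "'a set" and p :: real
  assumes fin: "finite I" and p_gt: "0 < p" and p_lt: "p < 1"
begin

abbreviation Ex :: "('a set \<Rightarrow> real) \<Rightarrow> real" where "Ex \<equiv> bexp I p"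
abbreviation q :: real where "q \<equiv> 1 - p"
abbreviation dev :: "'a \<Rightarrow> 'a set \<Rightarrow> real" where "dev e E \<equiv> of_bool (e \<in> E) - p"

lemma pq_pos: "p * q > 0" using p_gt p_lt by simp

lemma Ex_const [simp]: "Ex (\<lambda>_. c) = c"
  using bexp_const[OF fin] .

lemma Ex_mono:
  assumes "\<And>E. E \<subseteq> I \<Longrightarrow> F E \<le> G E"
  shows "Ex F \<le> Ex G"
  unfolding bexp_def
  by (intro sum_mono mult_left_mono assms mult_nonneg_nonneg zero_le_power) (use p_gt p_lt in auto)

lemma Ex_nonneg:
  assumes "\<And>E. E \<subseteq> I \<Longrightarrow> 0 \<le> F E"
  shows "0 \<le> Ex F"
  using Ex_mono[of "\<lambda>_. 0" F] assms by simp

lemma Ex_abs_le: "\<bar>Ex F\<bar> \<le> Ex (\<lambda>E. \<bar>F E\<bar>)"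
proof -
  have "Ex F \<le> Ex (\<lambda>E. \<bar>F E\<bar>)" "Ex (\<lambda>E. - F E) \<le> Ex (\<lambda>E. \<bar>F E\<bar>)" by (auto intro: Ex_mono)
  then show ?thesis by (simp add: bexp_uminus)
qed

lemma Ex_cauchy_schwarz: "(Ex (\<lambda>E. F E * G E))\<^sup>2 \<le> Ex (\<lambda>E. (F E)\<^sup>2) * Ex (\<lambda>E. (G E)\<^sup>2)"
proof -
  define w where "w E = p ^ card E * q ^ card (I - E)" for E
  have w: "w E \<ge> 0" for E using p_gt p_lt by (simp add: w_def)
  have "(\<Sum>E\<in>Pow I. (sqrt (w E) * F E) * (sqrt (w E) * G E))\<^sup>2
     \<le> (\<Sum>E\<in>Pow I. (sqrt (w E) * F E)\<^sup>2) * (\<Sum>E\<in>Pow I. (sqrt (w E) * G E)\<^sup>2)"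
    by (rule Cauchy_Schwarz_ineq_sum)
  moreover have "(sqrt (w E) * F E) * (sqrt (w E) * G E) = w E * (F E * G E)" for E
    using w[of E] by (metis mult.assoc mult.left_commute real_sqrt_mult_self abs_of_nonneg)
  ultimately show ?thesis
    using w by (simp add: bexp_def w_def[symmetric] power_mult_distrib)
qed

lemma Ex_abs_mult_le: "Ex (\<lambda>E. \<bar>F E * G E\<bar>) \<le> sqrt (Ex (\<lambda>E. (F E)\<^sup>2)) * sqrt (Ex (\<lambda>E. (G E)\<^sup>2))"
proof -
  have "(Ex (\<lambda>E. \<bar>F E\<bar> * \<bar>G E\<bar>))\<^sup>2 \<le> Ex (\<lambda>E. \<bar>F E\<bar>\<^sup>2) * Ex (\<lambda>E. \<bar>G E\<bar>\<^sup>2)"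
    by (rule Ex_cauchy_schwarz)
  then show ?thesis by (simp add: abs_mult real_sqrt_mult[symmetric] real_le_rsqrt)
qed

lemma Ex_abs_le_sqrt: "Ex (\<lambda>E. \<bar>F E\<bar>) \<le> sqrt (Ex (\<lambda>E. (F E)\<^sup>2))"
  using Ex_abs_mult_le[of F "\<lambda>_. 1"] by simp

text \<open>Drawing the membership of one element afresh does not change the law of the subset;
  condition on \<open>e\<close> on both sides.\<close>

lemma Ex_resample:
  assumes "e \<in> I"
  shows "Ex F = Ex (\<lambda>E. p * F (insert e E) + q * F (E - {e}))"
proof -
  define J where "J = I - {e}"
  have J: "I = insert e J" "e \<notin> J" "finite J" using assms fin by (auto simp: J_def)
  have "bexp I p (\<lambda>E. p * F (insert e E) + q * F (E - {e})) =
    bexp J p (\<lambda>E. p * (p * F (insert e E) + q * F (E - {e})) + q * (p * F (insert e E) + q * F (E - {e})))"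
    unfolding J(1) by (subst bexp_insert[OF J(3,2)]) simp
  also have "\<dots> = bexp J p (\<lambda>E. p * F (insert e E) + q * F E)"
  proof (rule bexp_cong)
    fix E assume "E \<subseteq> J"
    then have "E - {e} = E" using J by auto
    then show "p * (p * F (insert e E) + q * F (E - {e})) + q * (p * F (insert e E) + q * F (E - {e}))
      = p * F (insert e E) + q * F E" by (simp add: algebra_simps)
  qed
  also have "\<dots> = bexp I p F" unfolding J(1) by (rule bexp_insert[OF J(3,2), symmetric])
  finally show ?thesis by simp
qed

text \<open>Resample \<open>e\<close>: the centred indicator becomes q with weight p and -p with
  weight q, which leaves p * q times the difference of the two values of \<open>F\<close>.\<close>

lemma Ex_ibp:
  assumes "e \<in> I"
  shows "Ex (\<lambda>E. dev e E * F E) = p * q * Ex (ddiff e F)"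
proof -
  have "Ex (\<lambda>E. dev e E * F E) = Ex (\<lambda>E. p * (dev e (insert e E) * F (insert e E)) +
      q * (dev e (E - {e}) * F (E - {e})))"
    by (rule Ex_resample[OF assms])
  also have "\<dots> = Ex (\<lambda>E. p * q * ddiff e F E)"
    by (rule bexp_cong) (simp add: ddiff_def algebra_simps)
  finally show ?thesis by (simp add: bexp_cmult)
qed

end

text \<open>The Efron-Stein inequality, obtained by integrating out one element at a time.
  \<open>G\<close> is the mean of \<open>F\<close> over the membership of \<open>x\<close>; passing
  to \<open>G\<close> removes exactly the \<open>x\<close> term from the variance and only shrinks
  the other differences.\<close>

theorem bernoulli_poincare:
  fixes p :: real
  assumes "finite I" "0 < p" "p < 1"
  shows "bexp I p (\<lambda>E. (F E)\<^sup>2) - (bexp I p F)\<^sup>2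
     \<le> p * (1 - p) * (\<Sum>e\<in>I. bexp I p (\<lambda>E. (ddiff e F E)\<^sup>2))"
  using assms(1)
proof (induction I arbitrary: F rule: finite_induct)
  case (insert x I)
  define G where "G E = p * F (insert x E) + (1 - p) * F E" for E
  interpret I: bernoulli_subset I p using insert assms by unfold_locales auto
  have 1: "bexp (insert x I) p F = bexp I p G"
    using insert by (simp add: bexp_insert G_def[abs_def])
  have "bexp (insert x I) p (\<lambda>E. (F E)\<^sup>2) = bexp I p (\<lambda>E. p * (F (insert x E))\<^sup>2 + (1 - p) * (F E)\<^sup>2)"
    using insert by (simp add: bexp_insert)
  \<comment> \<open>The variance of a two-point law: p * a^2 + q * b^2 = (p * a + q * b)^2 + p * q *
    (a - b)^2.\<close>
  also have "\<dots> = bexp I p (\<lambda>E. (G E)\<^sup>2 + p * (1 - p) * (F (insert x E) - F E)\<^sup>2)"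
    by (rule bexp_cong) (simp add: G_def power2_eq_square algebra_simps)
  finally have 2: "bexp (insert x I) p (\<lambda>E. (F E)\<^sup>2)
      = bexp I p (\<lambda>E. (G E)\<^sup>2) + p * (1 - p) * bexp I p (\<lambda>E. (F (insert x E) - F E)\<^sup>2)"
    by (simp add: bexp_add bexp_cmult)
  have 3: "bexp (insert x I) p (\<lambda>E. (ddiff x F E)\<^sup>2) = bexp I p (\<lambda>E. (F (insert x E) - F E)\<^sup>2)"
  proof -
    have "bexp (insert x I) p (\<lambda>E. (ddiff x F E)\<^sup>2) =
      bexp I p (\<lambda>E. p * (ddiff x F (insert x E))\<^sup>2 + (1 - p) * (ddiff x F E)\<^sup>2)"
      using insert by (simp add: bexp_insert)
    also have "\<dots> = bexp I p (\<lambda>E. (F (insert x E) - F E)\<^sup>2)"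
    proof (rule bexp_cong)
      fix E assume "E \<subseteq> I"
      then have "E - {x} = E" using insert by auto
      then show "p * (ddiff x F (insert x E))\<^sup>2 + (1 - p) * (ddiff x F E)\<^sup>2 = (F (insert x E) - F E)\<^sup>2"
        by (simp add: ddiff_def algebra_simps)
    qed
    finally show ?thesis .
  qed
  \<comment> \<open>Jensen: differencing in \<open>e\<close> commutes with averaging over
    \<open>x\<close>.\<close>
  have 4: "bexp I p (\<lambda>E. (ddiff e G E)\<^sup>2) \<le> bexp (insert x I) p (\<lambda>E. (ddiff e F E)\<^sup>2)"
    if "e \<in> I" for e
  proof -
    have "bexp I p (\<lambda>E. (ddiff e G E)\<^sup>2) \<le>
      bexp I p (\<lambda>E. p * (ddiff e F (insert x E))\<^sup>2 + (1 - p) * (ddiff e F E)\<^sup>2)"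
    proof (rule I.Ex_mono)
      fix E
      have ne: "insert x E - {e} = insert x (E - {e})" using that insert by auto
      define a b where "a = ddiff e F (insert x E)" and "b = ddiff e F E"
      have eq: "ddiff e G E = p * a + (1 - p) * b"
        by (simp add: G_def a_def b_def ddiff_def ne insert_commute algebra_simps)
      have "p * a\<^sup>2 + (1 - p) * b\<^sup>2 - (p * a + (1 - p) * b)\<^sup>2 = p * (1 - p) * (a - b)\<^sup>2"
        by (simp add: power2_eq_square algebra_simps)
      also have "\<dots> \<ge> 0" using assms by simp
      finally show "(ddiff e G E)\<^sup>2 \<le> p * (ddiff e F (insert x E))\<^sup>2 + (1 - p) * (ddiff e F E)\<^sup>2"
        unfolding eq a_def[symmetric] b_def[symmetric] by linarith
    qed
    then show ?thesis using insert by (simp add: bexp_insert)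
  qed
  have "bexp (insert x I) p (\<lambda>E. (F E)\<^sup>2) - (bexp (insert x I) p F)\<^sup>2
     = (bexp I p (\<lambda>E. (G E)\<^sup>2) - (bexp I p G)\<^sup>2) + p * (1 - p) * bexp (insert x I) p (\<lambda>E. (ddiff x F E)\<^sup>2)"
    by (simp add: 1 2 3)
  also have "\<dots> \<le> p * (1 - p) * (\<Sum>e\<in>I. bexp I p (\<lambda>E. (ddiff e G E)\<^sup>2))
      + p * (1 - p) * bexp (insert x I) p (\<lambda>E. (ddiff x F E)\<^sup>2)"
    using insert by simp
  also have "\<dots> \<le> p * (1 - p) * (\<Sum>e\<in>I. bexp (insert x I) p (\<lambda>E. (ddiff e F E)\<^sup>2))
      + p * (1 - p) * bexp (insert x I) p (\<lambda>E. (ddiff x F E)\<^sup>2)"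
    using assms by (intro add_right_mono mult_left_mono sum_mono 4) auto
  also have "\<dots> = p * (1 - p) * (\<Sum>e\<in>insert x I. bexp (insert x I) p (\<lambda>E. (ddiff e F E)\<^sup>2))"
    using insert by (simp add: ring_distribs)
  finally show ?case .
qed simp

section \<open>Second-order Poincare inequality, discrete divergence, functions of the
  cardinality\<close>

context bernoulli_subset
begin

lemmas Ex_poincare = bernoulli_poincare[OF fin p_gt p_lt]

text \<open>When the constant and the linear part of \<open>F\<close> vanish, every first difference
  is centred, so the Poincare inequality applies to it once more and yields a second factor p * q.
  The diagonal disappears because \<open>ddiff e F\<close> does not depend on
  \<open>e\<close>.\<close>

lemma Ex_poincare2:
  assumes "Ex F = 0" "\<And>e. e \<in> I \<Longrightarrow> Ex (ddiff e F) = 0"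
  shows "Ex (\<lambda>E. (F E)\<^sup>2) \<le> (p * q)\<^sup>2 * (\<Sum>e\<in>I. \<Sum>f\<in>I - {e}. Ex (\<lambda>E. (ddiff f (ddiff e F) E)\<^sup>2))"
proof -
  have *: "Ex (\<lambda>E. (ddiff e F E)\<^sup>2) \<le> p * q * (\<Sum>f\<in>I - {e}. Ex (\<lambda>E. (ddiff f (ddiff e F) E)\<^sup>2))"
    if "e \<in> I" for e
  proof -
    have "ddiff e (ddiff e F) E = 0" for E by (simp add: ddiff_def)
    then have "(\<Sum>f\<in>I. Ex (\<lambda>E. (ddiff f (ddiff e F) E)\<^sup>2))
      = (\<Sum>f\<in>I - {e}. Ex (\<lambda>E. (ddiff f (ddiff e F) E)\<^sup>2))"
      using fin that by (subst sum.remove[of I e]) auto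
    then show ?thesis using Ex_poincare[of "ddiff e F"] assms(2)[OF that] by simp
  qed
  have "Ex (\<lambda>E. (F E)\<^sup>2) \<le> p * q * (\<Sum>e\<in>I. Ex (\<lambda>E. (ddiff e F E)\<^sup>2))"
    using Ex_poincare[of F] assms(1) by simp
  also have "\<dots> \<le> p * q * (\<Sum>e\<in>I. p * q * (\<Sum>f\<in>I - {e}. Ex (\<lambda>E. (ddiff f (ddiff e F) E)\<^sup>2)))"
    using pq_pos by (intro mult_left_mono sum_mono *) auto
  finally show ?thesis by (simp add: sum_distrib_left power2_eq_square mult_ac)
qed

text \<open>Skorohod isometry for the discrete divergence of the process \<open>G\<close>.\<close>

lemma Ex_divergence_sq:
  assumes indep: "\<And>e E. e \<in> I \<Longrightarrow> ddiff e (G e) E = 0"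
  shows "Ex (\<lambda>E. (\<Sum>e\<in>I. dev e E * G e E)\<^sup>2) = p * q * (\<Sum>e\<in>I. Ex (\<lambda>E. (G e E)\<^sup>2))
     + (p * q)\<^sup>2 * (\<Sum>e\<in>I. \<Sum>f\<in>I - {e}. Ex (\<lambda>E. ddiff f (G e) E * ddiff e (G f) E))"
proof -
  \<comment> \<open>\<open>G e\<close> ignores \<open>e\<close>, so it may be evaluated with or
    without \<open>e\<close> as convenient.\<close>
  have G: "G e (insert e E) = G e (E - {e})" if "e \<in> I" for e E
    using indep[OF that, of E] by (simp add: ddiff_def)
  have diag: "Ex (\<lambda>E. (dev e E * G e E) * (dev e E * G e E)) = p * q * Ex (\<lambda>E. (G e E)\<^sup>2)" if "e \<in> I" for e
  proof -
    have "Ex (\<lambda>E. (dev e E * G e E) * (dev e E * G e E)) = Ex (\<lambda>E. dev e E * (dev e E * (G e E)\<^sup>2))"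
      by (simp add: power2_eq_square mult_ac)
    also have "\<dots> = p * q * Ex (\<lambda>E. (G e (E - {e}))\<^sup>2)"
    proof -
      have "ddiff e (\<lambda>E. dev e E * (G e E)\<^sup>2) = (\<lambda>E. (G e (E - {e}))\<^sup>2)"
        using G[OF that] by (auto simp: ddiff_def algebra_simps fun_eq_iff)
      then show ?thesis by (simp only: Ex_ibp[OF that])
    qed
    also have "Ex (\<lambda>E. (G e (E - {e}))\<^sup>2) = Ex (\<lambda>E. (G e E)\<^sup>2)"
    proof -
      have "Ex (\<lambda>E. (G e E)\<^sup>2) = Ex (\<lambda>E. p * (G e (insert e E))\<^sup>2 + q * (G e (E - {e}))\<^sup>2)"
        by (rule Ex_resample[OF that])
      also have "\<dots> = Ex (\<lambda>E. (G e (E - {e}))\<^sup>2)"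
        using G[OF that] by (auto intro!: bexp_cong simp: algebra_simps)
      finally show ?thesis by simp
    qed
    finally show ?thesis .
  qed
  \<comment> \<open>Two integrations by parts. The one in \<open>e\<close> can only hit
    \<open>G f\<close>, the one in \<open>f\<close> only \<open>G e\<close>, because each process
    value ignores its own index.\<close>
  have off: "Ex (\<lambda>E. (dev e E * G e E) * (dev f E * G f E)) =
      (p * q)\<^sup>2 * Ex (\<lambda>E. ddiff f (G e) E * ddiff e (G f) E)" if "e \<in> I" "f \<in> I" "e \<noteq> f" for e f
  proof -
    have "Ex (\<lambda>E. (dev e E * G e E) * (dev f E * G f E)) = Ex (\<lambda>E. dev e E * (dev f E * G e E * G f E))"
      by (simp add: mult_ac)
    also have "\<dots> = p * q * Ex (ddiff e (\<lambda>E. dev f E * G e E * G f E))"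
      by (rule Ex_ibp[OF that(1)])
    also have "ddiff e (\<lambda>E. dev f E * G e E * G f E) = (\<lambda>E. dev f E * (G e (E - {e}) * ddiff e (G f) E))"
      using G[OF that(1)] that(3) by (auto simp: ddiff_def fun_eq_iff algebra_simps)
    also have "Ex \<dots> = p * q * Ex (ddiff f (\<lambda>E. G e (E - {e}) * ddiff e (G f) E))"
      by (rule Ex_ibp[OF that(2)])
    also have "ddiff f (\<lambda>E. G e (E - {e}) * ddiff e (G f) E)
      = (\<lambda>E. ddiff f (G e) (E - {e}) * ddiff e (G f) E)"
    proof
      fix E
      \<comment> \<open>Differences commute, so \<open>ddiff e (G f)\<close> inherits from
        \<open>G f\<close> that it ignores \<open>f\<close>.\<close>
      have z: "ddiff e (G f) (insert f E) = ddiff e (G f) (E - {f})"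
      proof -
        have "ddiff f (ddiff e (G f)) E = ddiff e (ddiff f (G f)) E" by (rule ddiff_commute)
        also have "\<dots> = 0" by (simp add: ddiff_def[of e] indep[OF that(2)])
        finally show ?thesis by (simp add: ddiff_def[of f "ddiff e (G f)"])
      qed
      then have z2: "ddiff e (G f) (E - {f}) = ddiff e (G f) E"
        by (rule ddiff_zero_remove)
      have "insert f E - {e} = insert f (E - {e})" "E - {f} - {e} = E - {e} - {f}" using that by auto
      then show "ddiff f (\<lambda>E. G e (E - {e}) * ddiff e (G f) E) E = ddiff f (G e) (E - {e}) * ddiff e (G f) E"
        using z z2 by (simp add: ddiff_def[of f] algebra_simps)
    qed
    also have "Ex \<dots> = Ex (\<lambda>E. ddiff f (G e) E * ddiff e (G f) E)"
    proof (rule bexp_cong)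
      fix E
      have "ddiff e (ddiff f (G e)) E = ddiff f (ddiff e (G e)) E" by (rule ddiff_commute)
      also have "\<dots> = 0" by (simp add: ddiff_def[of f] indep[OF that(1)])
      finally have "ddiff f (G e) (insert e E) = ddiff f (G e) (E - {e})"
        by (simp add: ddiff_def[of e "ddiff f (G e)"])
      then have "ddiff f (G e) (E - {e}) = ddiff f (G e) E"
        by (rule ddiff_zero_remove)
      then show "ddiff f (G e) (E - {e}) * ddiff e (G f) E = ddiff f (G e) E * ddiff e (G f) E" by simp
    qed
    finally show ?thesis by (simp add: power2_eq_square)
  qed
  have "Ex (\<lambda>E. (\<Sum>e\<in>I. dev e E * G e E)\<^sup>2) =
     (\<Sum>e\<in>I. \<Sum>f\<in>I. Ex (\<lambda>E. (dev e E * G e E) * (dev f E * G f E)))"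
    by (simp add: power2_eq_square sum_product bexp_sum)
  also have "\<dots> = (\<Sum>e\<in>I. p * q * Ex (\<lambda>E. (G e E)\<^sup>2)
     + (\<Sum>f\<in>I - {e}. (p * q)\<^sup>2 * Ex (\<lambda>E. ddiff f (G e) E * ddiff e (G f) E)))"
    using fin by (intro sum.cong refl) (auto simp: sum.remove diag intro!: sum.cong off)
  finally show ?thesis by (simp add: sum.distrib sum_distrib_left)
qed

text \<open>Split a superset of \<open>T\<close> into \<open>T\<close> and a subset of
  \<open>I - T\<close>; the weight factors accordingly. The right side involves \<open>T\<close>
  only through its complement and its size, which is what exchangeability arguments need.\<close>

lemma Ex_superset_card:
  assumes "T \<subseteq> I"
  shows "Ex (\<lambda>E. of_bool (T \<subseteq> E) * \<phi> (card E)) =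
    p ^ card T * bexp (I - T) p (\<lambda>E. \<phi> (card E + card T))"
proof -
  let ?w = "\<lambda>J E. p ^ card E * (1 - p) ^ card (J - E)"
  have inj: "inj_on ((\<union>) T) (Pow (I - T))" by (auto simp: inj_on_def)
  have im: "(\<union>) T ` Pow (I - T) = {E \<in> Pow I. T \<subseteq> E}"
  proof -
    have "E \<in> (\<union>) T ` Pow (I - T)" if "E \<subseteq> I" "T \<subseteq> E" for E
      using that by (intro image_eqI[of _ _ "E - T"]) auto
    then show ?thesis using assms by auto
  qed
  have "Ex (\<lambda>E. of_bool (T \<subseteq> E) * \<phi> (card E)) = (\<Sum>E\<in>{E \<in> Pow I. T \<subseteq> E}. ?w I E * \<phi> (card E))"
    unfolding bexp_def using fin by (intro sum.mono_neutral_cong_right) auto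
  also have "\<dots> = (\<Sum>E\<in>Pow (I - T). ?w I (T \<union> E) * \<phi> (card (T \<union> E)))"
    unfolding im[symmetric] using inj by (simp add: sum.reindex)
  also have "\<dots> = (\<Sum>E\<in>Pow (I - T). p ^ card T * (?w (I - T) E * \<phi> (card E + card T)))"
  proof (intro sum.cong refl)
    fix E assume "E \<in> Pow (I - T)"
    then have "card (T \<union> E) = card T + card E" "I - (T \<union> E) = I - T - E"
      using assms fin by (auto intro!: card_Un_disjoint intro: finite_subset)
    then show "?w I (T \<union> E) * \<phi> (card (T \<union> E)) = p ^ card T * (?w (I - T) E * \<phi> (card E + card T))"
      by (simp add: power_add add.commute)
  qed
  finally show ?thesis by (simp add: bexp_def sum_distrib_left)
qed

lemma Ex_superset:
  assumes "T \<subseteq> I"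
  shows "Ex (\<lambda>E. of_bool (T \<subseteq> E)) = p ^ card T"
  using Ex_superset_card[OF assms, of "\<lambda>_. 1"] fin by (simp add: bexp_const)

text \<open>Transport along a bijection between the two ground sets, which preserves the
  weights.\<close>

lemma Ex_card_cong:
  assumes "A \<subseteq> I" "B \<subseteq> I" "card A = card B"
  shows "bexp A p (\<lambda>E. \<phi> (card E)) = bexp B p (\<lambda>E. \<phi> (card E))"
proof -
  have finA: "finite A" and finB: "finite B" using assms fin finite_subset by auto
  obtain h where h: "bij_betw h A B" using finA finB assms(3) finite_same_card_bij by blast
  have bij: "bij_betw ((`) h) (Pow A) (Pow B)" using h by (rule bij_betw_Pow)
  have *: "card (h ` E) = card E" "card (B - h ` E) = card (A - E)" if "E \<subseteq> A" for E
  proof -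
    have inj: "inj_on h A" and im: "h ` A = B" using h by (auto simp: bij_betw_def)
    show "card (h ` E) = card E" using inj that by (meson card_image inj_on_subset)
    moreover have "h ` E \<subseteq> B" using that im by auto
    ultimately show "card (B - h ` E) = card (A - E)"
      using that finA finB assms(3) by (metis card_Diff_subset finite_subset)
  qed
  show ?thesis unfolding bexp_def
    by (subst sum.reindex_bij_betw[OF bij, symmetric]) (auto intro!: sum.cong simp: *)
qed

lemma Ex_exp_card: "Ex (\<lambda>E. exp (t * real (card E))) = (q + p * exp t) ^ card I"
proof -
  have "bexp J p (\<lambda>E. exp (t * real (card E))) = (q + p * exp t) ^ card J" if "finite J" for J :: "'a set"
    using that
  proof (induction J rule: finite_induct)
    case (insert x J)
    have "bexp (insert x J) p (\<lambda>E. exp (t * real (card E))) =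
      bexp J p (\<lambda>E. p * exp (t * real (card (insert x E))) + (1 - p) * exp (t * real (card E)))"
      using insert by (simp add: bexp_insert)
    also have "\<dots> = bexp J p (\<lambda>E. (q + p * exp t) * exp (t * real (card E)))"
    proof (rule bexp_cong)
      fix E assume "E \<subseteq> J"
      then have "card (insert x E) = Suc (card E)" using insert by (metis card_insert_disjoint finite_subset subsetD)
      then show "p * exp (t * real (card (insert x E))) + (1 - p) * exp (t * real (card E)) = (q + p * exp t) * exp (t * real (card E))"
        by (simp add: algebra_simps exp_add)
    qed
    finally show ?case using insert by (simp add: bexp_cmult)
  qed simp
  then show ?thesis using fin by blast
qed

text \<open>Apply x^4 <= 24 * exp x to x = \<open>card E\<close> / \<mu>, where \<mu> is the mean.
  The generating function at 1 / \<mu> is at most (1 + 2 * p / \<mu>)^\<open>card I\<close>, hence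
  at most exp 2, because exp (1 / \<mu>) <= 1 + 2 / \<mu> for \<mu> >= 1.\<close>

lemma Ex_card_pow4:
  assumes "real (card I) * p \<ge> 1"
  shows "Ex (\<lambda>E. real (card E) ^ 4) \<le> 24 * exp 2 * (real (card I) * p) ^ 4"
proof -
  define \<mu> where "\<mu> = real (card I) * p"
  have \<mu>: "\<mu> \<ge> 1" using assms by (simp add: \<mu>_def)
  have *: "x ^ 4 \<le> 24 * exp x" if "x \<ge> 0" for x :: real
  proof -
    have "(\<Sum>n<5. x ^ n / fact n) \<le> exp x"
      using that by (auto simp: exp_def scaleR_conv_of_real divide_inverse_commute
         intro!: sum_le_suminf summable_exp)
    moreover have "x ^ 4 / 24 \<le> (\<Sum>n<5. x ^ n / fact n)"
      using that by (simp add: eval_nat_numeral lessThan_Suc)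
    ultimately show ?thesis by simp
  qed
  have "Ex (\<lambda>E. real (card E) ^ 4) \<le> Ex (\<lambda>E. \<mu> ^ 4 * 24 * exp (1 / \<mu> * real (card E)))"
  proof (rule Ex_mono)
    fix E
    have "(real (card E) / \<mu>) ^ 4 \<le> 24 * exp (real (card E) / \<mu>)" using \<mu> by (intro *) auto
    then show "real (card E) ^ 4 \<le> \<mu> ^ 4 * 24 * exp (1 / \<mu> * real (card E))"
      using \<mu> by (simp add: field_simps)
  qed
  also have "\<dots> = \<mu> ^ 4 * 24 * (q + p * exp (1 / \<mu>)) ^ card I"
    by (simp only: bexp_cmult Ex_exp_card)
  also have "(q + p * exp (1 / \<mu>)) ^ card I \<le> exp 2"
  proof -
    have "exp (1 / \<mu>) \<le> 1 + 1 / \<mu> + (1 / \<mu>)\<^sup>2" using \<mu> by (intro exp_bound) auto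
    also have "(1 / \<mu>)\<^sup>2 \<le> 1 / \<mu>" using \<mu> by (simp add: power2_eq_square field_simps)
    finally have "p * exp (1 / \<mu>) \<le> p * (1 + 2 / \<mu>)" using p_gt by (intro mult_left_mono) auto
    then have "q + p * exp (1 / \<mu>) \<le> 1 + 2 * p / \<mu>" by (simp add: algebra_simps)
    also have "\<dots> \<le> exp (2 * p / \<mu>)" by (rule exp_ge_add_one_self)
    finally have "(q + p * exp (1 / \<mu>)) ^ card I \<le> exp (2 * p / \<mu>) ^ card I"
      using p_gt p_lt by (intro power_mono) auto
    also have "\<dots> = exp (real (card I) * (2 * p / \<mu>))" by (rule exp_of_nat_mult[symmetric])
    also have "real (card I) * (2 * p / \<mu>) = 2" using \<mu> p_gt by (simp add: \<mu>_def) (metis card_gt_0_iff mult_zero_left not_one_le_zero of_nat_0 gr0I card.empty)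
    finally show ?thesis .
  qed
  finally show ?thesis using \<mu> by (simp only: \<mu>_def[symmetric]) (simp add: mult_ac)
qed

end

section \<open>Stein's equation for the Kolmogorov distance\<close>

abbreviation gauss_cdf :: "real \<Rightarrow> real" where
  "gauss_cdf \<equiv> cdf std_normal_distribution"

section \<open>The normal distribution function and its density\<close>

lemma gauss_cdf_bounds: "0 \<le> gauss_cdf x" "gauss_cdf x \<le> 1"
proof -
  interpret real_distribution std_normal_distribution by (rule real_dist_normal_dist)
  show "0 \<le> gauss_cdf x" "gauss_cdf x \<le> 1" by (auto intro: cdf_nonneg cdf_bounded_prob)
qed

lemma gauss_cdf_mono: "x \<le> y \<Longrightarrow> gauss_cdf x \<le> gauss_cdf y"
proof -
  interpret real_distribution std_normal_distribution by (rule real_dist_normal_dist)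
  show "x \<le> y \<Longrightarrow> gauss_cdf x \<le> gauss_cdf y" by (rule cdf_nondecreasing)
qed

lemma gauss_cdf_at_top: "(gauss_cdf \<longlongrightarrow> 1) at_top"
proof -
  interpret real_distribution std_normal_distribution by (rule real_dist_normal_dist)
  show ?thesis by (rule cdf_lim_at_top_prob)
qed

lemma continuous_on_std_normal_density: "continuous_on A std_normal_density"
  unfolding std_normal_density_def by (intro continuous_intros) auto

text \<open>The half-lines are split at \<open>a\<close> with the atom at \<open>a\<close> kept
  separate, because the integral runs over a closed interval; the atom has measure zero.\<close>

lemma gauss_cdf_eq_integral:
  assumes "a \<le> x"
  shows "gauss_cdf x = gauss_cdf a + integral {a..x} std_normal_density"
proof -
  interpret real_distribution std_normal_distribution by (rule real_dist_normal_dist)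
  have int: "integrable lborel std_normal_density" by simp
  have si: "set_integrable lborel A std_normal_density" if "A \<in> sets borel" for A
    unfolding set_integrable_def by (rule integrable_mult_indicator) (use that int in auto)
  have meas: "measure std_normal_distribution A = (LINT y:A|lborel. std_normal_density y)"
    if "A \<in> sets borel" for A
  proof -
    have "measure std_normal_distribution A = (\<integral>y. indicator A y \<partial>std_normal_distribution)"
      using that by simp
    also have "\<dots> = (\<integral>y. std_normal_density y *\<^sub>R indicator A y \<partial>lborel)"
      by (rule integral_density) (use that in auto)
    finally show ?thesis by (simp add: set_lebesgue_integral_def mult.commute)
  qed
  have un: "{..x} = {..<a} \<union> {a..x}" using assms by auto
  have un': "{..a} = {..<a} \<union> {a}" by auto
  have "gauss_cdf x = measure std_normal_distribution {..<a} + measure std_normal_distribution {a..x}"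
    unfolding cdf_def un by (rule finite_measure_Union) auto
  moreover have "gauss_cdf a = measure std_normal_distribution {..<a} + measure std_normal_distribution {a}"
    unfolding cdf_def un' by (rule finite_measure_Union) auto
  moreover have "measure std_normal_distribution {a} = 0"
  proof -
    have "measure std_normal_distribution {a} = integral {a} std_normal_density"
      by (simp add: meas set_borel_integral_eq_integral(2)[OF si])
    then show ?thesis by simp
  qed
  moreover have "measure std_normal_distribution {a..x} = integral {a..x} std_normal_density"
    by (simp add: meas set_borel_integral_eq_integral(2)[OF si])
  ultimately show ?thesis by simp
qed

lemma has_real_derivative_gauss_cdf:
  "(gauss_cdf has_real_derivative std_normal_density x) (at x)"
proof -
  have "((\<lambda>y. integral {x - 1..y} std_normal_density) has_real_derivative std_normal_density x)
     (at x within {x - 1..x + 1})"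
    by (rule integral_has_real_derivative[OF continuous_on_std_normal_density]) auto
  then have "((\<lambda>y. integral {x - 1..y} std_normal_density) has_real_derivative std_normal_density x) (at x)"
    by (subst (asm) at_within_interior) auto
  then have "((\<lambda>y. gauss_cdf (x - 1) + integral {x - 1..y} std_normal_density)
      has_real_derivative std_normal_density x) (at x)"
    by (auto intro!: derivative_eq_intros)
  then show ?thesis
  proof (rule has_field_derivative_transform_within_open[of _ _ _ "{x - 1<..}"])
    show "gauss_cdf (x - 1) + integral {x - 1..y} std_normal_density = gauss_cdf y" if "y \<in> {x - 1<..}" for y
      using gauss_cdf_eq_integral[of "x - 1" y] that by simp
  qed auto
qed

lemma has_real_derivative_std_normal_density:
  "(std_normal_density has_real_derivative (- x * std_normal_density x)) (at x)"
proof -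
  have "((\<lambda>x::real. exp (- x\<^sup>2 / 2)) has_real_derivative (- x * exp (- x\<^sup>2 / 2))) (at x)"
    by (auto intro!: derivative_eq_intros)
  from DERIV_cmult[OF this, of "1 / sqrt (2 * pi)"] show ?thesis
    unfolding std_normal_density_def by (simp add: mult_ac)
qed

lemma std_normal_density_gt_0 [simp]: "std_normal_density x > 0"
  by (rule normal_density_pos) simp

text \<open>The density is even, so \<open>gauss_cdf x + gauss_cdf (- x)\<close> has derivative
  zero; its limit at infinity identifies the constant.\<close>

lemma gauss_cdf_uminus: "gauss_cdf (- x) = 1 - gauss_cdf x"
proof -
  have d: "((\<lambda>x. gauss_cdf x + gauss_cdf (- x)) has_real_derivative 0) (at x)" for x
  proof -
    have "((\<lambda>x. gauss_cdf x + gauss_cdf (- x)) has_real_derivative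
      std_normal_density x + std_normal_density (- x) * (- 1)) (at x)"
      by (intro DERIV_add has_real_derivative_gauss_cdf DERIV_chain2[OF has_real_derivative_gauss_cdf])
         (auto intro!: derivative_eq_intros)
    then show ?thesis by (simp add: std_normal_density_def)
  qed
  then have const: "gauss_cdf x + gauss_cdf (- x) = gauss_cdf y + gauss_cdf (- y)" for x y
    using DERIV_isconst_all by blast
  interpret real_distribution std_normal_distribution by (rule real_dist_normal_dist)
  have "((\<lambda>y. gauss_cdf y + gauss_cdf (- y)) \<longlongrightarrow> 1 + 0) at_top"
    by (intro tendsto_add gauss_cdf_at_top filterlim_compose[OF cdf_lim_at_bot] filterlim_uminus_at_bot_at_top)
  moreover have "(\<lambda>y. gauss_cdf y + gauss_cdf (- y)) = (\<lambda>_. gauss_cdf x + gauss_cdf (- x))"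
    using const[of _ x] by auto
  ultimately have "gauss_cdf x + gauss_cdf (- x) = 1"
    by (simp add: tendsto_const_iff)
  then show ?thesis by simp
qed

section \<open>The Mills ratio of the normal law and the solution of Stein's equation\<close>

definition mills :: "real \<Rightarrow> real" where
  "mills w = (1 - gauss_cdf w) / std_normal_density w"

lemma mills_nonneg: "0 \<le> mills w"
  unfolding mills_def using gauss_cdf_bounds[of w] by simp

text \<open>The difference of density / w and the upper tail has derivative - density / w^2 < 0 and
  tends to 0 at infinity, hence is nonnegative on the positive half-line.\<close>

lemma mult_mills_le: 
  assumes "w \<ge> 0"
  shows "w * mills w \<le> 1"
proof (cases "w = 0")
  case False
  then have w: "w > 0" using assms by simp
  define u where "u w = std_normal_density w / w - (1 - gauss_cdf w)" for w
  have d: "(u has_real_derivative (- std_normal_density x / x\<^sup>2)) (at x)" if "x > 0" for x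
    unfolding u_def
  proof -
    have "((\<lambda>w. std_normal_density w / w - (1 - gauss_cdf w)) has_real_derivative
      ((- x * std_normal_density x) * x - std_normal_density x * 1) / (x * x) - (0 - std_normal_density x)) (at x)"
      using that by (intro DERIV_diff DERIV_divide DERIV_const DERIV_ident has_real_derivative_gauss_cdf
          has_real_derivative_std_normal_density) auto
    then show "((\<lambda>w. std_normal_density w / w - (1 - gauss_cdf w)) has_real_derivative
      - std_normal_density x / x\<^sup>2) (at x)"
      by (rule DERIV_cong) (use that in \<open>auto simp: field_simps power2_eq_square\<close>)
  qed
  have dec: "u y \<le> u w" if "w \<le> y" for y
  proof (rule DERIV_nonpos_imp_nonincreasing[OF that])
    fix x assume "w \<le> x"
    then show "\<exists>d. (u has_real_derivative d) (at x) \<and> d \<le> 0"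
      using d[of x] w by (intro exI[of _ "- std_normal_density x / x\<^sup>2"]) auto
  qed
  have "(u \<longlongrightarrow> 0 - (1 - 1)) at_top"
    unfolding u_def
  proof (intro tendsto_diff tendsto_const gauss_cdf_at_top)
    show "((\<lambda>w. std_normal_density w / w) \<longlongrightarrow> 0) at_top"
    proof (rule tendsto_sandwich[OF _ _ tendsto_const tendsto_inverse_0_at_top[OF filterlim_ident]])
      show "\<forall>\<^sub>F y in at_top. 0 \<le> std_normal_density y / y"
        using eventually_gt_at_top[of 0] by eventually_elim simp
      have le1: "std_normal_density y \<le> 1" for y
      proof -
        have "1 \<le> sqrt (2 * pi)" using pi_gt3 by simp
        then have "1 / sqrt (2 * pi) * exp (- y\<^sup>2 / 2) \<le> 1 * 1"
          by (intro mult_mono) auto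
        then show ?thesis by (simp add: std_normal_density_def)
      qed
      show "\<forall>\<^sub>F y in at_top. std_normal_density y / y \<le> inverse y"
        using eventually_gt_at_top[of 0] by eventually_elim (use le1 in \<open>simp add: field_simps\<close>)
    qed
  qed
  moreover have "\<forall>\<^sub>F y in at_top. u y \<le> u w" using eventually_ge_at_top[of w] by eventually_elim (rule dec)
  ultimately have "0 \<le> u w" by (simp add: tendsto_upperbound)
  then show ?thesis using w unfolding u_def mills_def by (simp add: field_simps)
qed simp

text \<open>From 1 onwards \<open>mult_mills_le\<close> gives even the bound 1. Below 1 the density
  is at least 1/3 * 1/2, since sqrt (2 * pi) <= 3 and exp (- w^2 / 2) >= 1/2; this is the origin of
  the 6.\<close>

lemma mills_le:
  assumes "w \<ge> 0"
  shows "mills w \<le> 6"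
proof (cases "w \<ge> 1")
  case True
  then have "mills w \<le> w * mills w" using mills_nonneg[of w] by (simp add: mult_le_cancel_right1)
  then show ?thesis using mult_mills_le[OF assms] by simp
next
  case False
  have "sqrt (2 * pi) \<le> sqrt 9" using pi_less_4 by (intro real_sqrt_le_mono) simp
  then have 1: "1 / 3 \<le> 1 / sqrt (2 * pi)" by (simp add: field_simps)
  have "w\<^sup>2 \<le> 1" using False assms by (simp add: power_le_one)
  then have "1 / 2 \<le> 1 + (- w\<^sup>2 / 2)" by simp
  also have "\<dots> \<le> exp (- w\<^sup>2 / 2)" by (rule exp_ge_add_one_self)
  finally have "1 / 3 * (1 / 2) \<le> std_normal_density w"
    unfolding std_normal_density_def using 1 by (intro mult_mono) auto
  then have "1 \<le> 6 * std_normal_density w" by simp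
  moreover have "1 - gauss_cdf w \<le> 1" using gauss_cdf_bounds[of w] by simp
  ultimately have "1 - gauss_cdf w \<le> 6 * std_normal_density w" by linarith
  then show ?thesis by (simp add: mills_def divide_le_eq)
qed

text \<open>The solution of Stein's equation \<open>f' w - w f w = of_bool (w \<le> z) - gauss_cdf z\<close>.\<close>

definition stein_sol :: "real \<Rightarrow> real \<Rightarrow> real" where
  "stein_sol z w = (if w \<le> z then (1 - gauss_cdf z) * mills (- w) else gauss_cdf z * mills w)"

lemma mills_uminus: "mills (- w) = gauss_cdf w / std_normal_density w"
proof -
  have "std_normal_density (- w) = std_normal_density w" by (simp add: std_normal_density_def)
  then show ?thesis by (simp only: mills_def gauss_cdf_uminus) simp
qed

text \<open>Serves both branches of \<open>stein_sol\<close>, since the right branch is a reflected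
  left one. For positive \<open>w\<close> the factor \<open>mills (- w)\<close> grows fast, but
  \<open>c\<close> is then at most the ratio of upper to lower tail at \<open>w\<close>, which
  brings the product below \<open>mills w\<close>.\<close>

lemma mills_bound_sym:
  assumes "w \<le> 0 \<or> c * gauss_cdf w \<le> 1 - gauss_cdf w" "0 \<le> c" "c \<le> 1"
  shows "c * mills (- w) \<le> 6" "\<bar>w\<bar> * (c * mills (- w)) \<le> 1"
proof -
  have "c * mills (- w) \<le> mills \<bar>w\<bar>"
  proof (cases "w \<le> 0")
    case True
    then show ?thesis using assms mills_nonneg[of "- w"] by (simp add: mult_left_le_one_le)
  next
    case False
    then have "c * gauss_cdf w \<le> 1 - gauss_cdf w" using assms(1) by simp
    then show ?thesis using False unfolding mills_uminus
      by (simp add: mills_def divide_right_mono)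
  qed
  moreover have "mills \<bar>w\<bar> \<le> 6" "\<bar>w\<bar> * mills \<bar>w\<bar> \<le> 1" by (simp_all add: mills_le mult_mills_le)
  ultimately show "c * mills (- w) \<le> 6" "\<bar>w\<bar> * (c * mills (- w)) \<le> 1"
    using mult_left_mono[of "c * mills (- w)" "mills \<bar>w\<bar>" "\<bar>w\<bar>"] by linarith+
qed

lemma stein_sol_bounds: "\<bar>stein_sol z w\<bar> \<le> 6" "\<bar>w * stein_sol z w\<bar> \<le> 1"
proof -
  have "0 \<le> stein_sol z w \<and> stein_sol z w \<le> 6 \<and> \<bar>w\<bar> * stein_sol z w \<le> 1"
  proof (cases "w \<le> z")
    case True
    have "gauss_cdf w * (1 - gauss_cdf z) \<le> 1 * (1 - gauss_cdf w)"
      using gauss_cdf_mono[OF True] gauss_cdf_bounds[of w] gauss_cdf_bounds[of z] by (intro mult_mono) auto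
    then have "(1 - gauss_cdf z) * gauss_cdf w \<le> 1 - gauss_cdf w" by (simp add: mult.commute)
    then show ?thesis
      using mills_bound_sym[of w "1 - gauss_cdf z"] gauss_cdf_bounds[of z] mills_nonneg[of "- w"] True
      by (simp add: stein_sol_def)
  next
    case False
    have "gauss_cdf z * (1 - gauss_cdf w) \<le> gauss_cdf w * 1"
      using gauss_cdf_mono[of z w] False gauss_cdf_bounds[of w] by (intro mult_mono) auto
    then have "gauss_cdf z * gauss_cdf (- w) \<le> 1 - gauss_cdf (- w)"
      by (simp add: gauss_cdf_uminus)
    then show ?thesis
      using mills_bound_sym[of "- w" "gauss_cdf z"] gauss_cdf_bounds[of z] mills_nonneg[of w] False
      by (simp add: stein_sol_def)
  qed
  then show "\<bar>stein_sol z w\<bar> \<le> 6" "\<bar>w * stein_sol z w\<bar> \<le> 1" by (auto simp: abs_mult)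
qed

lemma has_real_derivative_mills: "(mills has_real_derivative (w * mills w - 1)) (at w)"
proof -
  have "(mills has_real_derivative ((0 - std_normal_density w) * std_normal_density w
     - (1 - gauss_cdf w) * (- w * std_normal_density w)) / (std_normal_density w * std_normal_density w)) (at w)"
    unfolding mills_def[abs_def]
    by (intro DERIV_divide DERIV_diff DERIV_const has_real_derivative_gauss_cdf has_real_derivative_std_normal_density)
       (simp add: less_imp_neq[OF std_normal_density_gt_0, symmetric])
  then show ?thesis by (rule DERIV_cong) (auto simp: mills_def less_imp_neq[OF std_normal_density_gt_0, symmetric] field_simps)
qed

text \<open>The solution is smooth on each side of \<open>z\<close>, and \<open>k\<close> is the
  value of the indicator belonging to that side. At an end point equal to \<open>z\<close> the value
  of \<open>k\<close> is the one of the adjacent side, so closed intervals touching \<open>z\<close>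
  are allowed from both directions.\<close>

lemma stein_sol_mvt:
  assumes "a \<le> b" "b \<le> z \<and> k = 1 \<or> z \<le> a \<and> k = 0"
  shows "\<exists>\<xi>\<in>{a..b}. stein_sol z b - stein_sol z a = (b - a) * (\<xi> * stein_sol z \<xi> + k - gauss_cdf z)"
proof (cases "a = b")
  case False
  then have ab: "a < b" using assms by simp
  define g where "g w = (if k = 1 then (1 - gauss_cdf z) * mills (- w) else gauss_cdf z * mills w)" for w
  have eq: "stein_sol z w = g w" if "w \<in> {a..b}" for w
  proof (cases "w = z")
    case True
    \<comment> \<open>The two branches of the solution agree at \<open>z\<close>.\<close>
    show ?thesis unfolding g_def stein_sol_def True mills_uminus by (auto simp: mills_def)
  next
    case False
    then show ?thesis using that assms by (auto simp: stein_sol_def g_def)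
  qed
  have 1: "((\<lambda>w. mills (- w)) has_real_derivative (1 + w * mills (- w))) (at w)" for w
  proof -
    have "((\<lambda>w. mills (- w)) has_real_derivative (- w * mills (- w) - 1) * (- 1)) (at w)"
      by (rule DERIV_chain'[of uminus, OF _ has_real_derivative_mills]) (auto intro!: derivative_eq_intros)
    then show ?thesis by (simp add: algebra_simps)
  qed
  have "(g has_real_derivative (w * g w + k - gauss_cdf z)) (at w)" for w
  proof (cases "k = 1")
    case True
    have "((\<lambda>w. (1 - gauss_cdf z) * mills (- w)) has_real_derivative (1 - gauss_cdf z) * (1 + w * mills (- w))) (at w)"
      by (intro DERIV_cmult 1)
    then show ?thesis using True by (simp add: g_def[abs_def] algebra_simps)
  next
    case False
    then have "k = 0" using assms by simp
    have "((\<lambda>w. gauss_cdf z * mills w) has_real_derivative gauss_cdf z * (w * mills w - 1)) (at w)"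
      by (intro DERIV_cmult has_real_derivative_mills)
    then show ?thesis using \<open>k = 0\<close> by (simp add: g_def[abs_def] algebra_simps)
  qed
  then obtain \<xi> where "\<xi> > a" "\<xi> < b" "g b - g a = (b - a) * (\<xi> * g \<xi> + k - gauss_cdf z)"
    using MVT2[OF ab, of g "\<lambda>w. w * g w + k - gauss_cdf z"] by blast
  then show ?thesis using eq by (intro bexI[of _ \<xi>]) auto
qed auto

text \<open>By Stein's equation the derivative is a term bounded by 1 plus a difference of two
  numbers in [0, 1]. An interval containing \<open>z\<close> is cut there.\<close>

lemma stein_sol_lipschitz: "\<bar>stein_sol z b - stein_sol z a\<bar> \<le> 2 * \<bar>b - a\<bar>"
proof -
  have piece: "\<bar>stein_sol z b - stein_sol z a\<bar> \<le> 2 * (b - a)" if le: "a \<le> b" "b \<le> z \<or> z \<le> a" for a b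
  proof -
    obtain k :: real where k: "b \<le> z \<and> k = 1 \<or> z \<le> a \<and> k = 0" using \<open>b \<le> z \<or> z \<le> a\<close> by blast
    obtain \<xi> where \<xi>: "stein_sol z b - stein_sol z a = (b - a) * (\<xi> * stein_sol z \<xi> + k - gauss_cdf z)"
      using stein_sol_mvt[OF le(1) k] by blast
    have "\<bar>\<xi> * stein_sol z \<xi> + k - gauss_cdf z\<bar> \<le> 2"
      using stein_sol_bounds(2)[of \<xi> z] gauss_cdf_bounds[of z] k by auto
    then have "\<bar>b - a\<bar> * \<bar>\<xi> * stein_sol z \<xi> + k - gauss_cdf z\<bar> \<le> \<bar>b - a\<bar> * 2" by (rule mult_left_mono) auto
    then show ?thesis using that(1) by (simp add: \<xi> abs_mult)
  qed
  have ordered: "\<bar>stein_sol z b - stein_sol z a\<bar> \<le> 2 * (b - a)" if "a \<le> b" for a b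
  proof (cases "b \<le> z \<or> z \<le> a")
    case True then show ?thesis using piece that by blast
  next
    case False
    then show ?thesis using piece[of a z] piece[of z b] by auto
  qed
  show ?thesis
  proof (cases "a \<le> b")
    case True then show ?thesis using ordered[of a b] by simp
  next
    case False then show ?thesis using ordered[of b a] by (simp add: abs_minus_commute)
  qed
qed

text \<open>The factor of \<open>v - w\<close> on the left is the derivative of the solution at
  \<open>x\<close>, by Stein's equation. The product subtracted on the right is never positive: it
  is -|v - w| if \<open>z\<close> separates \<open>v\<close> from \<open>w\<close> and 0 otherwise,
  so the jump of the derivative costs at most |v - w|. Writing this cost as a product of two
  increments makes it accessible to integration by parts.\<close>

lemma stein_sol_increment:
  assumes "x = v \<or> x = w"
  shows "\<bar>stein_sol z v - stein_sol z w - (v - w) * (x * stein_sol z x + of_bool (x \<le> z) - gauss_cdf z)\<bar>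
    \<le> (2 * \<bar>x\<bar> + 6) * (v - w)\<^sup>2 - (v - w) * (of_bool (v \<le> z) - of_bool (w \<le> z))"
proof -
  have ordered: "\<bar>stein_sol z v - stein_sol z w - (v - w) * (x * stein_sol z x + of_bool (x \<le> z) - gauss_cdf z)\<bar>
    \<le> (2 * \<bar>x\<bar> + 6) * (v - w)\<^sup>2 - (v - w) * (of_bool (v \<le> z) - of_bool (w \<le> z))"
    if "w \<le> v" "x = v \<or> x = w" for v w
  proof -
    let ?g = "\<lambda>k. x * stein_sol z x + k - gauss_cdf z"
    have piece: "\<bar>stein_sol z b - stein_sol z a - (b - a) * ?g k\<bar> \<le> (b - a) * ((2 * \<bar>x\<bar> + 6) * (v - w))"
      if ab: "a \<le> b" "b \<le> z \<and> k = 1 \<or> z \<le> a \<and> k = 0" "w \<le> a" "b \<le> v" for a b k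
    proof -
      obtain \<xi> where \<xi>: "\<xi> \<in> {a..b}"
        "stein_sol z b - stein_sol z a = (b - a) * (\<xi> * stein_sol z \<xi> + k - gauss_cdf z)"
        using stein_sol_mvt[OF ab(1,2)] by blast
      have d: "\<bar>\<xi> - x\<bar> \<le> v - w" using \<xi>(1) ab \<open>x = v \<or> x = w\<close> by auto
      \<comment> \<open>Vary the two factors of the product separately: the solution is 2-Lipschitz
        and bounded by 6, whence the factor \<open>2 * \<bar>x\<bar> + 6\<close>.\<close>
      have "\<xi> * stein_sol z \<xi> - x * stein_sol z x = x * (stein_sol z \<xi> - stein_sol z x) + (\<xi> - x) * stein_sol z \<xi>"
        by (simp add: algebra_simps)
      also have "\<bar>\<dots>\<bar> \<le> \<bar>x\<bar> * \<bar>stein_sol z \<xi> - stein_sol z x\<bar> + \<bar>\<xi> - x\<bar> * \<bar>stein_sol z \<xi>\<bar>"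
        by (metis abs_triangle_ineq abs_mult)
      also have "\<dots> \<le> \<bar>x\<bar> * (2 * \<bar>\<xi> - x\<bar>) + \<bar>\<xi> - x\<bar> * 6"
        by (intro add_mono mult_left_mono stein_sol_lipschitz stein_sol_bounds) auto
      also have "\<dots> = (2 * \<bar>x\<bar> + 6) * \<bar>\<xi> - x\<bar>" by (simp add: algebra_simps)
      also have "\<dots> \<le> (2 * \<bar>x\<bar> + 6) * (v - w)" by (intro mult_left_mono d) auto
      finally have "(b - a) * \<bar>\<xi> * stein_sol z \<xi> - x * stein_sol z x\<bar> \<le> (b - a) * ((2 * \<bar>x\<bar> + 6) * (v - w))"
        using ab by (intro mult_left_mono) auto
      moreover have "stein_sol z b - stein_sol z a - (b - a) * ?g k
         = (b - a) * (\<xi> * stein_sol z \<xi> - x * stein_sol z x)"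
        unfolding \<xi>(2) by (simp add: algebra_simps)
      ultimately show ?thesis using ab(1) by (simp add: abs_mult)
    qed
    consider "v \<le> z" | "z < w" | "w \<le> z" "z < v" using \<open>w \<le> v\<close> by linarith
    then show ?thesis
    proof cases
      case 1
      then have "x \<le> z" "w \<le> z" using that by auto
      then show ?thesis using piece[of w v 1] 1 \<open>w \<le> v\<close> by (simp add: power2_eq_square mult_ac)
    next
      case 2
      then have "\<not> x \<le> z" "\<not> w \<le> z" "\<not> v \<le> z" using that by auto
      then show ?thesis using piece[of w v 0] 2 \<open>w \<le> v\<close> by (simp add: power2_eq_square mult_ac)
    next
      case 3
      define h :: real where "h = of_bool (x \<le> z)"
      have h: "h = 0 \<or> h = 1" by (simp add: h_def)
      define P1 where "P1 = stein_sol z z - stein_sol z w - (z - w) * ?g 1"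
      define P2 where "P2 = stein_sol z v - stein_sol z z - (v - z) * ?g 0"
      have P: "\<bar>P1\<bar> \<le> (z - w) * ((2 * \<bar>x\<bar> + 6) * (v - w))" "\<bar>P2\<bar> \<le> (v - z) * ((2 * \<bar>x\<bar> + 6) * (v - w))"
        unfolding P1_def P2_def using piece[of w z 1] piece[of z v 0] 3 by auto
      \<comment> \<open>Cut at \<open>z\<close>. On one of the two pieces \<open>h\<close> is the
        wrong value of the indicator, and this costs the length of that piece.\<close>
      have eq: "stein_sol z v - stein_sol z w - (v - w) * ?g h = P1 + P2 + (z - w) * (1 - h) + (v - z) * (0 - h)"
        unfolding P1_def P2_def by (simp add: algebra_simps)
      have "\<bar>(z - w) * (1 - h) + (v - z) * (0 - h)\<bar> \<le> v - w" using h 3 by auto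
      moreover have "\<bar>P1\<bar> + \<bar>P2\<bar> \<le> (2 * \<bar>x\<bar> + 6) * (v - w)\<^sup>2"
        using P by (simp add: power2_eq_square algebra_simps)
      ultimately have "\<bar>stein_sol z v - stein_sol z w - (v - w) * ?g h\<bar> \<le> (2 * \<bar>x\<bar> + 6) * (v - w)\<^sup>2 + (v - w)"
        unfolding eq by linarith
      then show ?thesis unfolding h_def using 3 by simp
    qed
  qed
  show ?thesis
  proof (cases "w \<le> v")
    case True then show ?thesis using ordered assms by blast
  next
    case False
    let ?G = "x * stein_sol z x + of_bool (x \<le> z) - gauss_cdf z"
    have "stein_sol z v - stein_sol z w - (v - w) * ?G = - (stein_sol z w - stein_sol z v - (w - v) * ?G)"
      by (simp add: algebra_simps)
    then have "\<bar>stein_sol z v - stein_sol z w - (v - w) * ?G\<bar> = \<bar>stein_sol z w - stein_sol z v - (w - v) * ?G\<bar>"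
      by (metis abs_minus_cancel)
    also have "\<dots> \<le> (2 * \<bar>x\<bar> + 6) * (w - v)\<^sup>2 - (w - v) * (of_bool (w \<le> z) - of_bool (v \<le> z))"
      using assms False by (intro ordered) auto
    also have "(w - v) * (of_bool (w \<le> z) - of_bool (v \<le> z)) = (v - w) * (of_bool (v \<le> z) - of_bool (w \<le> z))"
      by (rule minus_mult_minus[of "v - w" "of_bool (v \<le> z) - of_bool (w \<le> z)", simplified minus_diff_eq])
    finally show ?thesis by (simp add: power2_commute)
  qed
qed

section \<open>A Berry-Esseen bound for functions of a random subset\<close>

context bernoulli_subset
begin

abbreviation cdev :: "'a set \<Rightarrow> real" where
  "cdev E \<equiv> real (card E) - real (card I) * p"

lemma cdev_eq_sum: "E \<subseteq> I \<Longrightarrow> cdev E = (\<Sum>e\<in>I. dev e E)"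
  using fin by (simp add: sum_subtractf Int_absorb1 of_bool_def sum.If_cases inf.absorb2)

lemma Ex_cdev_mult: "Ex (\<lambda>E. cdev E * F E) = p * q * (\<Sum>e\<in>I. Ex (ddiff e F))"
proof -
  have "Ex (\<lambda>E. cdev E * F E) = Ex (\<lambda>E. \<Sum>e\<in>I. dev e E * F E)"
    by (rule bexp_cong) (simp only: cdev_eq_sum sum_distrib_right)
  then show ?thesis by (simp add: bexp_sum Ex_ibp sum_distrib_left)
qed

lemma Ex_cdev_sq: "Ex (\<lambda>E. (cdev E)\<^sup>2) = real (card I) * (p * q)"
proof -
  have "Ex (\<lambda>E. (cdev E)\<^sup>2) = Ex (\<lambda>E. (\<Sum>e\<in>I. dev e E * 1)\<^sup>2)"
    by (rule bexp_cong) (simp only: cdev_eq_sum mult_1_right)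
  then show ?thesis by (subst (asm) Ex_divergence_sq) (simp_all add: ddiff_def)
qed

text \<open>\<open>F\<close> is independent of the membership of \<open>e\<close>, and the centred
  indicator has mean absolute value p * q + q * p.\<close>

lemma Ex_abs_dev_mult:
  assumes "e \<in> I" "ddiff e F = (\<lambda>_. 0)"
  shows "Ex (\<lambda>E. \<bar>dev e E * F E\<bar>) = 2 * (p * q) * Ex (\<lambda>E. \<bar>F E\<bar>)"
proof -
  have F: "F (insert e E) = F (E - {e})" for E using fun_cong[OF assms(2), of E] by (simp add: ddiff_def)
  have "Ex (\<lambda>E. \<bar>dev e E * F E\<bar>) = Ex (\<lambda>E. p * \<bar>dev e (insert e E) * F (insert e E)\<bar>
     + q * \<bar>dev e (E - {e}) * F (E - {e})\<bar>)" by (rule Ex_resample[OF assms(1)])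
  also have "\<dots> = Ex (\<lambda>E. 2 * (p * q) * \<bar>F E\<bar>)"
  proof (rule bexp_cong)
    fix E
    show "p * \<bar>dev e (insert e E) * F (insert e E)\<bar> + q * \<bar>dev e (E - {e}) * F (E - {e})\<bar> = 2 * (p * q) * \<bar>F E\<bar>"
      using p_gt p_lt by (simp add: F ddiff_zero_remove[of F, OF F] abs_mult)
  qed
  finally show ?thesis by (simp add: bexp_cmult)
qed

lemma Ex_abs_centered_le: "Ex (\<lambda>E. \<bar>F E - Ex F\<bar>) \<le> 2 * Ex (\<lambda>E. \<bar>F E\<bar>)"
proof -
  have "Ex (\<lambda>E. \<bar>F E - Ex F\<bar>) \<le> Ex (\<lambda>E. \<bar>F E\<bar> + \<bar>Ex F\<bar>)" by (rule Ex_mono) simp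
  then show ?thesis using Ex_abs_le[of F] by (simp add: bexp_add)
qed

text \<open>Insert \<open>W\<close> into Stein's equation and split off \<open>c * cdev\<close>.
  Integration by parts turns this part into a sum of differences of the composed Stein solution,
  which \<open>stein_sol_increment\<close> compares with \<open>ddiff e W\<close> times its
  derivative. The four terms are the deviation of the resulting weight from 1, the nonlinear rest of
  \<open>W\<close>, the quadratic error, and the jump of the derivative.\<close>

theorem stein_bound:
  fixes W :: "'a set \<Rightarrow> real" and c z :: real
  shows "\<bar>Ex (\<lambda>E. of_bool (W E \<le> z)) - gauss_cdf z\<bar>
    \<le> 2 * Ex (\<lambda>E. \<bar>1 - c * (p * q) * (\<Sum>e\<in>I. ddiff e W E)\<bar>)
      + \<bar>Ex (\<lambda>E. (W E - c * cdev E) * stein_sol z (W E))\<bar>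
      + \<bar>c\<bar> * (p * q) * (\<Sum>e\<in>I. Ex (\<lambda>E. (2 * \<bar>W E\<bar> + 6) * (ddiff e W E)\<^sup>2))
      + \<bar>c\<bar> * Ex (\<lambda>E. \<bar>\<Sum>e\<in>I. dev e E * ddiff e W E\<bar>)"
proof -
  define f where "f = stein_sol z"
  define g where "g x = x * f x + of_bool (x \<le> z) - gauss_cdf z" for x
  define D where "D e = ddiff e W" for e
  define J where "J E = (of_bool (W E \<le> z) :: real)" for E
  define err where "err e E = ddiff e (\<lambda>E. f (W E)) E - D e E * g (W E)" for e E
  have g_le: "\<bar>g x\<bar> \<le> 2" for x
    using stein_sol_bounds(2)[of x z] gauss_cdf_bounds[of z] unfolding g_def f_def by auto
  have err: "\<bar>err e E\<bar> \<le> (2 * \<bar>W E\<bar> + 6) * (D e E)\<^sup>2 - D e E * ddiff e J E" for e E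
  proof -
    have "W E = W (insert e E) \<or> W E = W (E - {e})" by (cases "e \<in> E") (simp_all add: insert_absorb)
    from stein_sol_increment[OF this, of z] show ?thesis
      unfolding err_def ddiff_def D_def g_def f_def J_def by simp
  qed
  have 1: "Ex (\<lambda>E. of_bool (W E \<le> z)) - gauss_cdf z = Ex (\<lambda>E. g (W E)) - Ex (\<lambda>E. W E * f (W E))"
    unfolding g_def by (simp add: bexp_add bexp_diff)
  have "Ex (\<lambda>E. W E * f (W E)) = Ex (\<lambda>E. c * (cdev E * f (W E)) + (W E - c * cdev E) * f (W E))"
    by (simp add: algebra_simps)
  also have "\<dots> = c * (p * q) * (\<Sum>e\<in>I. Ex (\<lambda>E. ddiff e (\<lambda>E. f (W E)) E)) + Ex (\<lambda>E. (W E - c * cdev E) * f (W E))"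
    by (simp add: bexp_add bexp_cmult Ex_cdev_mult)
  also have "(\<Sum>e\<in>I. Ex (\<lambda>E. ddiff e (\<lambda>E. f (W E)) E)) = (\<Sum>e\<in>I. Ex (\<lambda>E. D e E * g (W E) + err e E))"
    by (simp add: err_def)
  also have "\<dots> = Ex (\<lambda>E. (\<Sum>e\<in>I. D e E) * g (W E)) + (\<Sum>e\<in>I. Ex (err e))"
    by (simp add: bexp_add sum.distrib bexp_sum sum_distrib_right)
  finally have 2: "Ex (\<lambda>E. of_bool (W E \<le> z)) - gauss_cdf z =
     (Ex (\<lambda>E. g (W E)) - c * (p * q) * Ex (\<lambda>E. (\<Sum>e\<in>I. D e E) * g (W E)))
     - Ex (\<lambda>E. (W E - c * cdev E) * f (W E)) - c * (p * q) * (\<Sum>e\<in>I. Ex (err e))"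
    unfolding 1 by (simp add: algebra_simps)
  have "Ex (\<lambda>E. g (W E)) - c * (p * q) * Ex (\<lambda>E. (\<Sum>e\<in>I. D e E) * g (W E))
     = Ex (\<lambda>E. g (W E) - c * (p * q) * ((\<Sum>e\<in>I. D e E) * g (W E)))"
    by (simp only: bexp_diff bexp_cmult)
  also have "\<dots> = Ex (\<lambda>E. (1 - c * (p * q) * (\<Sum>e\<in>I. D e E)) * g (W E))"
    by (simp add: algebra_simps)
  also have "\<bar>\<dots>\<bar> \<le> Ex (\<lambda>E. \<bar>(1 - c * (p * q) * (\<Sum>e\<in>I. D e E)) * g (W E)\<bar>)" by (rule Ex_abs_le)
  also have "\<dots> \<le> Ex (\<lambda>E. 2 * \<bar>1 - c * (p * q) * (\<Sum>e\<in>I. D e E)\<bar>)"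
  proof (rule Ex_mono)
    fix E
    have "\<bar>1 - c * (p * q) * (\<Sum>e\<in>I. D e E)\<bar> * \<bar>g (W E)\<bar> \<le> \<bar>1 - c * (p * q) * (\<Sum>e\<in>I. D e E)\<bar> * 2"
      by (intro mult_left_mono g_le) auto
    then show "\<bar>(1 - c * (p * q) * (\<Sum>e\<in>I. D e E)) * g (W E)\<bar> \<le> 2 * \<bar>1 - c * (p * q) * (\<Sum>e\<in>I. D e E)\<bar>"
      by (simp add: abs_mult)
  qed
  finally have T1: "\<bar>Ex (\<lambda>E. g (W E)) - c * (p * q) * Ex (\<lambda>E. (\<Sum>e\<in>I. D e E) * g (W E))\<bar>
     \<le> 2 * Ex (\<lambda>E. \<bar>1 - c * (p * q) * (\<Sum>e\<in>I. D e E)\<bar>)" by (simp add: bexp_cmult)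
  \<comment> \<open>\<open>D e\<close> ignores \<open>e\<close>, so this is integration by parts
    read backwards. Absolute values are taken only after summing over \<open>e\<close>, which keeps
    the cancellation in the divergence.\<close>
  have jump: "p * q * Ex (\<lambda>E. D e E * ddiff e J E) = Ex (\<lambda>E. dev e E * (D e E * J E))" if "e \<in> I" for e
  proof -
    have "ddiff e (\<lambda>E. D e E * J E) = (\<lambda>E. D e E * ddiff e J E)"
    proof
      fix E
      show "ddiff e (\<lambda>E. D e E * J E) E = D e E * ddiff e J E"
        by (subst (1 2) ddiff_def) (simp add: D_def algebra_simps)
    qed
    then show ?thesis using Ex_ibp[OF that, of "\<lambda>E. D e E * J E"] by simp
  qed
  have "\<bar>\<Sum>e\<in>I. Ex (err e)\<bar> \<le> (\<Sum>e\<in>I. Ex (\<lambda>E. (2 * \<bar>W E\<bar> + 6) * (D e E)\<^sup>2 - D e E * ddiff e J E))"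
    by (rule order_trans[OF sum_abs], intro sum_mono order_trans[OF Ex_abs_le] Ex_mono err)
  then have "p * q * \<bar>\<Sum>e\<in>I. Ex (err e)\<bar>
    \<le> p * q * (\<Sum>e\<in>I. Ex (\<lambda>E. (2 * \<bar>W E\<bar> + 6) * (D e E)\<^sup>2) - Ex (\<lambda>E. D e E * ddiff e J E))"
    using pq_pos by (intro mult_left_mono) (simp_all add: bexp_diff)
  also have "\<dots> = p * q * (\<Sum>e\<in>I. Ex (\<lambda>E. (2 * \<bar>W E\<bar> + 6) * (D e E)\<^sup>2)) - (\<Sum>e\<in>I. p * q * Ex (\<lambda>E. D e E * ddiff e J E))"
    by (simp add: sum_subtractf sum_distrib_left right_diff_distrib)
  also have "(\<Sum>e\<in>I. p * q * Ex (\<lambda>E. D e E * ddiff e J E)) = Ex (\<lambda>E. (\<Sum>e\<in>I. dev e E * D e E) * J E)"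
    by (simp only: sum.cong[OF refl jump] bexp_sum[symmetric] sum_distrib_right mult.assoc[of "dev _ _"])
  also have "p * q * (\<Sum>e\<in>I. Ex (\<lambda>E. (2 * \<bar>W E\<bar> + 6) * (D e E)\<^sup>2)) - Ex (\<lambda>E. (\<Sum>e\<in>I. dev e E * D e E) * J E)
    \<le> p * q * (\<Sum>e\<in>I. Ex (\<lambda>E. (2 * \<bar>W E\<bar> + 6) * (D e E)\<^sup>2)) + Ex (\<lambda>E. \<bar>\<Sum>e\<in>I. dev e E * D e E\<bar>)"
  proof -
    have "\<bar>Ex (\<lambda>E. (\<Sum>e\<in>I. dev e E * D e E) * J E)\<bar> \<le> Ex (\<lambda>E. \<bar>(\<Sum>e\<in>I. dev e E * D e E) * J E\<bar>)" by (rule Ex_abs_le)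
    also have "\<dots> \<le> Ex (\<lambda>E. \<bar>\<Sum>e\<in>I. dev e E * D e E\<bar>)"
      by (rule Ex_mono) (simp add: J_def abs_mult)
    finally show ?thesis by linarith
  qed
  finally have *: "\<bar>c\<bar> * (p * q * \<bar>\<Sum>e\<in>I. Ex (err e)\<bar>) \<le> \<bar>c\<bar> * (p * q * (\<Sum>e\<in>I. Ex (\<lambda>E. (2 * \<bar>W E\<bar> + 6) * (D e E)\<^sup>2))
    + Ex (\<lambda>E. \<bar>\<Sum>e\<in>I. dev e E * D e E\<bar>))" by (rule mult_left_mono) simp
  have T2: "\<bar>c * (p * q) * (\<Sum>e\<in>I. Ex (err e))\<bar> \<le> \<bar>c\<bar> * (p * q) * (\<Sum>e\<in>I. Ex (\<lambda>E. (2 * \<bar>W E\<bar> + 6) * (D e E)\<^sup>2))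
    + \<bar>c\<bar> * Ex (\<lambda>E. \<bar>\<Sum>e\<in>I. dev e E * D e E\<bar>)"
  proof -
    have "\<bar>c * (p * q) * x\<bar> = \<bar>c\<bar> * (p * q * \<bar>x\<bar>)" for x
      using p_gt p_lt by (simp add: abs_mult mult.assoc)
    then show ?thesis using * by (simp only: distrib_left mult.assoc)
  qed
  show ?thesis using T1 T2 unfolding 2 D_def f_def by linarith
qed

text \<open>The remainder \<open>V\<close> is only of order \<open>sqrt \<epsilon>\<close>; it is harmless because it is orthogonal to all
  functions of \<open>card E\<close>, in particular to \<open>stein_sol z\<close> of the linear term.\<close>

theorem berry_esseen_decomposition:
  fixes K A B H V :: "'a set \<Rightarrow> real" and c0 s \<epsilon> z :: real
  defines "\<sigma> \<equiv> sqrt (Ex (\<lambda>E. (K E - Ex K)\<^sup>2))"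
  assumes K: "\<And>E. E \<subseteq> I \<Longrightarrow> K E = A E + B E"
    and A: "\<And>E. E \<subseteq> I \<Longrightarrow> A E - Ex A = c0 * cdev E + H E + V E"
    and s: "s = \<bar>c0\<bar> * sqrt (real (card I) * (p * q))" "s > 0" and \<epsilon>: "\<epsilon> \<ge> 0"
    and V_orth: "\<And>\<phi>. Ex (\<lambda>E. V E * \<phi> (card E)) = 0"
    and H_le: "Ex (\<lambda>E. (H E)\<^sup>2) \<le> (\<epsilon> * s)\<^sup>2"
    and V_le: "Ex (\<lambda>E. (V E)\<^sup>2) \<le> \<epsilon> * s\<^sup>2"
    and B_le: "Ex (\<lambda>E. (B E - Ex B)\<^sup>2) \<le> (\<epsilon> * s)\<^sup>2"
    and dB_le: "\<bar>c0\<bar> * (p * q) * (\<Sum>e\<in>I. Ex (\<lambda>E. \<bar>ddiff e B E\<bar>)) \<le> \<epsilon> * s\<^sup>2"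
    and dA_le: "\<bar>c0\<bar> * (p * q) * sqrt (Ex (\<lambda>E. ((\<Sum>e\<in>I. ddiff e A E) - Ex (\<lambda>E. \<Sum>e\<in>I. ddiff e A E))\<^sup>2)) \<le> \<epsilon> * s\<^sup>2"
    and dK_le: "\<bar>c0\<bar> * (p * q) * (\<Sum>e\<in>I. sqrt (Ex (\<lambda>E. (ddiff e K E) ^ 4))) \<le> \<epsilon> * s ^ 3"
    and ddA_le: "\<bar>c0\<bar> * sqrt (Ex (\<lambda>E. (\<Sum>e\<in>I. dev e E * ddiff e A E)\<^sup>2)) \<le> \<epsilon> * s\<^sup>2"
  shows "\<bar>Ex (\<lambda>E. of_bool ((K E - Ex K) / \<sigma> \<le> z)) - gauss_cdf z\<bar> \<le> 120 * \<epsilon>"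
proof (cases "36 * \<epsilon> \<le> 1")
  \<comment> \<open>Then \<open>120 * \<epsilon>\<close> exceeds 1, while two probabilities differ
    by at most 1.\<close>
  case False
  have "0 \<le> Ex (\<lambda>E. of_bool ((K E - Ex K) / \<sigma> \<le> z))" by (rule Ex_nonneg) simp
  moreover have "Ex (\<lambda>E. of_bool ((K E - Ex K) / \<sigma> \<le> z)) \<le> Ex (\<lambda>_. 1)" by (rule Ex_mono) simp
  ultimately have "\<bar>Ex (\<lambda>E. of_bool ((K E - Ex K) / \<sigma> \<le> z)) - gauss_cdf z\<bar> \<le> 1"
    using gauss_cdf_bounds[of z] by simp
  then show ?thesis using False by linarith
next
  case True
  define B0 where "B0 E = B E - Ex B" for E
  define R where "R E = H E + V E + B0 E" for E
  have \<epsilon>1: "\<epsilon>\<^sup>2 \<le> \<epsilon>" using True \<epsilon> by (simp add: power2_eq_square mult_left_le_one_le)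
  have s2: "s\<^sup>2 > 0" using zero_less_power[OF s(2)] .
  have s2_eq: "s\<^sup>2 = c0\<^sup>2 * (real (card I) * (p * q))"
    using p_gt p_lt by (simp add: s(1) power_mult_distrib)
  have ExK: "Ex K = Ex A + Ex B" using bexp_cong[of I K "\<lambda>E. A E + B E" p] K by (simp add: bexp_add)
  have K0: "K E - Ex K = c0 * cdev E + R E" if "E \<subseteq> I" for E
    using K[OF that] A[OF that] by (simp add: ExK R_def B0_def)
  have es2: "(\<epsilon> * s)\<^sup>2 \<le> \<epsilon> * s\<^sup>2" using \<epsilon>1 s2 by (simp add: power_mult_distrib)
  have R_le: "Ex (\<lambda>E. (R E)\<^sup>2) \<le> 9 * (\<epsilon> * s\<^sup>2)"
  proof -
    have "Ex (\<lambda>E. (R E)\<^sup>2) \<le> Ex (\<lambda>E. 3 * ((H E)\<^sup>2 + (V E)\<^sup>2 + (B0 E)\<^sup>2))"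
    proof (rule Ex_mono)
      fix E
      have "3 * ((H E)\<^sup>2 + (V E)\<^sup>2 + (B0 E)\<^sup>2) - (R E)\<^sup>2 = (H E - V E)\<^sup>2 + (V E - B0 E)\<^sup>2 + (H E - B0 E)\<^sup>2"
        unfolding R_def by (simp add: power2_eq_square algebra_simps)
      also have "\<dots> \<ge> 0" by simp
      finally show "(R E)\<^sup>2 \<le> 3 * ((H E)\<^sup>2 + (V E)\<^sup>2 + (B0 E)\<^sup>2)" by linarith
    qed
    also have "\<dots> = 3 * (Ex (\<lambda>E. (H E)\<^sup>2) + Ex (\<lambda>E. (V E)\<^sup>2) + Ex (\<lambda>E. (B0 E)\<^sup>2))"
      by (simp add: bexp_cmult bexp_add)
    also have "\<dots> \<le> 3 * (\<epsilon> * s\<^sup>2 + \<epsilon> * s\<^sup>2 + \<epsilon> * s\<^sup>2)"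
      using H_le V_le B_le es2 unfolding B0_def[symmetric] by (intro mult_left_mono add_mono) linarith+
    finally show ?thesis by simp
  qed
  have L2: "Ex (\<lambda>E. (c0 * cdev E)\<^sup>2) = s\<^sup>2"
    by (simp add: power_mult_distrib bexp_cmult Ex_cdev_sq s2_eq)
  have sqL: "sqrt (Ex (\<lambda>E. (c0 * cdev E)\<^sup>2)) = s" using s(2) by (simp add: L2)
  have sqH: "sqrt (Ex (\<lambda>E. (H E)\<^sup>2)) \<le> \<epsilon> * s"
    using real_sqrt_le_mono[OF H_le] \<epsilon> s(2) by simp
  have sqB: "sqrt (Ex (\<lambda>E. (B0 E)\<^sup>2)) \<le> \<epsilon> * s"
    using real_sqrt_le_mono[OF B_le] \<epsilon> s(2) unfolding B0_def by simp
  \<comment> \<open>The covariance of the linear term with the remainder. \<open>V\<close> drops out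
    by orthogonality, so \<open>t\<close> is of order \<epsilon> relative to the variance although
    \<open>R\<close> itself is only of order sqrt \<epsilon>.\<close>
  define t where "t = Ex (\<lambda>E. (c0 * cdev E) * R E)"
  have t_le: "\<bar>t\<bar> \<le> 2 * (\<epsilon> * s\<^sup>2)"
  proof -
    have "Ex (\<lambda>E. (c0 * cdev E) * V E) = 0"
      using V_orth[of "\<lambda>k. c0 * (real k - real (card I) * p)"] by (simp add: mult.commute)
    then have "t = Ex (\<lambda>E. (c0 * cdev E) * H E) + Ex (\<lambda>E. (c0 * cdev E) * B0 E)"
      unfolding t_def R_def by (simp only: ring_distribs(1) bexp_add)
    moreover have "\<bar>Ex (\<lambda>E. (c0 * cdev E) * H E)\<bar> \<le> s * (\<epsilon> * s)"
    proof -
      have "\<bar>Ex (\<lambda>E. (c0 * cdev E) * H E)\<bar> \<le> sqrt (Ex (\<lambda>E. (c0 * cdev E)\<^sup>2)) * sqrt (Ex (\<lambda>E. (H E)\<^sup>2))"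
        by (rule order_trans[OF Ex_abs_le Ex_abs_mult_le])
      also have "\<dots> \<le> s * (\<epsilon> * s)" unfolding sqL using s(2) by (intro mult_left_mono sqH) simp
      finally show ?thesis .
    qed
    moreover have "\<bar>Ex (\<lambda>E. (c0 * cdev E) * B0 E)\<bar> \<le> s * (\<epsilon> * s)"
    proof -
      have "\<bar>Ex (\<lambda>E. (c0 * cdev E) * B0 E)\<bar> \<le> sqrt (Ex (\<lambda>E. (c0 * cdev E)\<^sup>2)) * sqrt (Ex (\<lambda>E. (B0 E)\<^sup>2))"
        by (rule order_trans[OF Ex_abs_le Ex_abs_mult_le])
      also have "\<dots> \<le> s * (\<epsilon> * s)" unfolding sqL using s(2) by (intro mult_left_mono sqB) simp
      finally show ?thesis .
    qed
    ultimately show ?thesis by (simp add: power2_eq_square mult_ac)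
  qed
  have var: "Ex (\<lambda>E. (K E - Ex K)\<^sup>2) = s\<^sup>2 + 2 * t + Ex (\<lambda>E. (R E)\<^sup>2)"
  proof -
    have "Ex (\<lambda>E. (K E - Ex K)\<^sup>2) = Ex (\<lambda>E. (c0 * cdev E)\<^sup>2 + 2 * ((c0 * cdev E) * R E) + (R E)\<^sup>2)"
      by (rule bexp_cong) (simp only: K0 power2_sum mult.assoc add.assoc add.commute[of "(R _)\<^sup>2"])
    then show ?thesis unfolding bexp_add bexp_cmult[of _ _ 2] L2 t_def by simp
  qed
  have ExR_nonneg: "0 \<le> Ex (\<lambda>E. (R E)\<^sup>2)" by (rule Ex_nonneg) simp
  have es: "36 * (\<epsilon> * s\<^sup>2) \<le> s\<^sup>2" using True s2 by simp
  have \<sigma>2: "\<sigma>\<^sup>2 = s\<^sup>2 + 2 * t + Ex (\<lambda>E. (R E)\<^sup>2)"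
    unfolding \<sigma>_def var[symmetric] by (rule real_sqrt_pow2) (auto intro: Ex_nonneg)
  \<comment> \<open>Here the smallness of \<epsilon> enters: |2 * t| is at most 4 * \<epsilon> times
    the variance of the linear term, hence at most a ninth of it.\<close>
  have s2_le: "s\<^sup>2 \<le> 2 * \<sigma>\<^sup>2" using \<sigma>2 t_le ExR_nonneg es by linarith
  have \<sigma>_pos: "\<sigma> > 0"
  proof -
    have "\<sigma> \<ge> 0" unfolding \<sigma>_def by (auto intro: Ex_nonneg)
    moreover have "\<sigma> \<noteq> 0" using s2_le s2 by auto
    ultimately show ?thesis by simp
  qed
  have s_le: "s \<le> 3 / 2 * \<sigma>"
  proof (rule power2_le_imp_le)
    have "(3 / 2 * \<sigma>)\<^sup>2 = 9 / 4 * \<sigma>\<^sup>2" by (simp add: power2_eq_square)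
    moreover have "0 \<le> \<sigma>\<^sup>2" by simp
    ultimately show "s\<^sup>2 \<le> (3 / 2 * \<sigma>)\<^sup>2" using s2_le by linarith
  qed (use \<sigma>_pos in simp)
  have s3_le: "s ^ 3 \<le> 3 * \<sigma> ^ 3"
  proof -
    have "s\<^sup>2 * s \<le> (2 * \<sigma>\<^sup>2) * (3 / 2 * \<sigma>)" using s2_le s_le s(2) \<sigma>_pos by (intro mult_mono) auto
    then show ?thesis by (simp add: power2_eq_square power3_eq_cube)
  qed
  define W where "W E = (K E - Ex K) / \<sigma>" for E
  define c where "c = c0 / \<sigma>"
  have ExW2: "Ex (\<lambda>E. (W E)\<^sup>2) = 1"
  proof -
    have "Ex (\<lambda>E. (W E)\<^sup>2) = Ex (\<lambda>E. (1 / \<sigma>\<^sup>2) * (K E - Ex K)\<^sup>2)"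
      by (simp add: W_def power_divide)
    also have "\<dots> = (1 / \<sigma>\<^sup>2) * \<sigma>\<^sup>2" unfolding bexp_cmult \<sigma>2 var ..
    finally show ?thesis using \<sigma>_pos by simp
  qed
  have dW: "ddiff e W E = ddiff e K E / \<sigma>" for e E
    by (simp add: ddiff_def W_def diff_divide_distrib)
  have dK: "ddiff e K E = ddiff e A E + ddiff e B E" if "e \<in> I" "E \<subseteq> I" for e E
  proof -
    have "insert e E \<subseteq> I" "E - {e} \<subseteq> I" using that by auto
    then show ?thesis by (simp add: K ddiff_def)
  qed
  define SA where "SA E = (\<Sum>e\<in>I. ddiff e A E)" for E
  define SB where "SB E = (\<Sum>e\<in>I. ddiff e B E)" for E
  have SB_le: "Ex (\<lambda>E. \<bar>SB E\<bar>) \<le> (\<Sum>e\<in>I. Ex (\<lambda>E. \<bar>ddiff e B E\<bar>))"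
    unfolding SB_def bexp_sum[symmetric] by (intro Ex_mono sum_abs)
  define X where "X E = c * (p * q) * (\<Sum>e\<in>I. ddiff e W E)" for E
  have X_eq: "X E = c0 * (p * q) / \<sigma>\<^sup>2 * (SA E + SB E)" if "E \<subseteq> I" for E
    using that by (simp add: X_def c_def dW dK SA_def SB_def sum.distrib sum_divide_distrib[symmetric] power2_eq_square)
  \<comment> \<open>Integration by parts read backwards: up to scaling, the mean of \<open>X\<close>
    is the covariance of the linear term with \<open>K\<close>.\<close>
  have ExX: "Ex X = (s\<^sup>2 + t) / \<sigma>\<^sup>2"
  proof -
    have "Ex X = c / \<sigma> * (p * q * (\<Sum>e\<in>I. Ex (ddiff e K)))"
      unfolding X_def dW by (simp add: bexp_cmult bexp_sum sum_divide_distrib[symmetric] divide_inverse mult_ac bexp_cmult[of _ _ "inverse \<sigma>"] sum_distrib_left[symmetric])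
    also have "p * q * (\<Sum>e\<in>I. Ex (ddiff e K)) = p * q * (\<Sum>e\<in>I. Ex (ddiff e (\<lambda>E. K E - Ex K)))"
    proof -
      have "ddiff e (\<lambda>E. K E - Ex K) = ddiff e K" for e by (rule ext) (simp add: ddiff_def)
      then show ?thesis by simp
    qed
    also have "\<dots> = Ex (\<lambda>E. cdev E * (K E - Ex K))" by (rule Ex_cdev_mult[symmetric])
    also have "c / \<sigma> * Ex (\<lambda>E. cdev E * (K E - Ex K)) = 1 / \<sigma>\<^sup>2 * Ex (\<lambda>E. (c0 * cdev E) * (K E - Ex K))"
      by (simp add: c_def power2_eq_square mult.assoc bexp_cmult)
    also have "Ex (\<lambda>E. (c0 * cdev E) * (K E - Ex K)) = Ex (\<lambda>E. (c0 * cdev E)\<^sup>2 + (c0 * cdev E) * R E)"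
      by (rule bexp_cong) (simp only: K0 power2_eq_square ring_distribs(1))
    also have "\<dots> = s\<^sup>2 + t" unfolding bexp_add L2 t_def ..
    finally show ?thesis by simp
  qed
  have T1: "Ex (\<lambda>E. \<bar>1 - X E\<bar>) \<le> 28 * \<epsilon>"
  proof -
    have "Ex (\<lambda>E. \<bar>1 - X E\<bar>) \<le> Ex (\<lambda>E. \<bar>1 - Ex X\<bar> + \<bar>c0 * (p * q) / \<sigma>\<^sup>2\<bar> * (\<bar>SA E - Ex SA\<bar> + \<bar>SB E - Ex SB\<bar>))"
    proof (rule Ex_mono)
      fix E assume E: "E \<subseteq> I"
      have "Ex X = Ex (\<lambda>E. c0 * (p * q) / \<sigma>\<^sup>2 * (SA E + SB E))" by (rule bexp_cong) (rule X_eq)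
      then have ExX': "Ex X = c0 * (p * q) / \<sigma>\<^sup>2 * (Ex SA + Ex SB)" by (simp only: bexp_cmult bexp_add)
      have "X E - Ex X = c0 * (p * q) / \<sigma>\<^sup>2 * ((SA E - Ex SA) + (SB E - Ex SB))"
      proof -
        have "d * (a + b) - d * (a' + b') = d * ((a - a') + (b - b'))" for d a b a' b' :: real
          by (simp add: algebra_simps)
        then show ?thesis unfolding X_eq[OF E] ExX' .
      qed
      then have "\<bar>X E - Ex X\<bar> = \<bar>c0 * (p * q) / \<sigma>\<^sup>2\<bar> * \<bar>(SA E - Ex SA) + (SB E - Ex SB)\<bar>"
        by (simp only: abs_mult)
      also have "\<dots> \<le> \<bar>c0 * (p * q) / \<sigma>\<^sup>2\<bar> * (\<bar>SA E - Ex SA\<bar> + \<bar>SB E - Ex SB\<bar>)"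
        by (intro mult_left_mono abs_triangle_ineq) simp
      finally show "\<bar>1 - X E\<bar> \<le> \<bar>1 - Ex X\<bar> + \<bar>c0 * (p * q) / \<sigma>\<^sup>2\<bar> * (\<bar>SA E - Ex SA\<bar> + \<bar>SB E - Ex SB\<bar>)"
        by linarith
    qed
    also have "\<dots> = \<bar>1 - Ex X\<bar> + \<bar>c0 * (p * q) / \<sigma>\<^sup>2\<bar> * (Ex (\<lambda>E. \<bar>SA E - Ex SA\<bar>) + Ex (\<lambda>E. \<bar>SB E - Ex SB\<bar>))"
      by (simp only: bexp_add bexp_cmult Ex_const)
    \<comment> \<open>\<open>A\<close> enters through the variance of its summed differences,
      \<open>B\<close> through first absolute moments only; centring the latter costs a factor
      2.\<close>
    also have "\<bar>c0 * (p * q) / \<sigma>\<^sup>2\<bar> * (Ex (\<lambda>E. \<bar>SA E - Ex SA\<bar>) + Ex (\<lambda>E. \<bar>SB E - Ex SB\<bar>)) \<le> 6 * \<epsilon>"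
    proof -
      have "\<bar>c0\<bar> * (p * q) * (Ex (\<lambda>E. \<bar>SA E - Ex SA\<bar>) + Ex (\<lambda>E. \<bar>SB E - Ex SB\<bar>))
        \<le> \<bar>c0\<bar> * (p * q) * (sqrt (Ex (\<lambda>E. (SA E - Ex SA)\<^sup>2)) + 2 * (\<Sum>e\<in>I. Ex (\<lambda>E. \<bar>ddiff e B E\<bar>)))"
        using pq_pos Ex_abs_centered_le[of SB] SB_le
        by (intro mult_left_mono add_mono Ex_abs_le_sqrt) auto
      also have "\<dots> \<le> \<epsilon> * s\<^sup>2 + 2 * (\<epsilon> * s\<^sup>2)"
        using dA_le dB_le unfolding SA_def[symmetric] by (simp add: ring_distribs)
      also have "\<dots> \<le> 6 * \<epsilon> * \<sigma>\<^sup>2" using mult_left_mono[OF s2_le, of "3 * \<epsilon>"] \<epsilon> by simp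
      finally have *: "\<bar>c0\<bar> * (p * q) * (Ex (\<lambda>E. \<bar>SA E - Ex SA\<bar>) + Ex (\<lambda>E. \<bar>SB E - Ex SB\<bar>)) \<le> 6 * \<epsilon> * \<sigma>\<^sup>2" .
      have "\<bar>c0 * (p * q) / \<sigma>\<^sup>2\<bar> * x = \<bar>c0\<bar> * (p * q) * x / \<sigma>\<^sup>2" for x
        using p_gt p_lt by (simp add: abs_mult)
      then show ?thesis using * \<sigma>_pos by (simp only: pos_divide_le_eq zero_less_power)
    qed
    \<comment> \<open>By the formula for \<sigma> the numerator of the bias is \<open>t\<close> plus
      the second moment of \<open>R\<close>: 2 + 9 = 11 times \<epsilon> relative to
      \<open>s\<close>, doubled when passing to \<sigma>.\<close>
    also have "\<bar>1 - Ex X\<bar> \<le> 22 * \<epsilon>"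
    proof -
      have "1 - Ex X = (t + Ex (\<lambda>E. (R E)\<^sup>2)) / \<sigma>\<^sup>2"
      proof -
        have "1 = \<sigma>\<^sup>2 / \<sigma>\<^sup>2" using \<sigma>_pos by simp
        then have "1 - Ex X = (\<sigma>\<^sup>2 - (s\<^sup>2 + t)) / \<sigma>\<^sup>2" unfolding ExX diff_divide_distrib by linarith
        then show ?thesis using \<sigma>2 by simp
      qed
      moreover have "\<bar>t + Ex (\<lambda>E. (R E)\<^sup>2)\<bar> \<le> 22 * \<epsilon> * \<sigma>\<^sup>2"
      proof -
        have "\<bar>t + Ex (\<lambda>E. (R E)\<^sup>2)\<bar> \<le> 11 * \<epsilon> * s\<^sup>2" using t_le R_le ExR_nonneg by linarith
        also have "\<dots> \<le> 22 * \<epsilon> * \<sigma>\<^sup>2" using mult_left_mono[OF s2_le, of "11 * \<epsilon>"] \<epsilon> by simp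
        finally show ?thesis .
      qed
      ultimately show ?thesis using \<sigma>_pos by (simp add: divide_le_eq)
    qed
    finally show ?thesis by simp
  qed
  have T2: "\<bar>Ex (\<lambda>E. (W E - c * cdev E) * stein_sol z (W E))\<bar> \<le> 30 * \<epsilon>"
  proof -
    have res: "W E - c * cdev E = R E / \<sigma>" if "E \<subseteq> I" for E
      unfolding W_def c_def K0[OF that] using \<sigma>_pos by (simp add: field_simps)
    have "Ex (\<lambda>E. (W E - c * cdev E) * stein_sol z (W E)) = Ex (\<lambda>E. 1 / \<sigma> * (H E * stein_sol z (W E)
       + V E * (stein_sol z (W E)) + B0 E * stein_sol z (W E)))"
      by (rule bexp_cong, simp only: res R_def) (simp add: algebra_simps add_divide_distrib)
    also have "\<dots> = 1 / \<sigma> * (Ex (\<lambda>E. H E * stein_sol z (W E)) + Ex (\<lambda>E. V E * stein_sol z (W E))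
       + Ex (\<lambda>E. B0 E * stein_sol z (W E)))"
      by (simp only: bexp_cmult bexp_add)
    also have "Ex (\<lambda>E. V E * stein_sol z (W E)) = Ex (\<lambda>E. V E * (stein_sol z (W E) - stein_sol z (c * cdev E)))"
      using V_orth[of "\<lambda>k. stein_sol z (c * (real k - real (card I) * p))"]
      by (simp add: right_diff_distrib bexp_diff)
    finally have eq: "Ex (\<lambda>E. (W E - c * cdev E) * stein_sol z (W E)) = 1 / \<sigma> * (Ex (\<lambda>E. H E * stein_sol z (W E))
       + Ex (\<lambda>E. V E * (stein_sol z (W E) - stein_sol z (c * cdev E))) + Ex (\<lambda>E. B0 E * stein_sol z (W E)))" .
    have bd: "\<bar>Ex (\<lambda>E. F E * stein_sol z (W E))\<bar> \<le> 6 * (\<epsilon> * s)" if "sqrt (Ex (\<lambda>E. (F E)\<^sup>2)) \<le> \<epsilon> * s" for F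
    proof -
      have "\<bar>Ex (\<lambda>E. F E * stein_sol z (W E))\<bar> \<le> Ex (\<lambda>E. \<bar>F E * stein_sol z (W E)\<bar>)" by (rule Ex_abs_le)
      also have "\<dots> \<le> Ex (\<lambda>E. 6 * \<bar>F E\<bar>)"
        by (rule Ex_mono) (simp add: abs_mult mult.commute[of 6] mult_left_mono stein_sol_bounds(1))
      also have "\<dots> = 6 * Ex (\<lambda>E. \<bar>F E\<bar>)" by (simp only: bexp_cmult)
      also have "\<dots> \<le> 6 * (\<epsilon> * s)" using Ex_abs_le_sqrt[of F] that by (intro mult_left_mono) linarith+
      finally show ?thesis .
    qed
    \<comment> \<open>The Lipschitz bound replaces the difference of Stein solutions by
      \<open>R\<close> / \<sigma>. Both \<open>V\<close> and \<open>R\<close> have size sqrt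
      \<epsilon> in mean square, so Cauchy-Schwarz gives \<epsilon>.\<close>
    have "\<bar>Ex (\<lambda>E. V E * (stein_sol z (W E) - stein_sol z (c * cdev E)))\<bar> \<le> 2 / \<sigma> * Ex (\<lambda>E. \<bar>V E * R E\<bar>)"
    proof -
      have "\<bar>Ex (\<lambda>E. V E * (stein_sol z (W E) - stein_sol z (c * cdev E)))\<bar>
        \<le> Ex (\<lambda>E. \<bar>V E * (stein_sol z (W E) - stein_sol z (c * cdev E))\<bar>)" by (rule Ex_abs_le)
      also have "\<dots> \<le> Ex (\<lambda>E. 2 / \<sigma> * \<bar>V E * R E\<bar>)"
      proof (rule Ex_mono)
        fix E assume "E \<subseteq> I"
        then have "\<bar>stein_sol z (W E) - stein_sol z (c * cdev E)\<bar> \<le> 2 * \<bar>R E / \<sigma>\<bar>"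
          using stein_sol_lipschitz[of z "W E" "c * cdev E"] by (simp only: res)
        then have "\<bar>V E\<bar> * \<bar>stein_sol z (W E) - stein_sol z (c * cdev E)\<bar> \<le> \<bar>V E\<bar> * (2 * \<bar>R E / \<sigma>\<bar>)"
          by (rule mult_left_mono) simp
        then show "\<bar>V E * (stein_sol z (W E) - stein_sol z (c * cdev E))\<bar> \<le> 2 / \<sigma> * \<bar>V E * R E\<bar>"
          using \<sigma>_pos by (simp add: abs_mult mult_ac)
      qed
      finally show ?thesis by (simp only: bexp_cmult)
    qed
    also have "Ex (\<lambda>E. \<bar>V E * R E\<bar>) \<le> sqrt (\<epsilon> * s\<^sup>2) * sqrt (9 * (\<epsilon> * s\<^sup>2))"
      using Ex_abs_mult_le[of V R] V_le R_le \<epsilon>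
      by (elim order_trans, intro mult_mono real_sqrt_le_mono) (auto intro: Ex_nonneg)
    also have "sqrt (\<epsilon> * s\<^sup>2) * sqrt (9 * (\<epsilon> * s\<^sup>2)) = 3 * (\<epsilon> * s\<^sup>2)"
    proof -
      have "sqrt (9 * (\<epsilon> * s\<^sup>2)) = 3 * sqrt (\<epsilon> * s\<^sup>2)" by (simp only: real_sqrt_mult[of 9] ) simp
      then show ?thesis using \<epsilon> s2 by simp
    qed
    finally have V: "\<bar>Ex (\<lambda>E. V E * (stein_sol z (W E) - stein_sol z (c * cdev E)))\<bar> \<le> 6 * \<epsilon> * s\<^sup>2 / \<sigma>"
      using \<sigma>_pos by (simp add: divide_right_mono)
    have V': "6 * \<epsilon> * s\<^sup>2 / \<sigma> \<le> 12 * \<epsilon> * \<sigma>"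
    proof -
      have "6 * \<epsilon> * s\<^sup>2 \<le> 6 * \<epsilon> * (2 * \<sigma>\<^sup>2)" using \<epsilon> s2_le by (intro mult_left_mono) auto
      then show ?thesis using \<sigma>_pos by (simp add: divide_le_eq power2_eq_square mult_ac)
    qed
    have HB: "6 * (\<epsilon> * s) \<le> 9 * \<epsilon> * \<sigma>" using mult_left_mono[OF s_le, of "6 * \<epsilon>"] \<epsilon> by simp
    have "\<bar>Ex (\<lambda>E. H E * stein_sol z (W E))
       + Ex (\<lambda>E. V E * (stein_sol z (W E) - stein_sol z (c * cdev E))) + Ex (\<lambda>E. B0 E * stein_sol z (W E))\<bar>
       \<le> 30 * \<epsilon> * \<sigma>"
      using bd[OF sqH] bd[OF sqB] V V' HB by linarith
    then show ?thesis unfolding eq using \<sigma>_pos by (simp add: abs_mult divide_le_eq)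
  qed
  have T3: "\<bar>c\<bar> * (p * q) * (\<Sum>e\<in>I. Ex (\<lambda>E. (2 * \<bar>W E\<bar> + 6) * (ddiff e W E)\<^sup>2)) \<le> 24 * \<epsilon>"
  proof -
    \<comment> \<open>Cauchy-Schwarz against \<open>W\<close>, whose second moment is 1. This is why
      fourth moments of \<open>ddiff e K\<close> are assumed.\<close>
    have each: "Ex (\<lambda>E. (2 * \<bar>W E\<bar> + 6) * (ddiff e W E)\<^sup>2) \<le> 8 / \<sigma>\<^sup>2 * sqrt (Ex (\<lambda>E. (ddiff e K E) ^ 4))" for e
    proof -
      have "Ex (\<lambda>E. (2 * \<bar>W E\<bar> + 6) * (ddiff e W E)\<^sup>2)
        = Ex (\<lambda>E. 1 / \<sigma>\<^sup>2 * (2 * \<bar>W E * (ddiff e K E)\<^sup>2\<bar> + 6 * \<bar>(ddiff e K E)\<^sup>2\<bar>))"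
        by (simp add: dW abs_mult power_divide add_divide_distrib algebra_simps)
      also have "\<dots> = 1 / \<sigma>\<^sup>2 * (2 * Ex (\<lambda>E. \<bar>W E * (ddiff e K E)\<^sup>2\<bar>) + 6 * Ex (\<lambda>E. \<bar>(ddiff e K E)\<^sup>2\<bar>))"
        by (simp only: bexp_cmult bexp_add)
      also have "\<dots> \<le> 1 / \<sigma>\<^sup>2 * (2 * sqrt (Ex (\<lambda>E. (ddiff e K E) ^ 4)) + 6 * sqrt (Ex (\<lambda>E. (ddiff e K E) ^ 4)))"
      proof (intro mult_left_mono add_mono)
        show "Ex (\<lambda>E. \<bar>W E * (ddiff e K E)\<^sup>2\<bar>) \<le> sqrt (Ex (\<lambda>E. (ddiff e K E) ^ 4))"
          using Ex_abs_mult_le[of W "\<lambda>E. (ddiff e K E)\<^sup>2"] by (simp add: ExW2)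
        show "Ex (\<lambda>E. \<bar>(ddiff e K E)\<^sup>2\<bar>) \<le> sqrt (Ex (\<lambda>E. (ddiff e K E) ^ 4))"
          using Ex_abs_le_sqrt[of "\<lambda>E. (ddiff e K E)\<^sup>2"] by simp
      qed auto
      finally show ?thesis by simp
    qed
    have "\<bar>c\<bar> * (p * q) * (\<Sum>e\<in>I. Ex (\<lambda>E. (2 * \<bar>W E\<bar> + 6) * (ddiff e W E)\<^sup>2))
       \<le> \<bar>c\<bar> * (p * q) * (\<Sum>e\<in>I. 8 / \<sigma>\<^sup>2 * sqrt (Ex (\<lambda>E. (ddiff e K E) ^ 4)))"
      using pq_pos by (intro mult_left_mono sum_mono each) auto
    also have "\<dots> = 8 / \<sigma> ^ 3 * (\<bar>c0\<bar> * (p * q) * (\<Sum>e\<in>I. sqrt (Ex (\<lambda>E. (ddiff e K E) ^ 4))))"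
      using \<sigma>_pos by (simp only: sum_distrib_left[symmetric]) (simp add: c_def power2_eq_square power3_eq_cube mult_ac)
    also have "\<dots> \<le> 8 / \<sigma> ^ 3 * (\<epsilon> * s ^ 3)" using \<sigma>_pos by (intro mult_left_mono dK_le) auto
    also have "\<dots> \<le> 8 / \<sigma> ^ 3 * (\<epsilon> * (3 * \<sigma> ^ 3))" using \<sigma>_pos \<epsilon> by (intro mult_left_mono s3_le) auto
    finally show ?thesis using \<sigma>_pos by simp
  qed
  have T4: "\<bar>c\<bar> * Ex (\<lambda>E. \<bar>\<Sum>e\<in>I. dev e E * ddiff e W E\<bar>) \<le> 6 * \<epsilon>"
  proof -
    have B: "Ex (\<lambda>E. \<bar>dev e E * ddiff e B E\<bar>) = 2 * (p * q) * Ex (\<lambda>E. \<bar>ddiff e B E\<bar>)" if "e \<in> I" for e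
      by (rule Ex_abs_dev_mult[OF that]) (auto simp: ddiff_def)
    have "Ex (\<lambda>E. \<bar>\<Sum>e\<in>I. dev e E * ddiff e W E\<bar>)
      \<le> Ex (\<lambda>E. 1 / \<sigma> * (\<bar>\<Sum>e\<in>I. dev e E * ddiff e A E\<bar> + (\<Sum>e\<in>I. \<bar>dev e E * ddiff e B E\<bar>)))"
    proof (rule Ex_mono)
      fix E assume E: "E \<subseteq> I"
      have "(\<Sum>e\<in>I. dev e E * ddiff e W E) = 1 / \<sigma> * ((\<Sum>e\<in>I. dev e E * ddiff e A E) + (\<Sum>e\<in>I. dev e E * ddiff e B E))"
        using E by (simp add: dW dK sum.distrib[symmetric] sum_divide_distrib algebra_simps)
      also have "\<bar>\<dots>\<bar> = 1 / \<sigma> * \<bar>(\<Sum>e\<in>I. dev e E * ddiff e A E) + (\<Sum>e\<in>I. dev e E * ddiff e B E)\<bar>"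
        using \<sigma>_pos by (simp add: abs_mult)
      also have "\<dots> \<le> 1 / \<sigma> * (\<bar>\<Sum>e\<in>I. dev e E * ddiff e A E\<bar> + (\<Sum>e\<in>I. \<bar>dev e E * ddiff e B E\<bar>))"
        using \<sigma>_pos by (intro mult_left_mono order_trans[OF abs_triangle_ineq] add_left_mono sum_abs) auto
      finally show "\<bar>\<Sum>e\<in>I. dev e E * ddiff e W E\<bar> \<le> \<dots>" .
    qed
    also have "\<dots> = 1 / \<sigma> * (Ex (\<lambda>E. \<bar>\<Sum>e\<in>I. dev e E * ddiff e A E\<bar>) + (\<Sum>e\<in>I. 2 * (p * q) * Ex (\<lambda>E. \<bar>ddiff e B E\<bar>)))"
      by (simp only: bexp_cmult bexp_add bexp_sum B cong: sum.cong)
    also have "\<dots> \<le> 1 / \<sigma> * (sqrt (Ex (\<lambda>E. (\<Sum>e\<in>I. dev e E * ddiff e A E)\<^sup>2)) + (\<Sum>e\<in>I. 2 * (p * q) * Ex (\<lambda>E. \<bar>ddiff e B E\<bar>)))"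
      using \<sigma>_pos by (intro mult_left_mono add_right_mono Ex_abs_le_sqrt) auto
    finally have "\<bar>c\<bar> * Ex (\<lambda>E. \<bar>\<Sum>e\<in>I. dev e E * ddiff e W E\<bar>) \<le> \<bar>c\<bar> * \<dots>" by (rule mult_left_mono) simp
    also have "\<dots> = 1 / \<sigma>\<^sup>2 * (\<bar>c0\<bar> * sqrt (Ex (\<lambda>E. (\<Sum>e\<in>I. dev e E * ddiff e A E)\<^sup>2))
        + 2 * (\<bar>c0\<bar> * (p * q) * (\<Sum>e\<in>I. Ex (\<lambda>E. \<bar>ddiff e B E\<bar>))))"
      using \<sigma>_pos by (simp only: sum_distrib_left[symmetric]) (simp add: c_def power2_eq_square add_divide_distrib distrib_left mult_ac)
    also have "\<dots> \<le> 1 / \<sigma>\<^sup>2 * (\<epsilon> * s\<^sup>2 + 2 * (\<epsilon> * s\<^sup>2))"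
      using \<sigma>_pos by (intro mult_left_mono add_mono ddA_le dB_le) auto
    also have "\<dots> \<le> 1 / \<sigma>\<^sup>2 * (6 * \<epsilon> * \<sigma>\<^sup>2)"
      using \<sigma>_pos mult_left_mono[OF s2_le, of "3 * \<epsilon>"] \<epsilon> by (intro mult_left_mono) auto
    finally show ?thesis using \<sigma>_pos by simp
  qed
  \<comment> \<open>The coefficients add up to 116.\<close>
  have "\<bar>Ex (\<lambda>E. of_bool (W E \<le> z)) - gauss_cdf z\<bar> \<le> 2 * (28 * \<epsilon>) + 30 * \<epsilon> + 24 * \<epsilon> + 6 * \<epsilon>"
    using stein_bound[of W z c] T1 T2 T3 T4 unfolding X_def by linarith
  then show ?thesis unfolding W_def using \<epsilon> by simp
qed

end

section \<open>Counting cycles and paths\<close>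

context bernoulli_subset
begin

lemma Ex_choose:
  assumes "J \<subseteq> I"
  shows "Ex (\<lambda>E. real (card (E \<inter> J) choose k)) = real (card J choose k) * p ^ k"
proof -
  define \<T> where "\<T> = {T. T \<subseteq> J \<and> card T = k}"
  have finJ: "finite J" using assms fin finite_subset by blast
  have fin\<T>: "finite \<T>" unfolding \<T>_def using finJ by auto
  have "Ex (\<lambda>E. real (card (E \<inter> J) choose k)) = Ex (\<lambda>E. \<Sum>T\<in>\<T>. of_bool (T \<subseteq> E))"
  proof (rule bexp_cong)
    fix E
    have "real (card (E \<inter> J) choose k) = real (card {T. T \<subseteq> E \<inter> J \<and> card T = k})"
      using n_subsets[of "E \<inter> J" k] finJ by simp
    also have "{T. T \<subseteq> E \<inter> J \<and> card T = k} = \<T> \<inter> {T. T \<subseteq> E}" by (auto simp: \<T>_def)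
    also have "real (card \<dots>) = (\<Sum>T\<in>\<T>. of_bool (T \<subseteq> E))"
      using fin\<T> by (simp add: of_bool_def sum.If_cases)
    finally show "real (card (E \<inter> J) choose k) = (\<Sum>T\<in>\<T>. of_bool (T \<subseteq> E))" .
  qed
  also have "\<dots> = (\<Sum>T\<in>\<T>. p ^ k)"
    unfolding bexp_sum using assms by (intro sum.cong refl) (auto simp: \<T>_def Ex_superset)
  also have "\<dots> = real (card \<T>) * p ^ k" by simp
  also have "card \<T> = card J choose k" unfolding \<T>_def by (rule n_subsets[OF finJ])
  finally show ?thesis .
qed

text \<open>Expand the binomial coefficient as a sum over \<open>k\<close>-subsets; by
  exchangeability each contributes the same. In other words, given \<open>card E\<close>, every
  \<open>k\<close>-set is contained in \<open>E\<close> with the same conditional probability. This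
  is the source of the orthogonality of \<open>V\<close>.\<close>

lemma Ex_choose_mult_card:
  assumes "T \<subseteq> I" "card T = k"
  shows "Ex (\<lambda>E. real (card E choose k) * \<phi> (card E))
    = real (card I choose k) * Ex (\<lambda>E. of_bool (T \<subseteq> E) * \<phi> (card E))"
proof -
  define \<T> where "\<T> = {T. T \<subseteq> I \<and> card T = k}"
  have fin\<T>: "finite \<T>" unfolding \<T>_def using fin by auto
  have eq: "Ex (\<lambda>E. of_bool (T' \<subseteq> E) * \<phi> (card E)) = Ex (\<lambda>E. of_bool (T \<subseteq> E) * \<phi> (card E))"
    if "T' \<in> \<T>" for T'
  proof -
    have T': "T' \<subseteq> I" "card T' = k" using that by (auto simp: \<T>_def)
    have "finite T" "finite T'" using fin assms T' finite_subset by blast+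
    then have "card (I - T') = card (I - T)" using T' assms by (simp add: card_Diff_subset)
    then show ?thesis using T' assms
      by (simp add: Ex_superset_card Ex_card_cong[of "I - T'" "I - T" "\<lambda>j. \<phi> (j + k)"])
  qed
  have "Ex (\<lambda>E. real (card E choose k) * \<phi> (card E)) = Ex (\<lambda>E. \<Sum>T\<in>\<T>. of_bool (T \<subseteq> E) * \<phi> (card E))"
  proof (rule bexp_cong)
    fix E assume E: "E \<subseteq> I"
    then have "finite E" using fin finite_subset by blast
    then have "real (card E choose k) = real (card {T. T \<subseteq> E \<and> card T = k})"
      by (simp add: n_subsets)
    also have "{T. T \<subseteq> E \<and> card T = k} = \<T> \<inter> {T. T \<subseteq> E}" using E by (auto simp: \<T>_def)
    also have "real (card \<dots>) = (\<Sum>T\<in>\<T>. of_bool (T \<subseteq> E))"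
      using fin\<T> by (simp add: of_bool_def sum.If_cases)
    finally show "real (card E choose k) * \<phi> (card E) = (\<Sum>T\<in>\<T>. of_bool (T \<subseteq> E) * \<phi> (card E))"
      by (simp only: sum_distrib_right)
  qed
  also have "\<dots> = (\<Sum>T'\<in>\<T>. Ex (\<lambda>E. of_bool (T \<subseteq> E) * \<phi> (card E)))"
    unfolding bexp_sum by (intro sum.cong refl eq)
  also have "\<dots> = real (card \<T>) * Ex (\<lambda>E. of_bool (T \<subseteq> E) * \<phi> (card E))" by simp
  also have "card \<T> = card I choose k" unfolding \<T>_def by (rule n_subsets[OF fin])
  finally show ?thesis .
qed

lemma Ex_card_inter_sq_le:
  assumes "J \<subseteq> I"
  shows "Ex (\<lambda>E. (real (card (E \<inter> J)))\<^sup>2) \<le> real (card J) * p + (real (card J) * p)\<^sup>2"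
proof -
  have sq: "(real m)\<^sup>2 = 2 * real (m choose 2) + real (m choose 1)" for m
  proof -
    have "even (m * (m - 1))" by (cases m) auto
    then have "2 * (m choose 2) = m * (m - 1)" by (simp add: choose_two)
    then have "2 * real (m choose 2) = real (m * (m - 1))" by (metis of_nat_mult of_nat_numeral)
    also have "\<dots> = (real m)\<^sup>2 - real m" by (cases m) (simp_all add: power2_eq_square algebra_simps)
    finally show ?thesis by simp
  qed
  have "Ex (\<lambda>E. (real (card (E \<inter> J)))\<^sup>2) = 2 * (real (card J choose 2) * p ^ 2) + real (card J choose 1) * p ^ 1"
    unfolding sq bexp_add bexp_cmult Ex_choose[OF assms] ..
  also have "\<dots> \<le> real (card J) * p + (real (card J) * p)\<^sup>2"
  proof -
    have "2 * real (card J choose 2) \<le> (real (card J))\<^sup>2" using sq[of "card J"] by simp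
    then have "2 * real (card J choose 2) * p\<^sup>2 \<le> (real (card J))\<^sup>2 * p\<^sup>2" by (rule mult_right_mono) simp
    then show ?thesis by (simp add: power_mult_distrib)
  qed
  finally show ?thesis .
qed

lemma Ex_card_inter: "J \<subseteq> I \<Longrightarrow> Ex (\<lambda>E. real (card (E \<inter> J))) = real (card J) * p"
  using Ex_choose[of J 1] by simp

end

section \<open>Differences of superset indicators and numbers of ordered 4-cycles\<close>

lemma ddiff_superset:
  "ddiff e (\<lambda>E. of_bool (T \<subseteq> E)) E = (of_bool (e \<in> T \<and> T - {e} \<subseteq> E) :: real)"
  by (auto simp: ddiff_def)

lemma ddiff2_superset:
  assumes "e \<noteq> f"
  shows "ddiff f (ddiff e (\<lambda>E. of_bool (T \<subseteq> E))) E = (of_bool (e \<in> T \<and> f \<in> T \<and> T - {e} - {f} \<subseteq> E) :: real)"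
  unfolding ddiff_def[of f] unfolding ddiff_superset using assms by auto

lemma card_insert_eq_remove: "finite E \<Longrightarrow> card (insert e E) = Suc (card (E - {e}))"
  by (metis card_insert_disjoint finite_Diff insert_Diff_single Diff_iff insertI1)

text \<open>Pascal's rule, as \<open>insert e E\<close> has one element more than
  \<open>E - {e}\<close>.\<close>

lemma ddiff_choose:
  assumes "finite E"
  shows "ddiff e (\<lambda>E. real (card E choose Suc k)) E = real (card (E - {e}) choose k)"
  using assms by (simp add: ddiff_def card_insert_eq_remove)

definition tuples4 :: "'v set \<Rightarrow> ('v \<times> 'v \<times> 'v \<times> 'v) set" where
  "tuples4 V = {(a, b, c, d). {a, b, c, d} \<subseteq> V \<and> distinct [a, b, c, d]}"

fun arcs4 :: "'v \<times> 'v \<times> 'v \<times> 'v \<Rightarrow> 'v set set" where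
  "arcs4 (a, b, c, d) = {{a, b}, {b, c}, {c, d}, {d, a}}"

text \<open>Every 4-cycle is counted eight times below, and paths and lone pairs are counted once for each
  order of their end points.\<close>

definition cycle_count :: "'v set \<Rightarrow> 'v set set \<Rightarrow> real" where
  "cycle_count V E = (\<Sum>t\<in>tuples4 V. of_bool (arcs4 t \<subseteq> E))"

lemma finite_tuples4 [simp]: "finite V \<Longrightarrow> finite (tuples4 V)"
  by (rule finite_subset[of _ "V \<times> V \<times> V \<times> V"]) (auto simp: tuples4_def)

lemma arcs4_subset: "t \<in> tuples4 V \<Longrightarrow> arcs4 t \<subseteq> nsets V 2"
  by (auto simp: tuples4_def doubleton_in_nsets_2)

lemma card_arcs4: "t \<in> tuples4 V \<Longrightarrow> card (arcs4 t) = 4"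
  by (auto simp: tuples4_def card_insert_if doubleton_eq_iff)

lemma finite_arcs4 [simp]: "finite (arcs4 t)"
  by (cases t) auto

lemma card_distinct_pairs:
  assumes "finite W"
  shows "card {(c, d). c \<in> W \<and> d \<in> W \<and> c \<noteq> d} = card W * (card W - 1)"
proof -
  have "{(c, d). c \<in> W \<and> d \<in> W \<and> c \<noteq> d} = (SIGMA c:W. W - {c})" by auto
  then show ?thesis using assms by (simp add: card_SigmaI)
qed

lemma card_tuples4_pos1:
  assumes "finite V" "e \<in> nsets V 2"
  shows "card {(a, b, c, d). (a, b, c, d) \<in> tuples4 V \<and> {a, b} = e} = 2 * ((card V - 2) * (card V - 3))"
proof -
  obtain x y where e: "e = {x, y}" "x \<in> V" "y \<in> V" "x \<noteq> y" using assms(2) by (rule nsets2_E)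
  define P where "P = {(c, d). c \<in> V - e \<and> d \<in> V - e \<and> c \<noteq> d}"
  have "{(a, b, c, d). (a, b, c, d) \<in> tuples4 V \<and> {a, b} = e} = (\<lambda>((a, b), (c, d)). (a, b, c, d)) ` ({(x, y), (y, x)} \<times> P)"
    (is "?L = ?f ` _")
  proof
    show "?L \<subseteq> ?f ` ({(x, y), (y, x)} \<times> P)"
    proof
      fix t assume "t \<in> ?L"
      then obtain a b c d where t: "t = (a, b, c, d)" "(a, b, c, d) \<in> tuples4 V" "{a, b} = e" by auto
      then have "((a, b), (c, d)) \<in> {(x, y), (y, x)} \<times> P" 
        by (auto simp: tuples4_def P_def e doubleton_eq_iff)
      then show "t \<in> ?f ` ({(x, y), (y, x)} \<times> P)" using t by force
    qed
    show "?f ` ({(x, y), (y, x)} \<times> P) \<subseteq> ?L" using e by (auto simp: tuples4_def P_def)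
  qed
  also have "card \<dots> = card ({(x, y), (y, x)} \<times> P)" 
  proof (rule card_image)
    have "inj ?f" by (rule injI) (simp split: prod.splits)
    then show "inj_on ?f ({(x, y), (y, x)} \<times> P)" by (rule inj_on_subset) simp
  qed
  also have "\<dots> = 2 * card P" using e by (simp add: card_cartesian_product)
  also have "card P = card (V - e) * (card (V - e) - 1)" unfolding P_def using assms by (intro card_distinct_pairs) auto
  also have "card (V - e) = card V - 2" using assms e by (simp add: card_Diff_subset)
  also have "card V - 2 - 1 = card V - 3" by simp
  finally show ?thesis .
qed

text \<open>Cyclic rotation maps the tuples with \<open>e\<close> in one position bijectively to
  those with \<open>e\<close> in the next, and distinctness of the nodes prevents \<open>e\<close>
  from occupying two positions.\<close>

lemma card_tuples4_arc:
  assumes "finite V" "e \<in> nsets V 2"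
  shows "card {t \<in> tuples4 V. e \<in> arcs4 t} = 8 * ((card V - 2) * (card V - 3))"
proof -
  let ?n = "2 * ((card V - 2) * (card V - 3))"
  define S1 where "S1 = {(a, b, c, d). (a, b, c, d) \<in> tuples4 V \<and> {a, b} = e}"
  define S2 where "S2 = {(a, b, c, d). (a, b, c, d) \<in> tuples4 V \<and> {b, c} = e}"
  define S3 where "S3 = {(a, b, c, d). (a, b, c, d) \<in> tuples4 V \<and> {c, d} = e}"
  define S4 where "S4 = {(a, b, c, d). (a, b, c, d) \<in> tuples4 V \<and> {d, a} = e}"
  have fin: "finite S1" "finite S2" "finite S3" "finite S4"
    unfolding S1_def S2_def S3_def S4_def
    by (rule finite_subset[OF _ finite_tuples4[OF assms(1)]], auto)+
  have c1: "card S1 = ?n" unfolding S1_def by (rule card_tuples4_pos1[OF assms])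
  have c2: "card S2 = ?n"
  proof -
    have "bij_betw (\<lambda>(a, b, c, d). (d, a, b, c)) S1 S2"
      by (rule bij_betwI[where g = "\<lambda>(a, b, c, d). (b, c, d, a)"]) (auto simp: S1_def S2_def tuples4_def)
    then show ?thesis using c1 by (metis bij_betw_same_card)
  qed
  have c3: "card S3 = ?n"
  proof -
    have "bij_betw (\<lambda>(a, b, c, d). (d, a, b, c)) S2 S3"
      by (rule bij_betwI[where g = "\<lambda>(a, b, c, d). (b, c, d, a)"]) (auto simp: S2_def S3_def tuples4_def)
    then show ?thesis using c2 by (metis bij_betw_same_card)
  qed
  have c4: "card S4 = ?n"
  proof -
    have "bij_betw (\<lambda>(a, b, c, d). (d, a, b, c)) S3 S4"
      by (rule bij_betwI[where g = "\<lambda>(a, b, c, d). (b, c, d, a)"]) (auto simp: S3_def S4_def tuples4_def)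
    then show ?thesis using c3 by (metis bij_betw_same_card)
  qed
  have disj: "S1 \<inter> S2 = {}" "S1 \<inter> S3 = {}" "S1 \<inter> S4 = {}" "S2 \<inter> S3 = {}" "S2 \<inter> S4 = {}" "S3 \<inter> S4 = {}"
    by (auto simp: S1_def S2_def S3_def S4_def tuples4_def doubleton_eq_iff)
  have "{t \<in> tuples4 V. e \<in> arcs4 t} = S1 \<union> (S2 \<union> (S3 \<union> S4))"
    unfolding S1_def S2_def S3_def S4_def by auto
  also have "card \<dots> = card S1 + card (S2 \<union> (S3 \<union> S4))"
    using fin disj by (intro card_Un_disjoint) auto
  also have "card (S2 \<union> (S3 \<union> S4)) = card S2 + card (S3 \<union> S4)"
    using fin disj by (intro card_Un_disjoint) auto
  also have "card (S3 \<union> S4) = card S3 + card S4"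
    using fin disj by (intro card_Un_disjoint) auto
  finally show ?thesis using c1 c2 c3 c4 by simp
qed

lemma card_tuples4:
  assumes "finite V"
  shows "card (tuples4 V) = card V * (card V - 1) * ((card V - 2) * (card V - 3))"
proof -
  have "t \<in> tuples4 V \<longleftrightarrow> t \<in> (SIGMA a:V. SIGMA b:V - {a}. SIGMA c:V - {a, b}. V - {a, b, c})" for t
    by (cases t) (simp add: tuples4_def, blast)
  then have "tuples4 V = (SIGMA a:V. SIGMA b:V - {a}. SIGMA c:V - {a, b}. V - {a, b, c})" by blast
  also have "card \<dots> = (\<Sum>a\<in>V. \<Sum>b\<in>V - {a}. \<Sum>c\<in>V - {a, b}. card (V - {a, b, c}))"
    using assms by (simp add: card_SigmaI)
  also have "\<dots> = (\<Sum>a\<in>V. \<Sum>b\<in>V - {a}. \<Sum>c\<in>V - {a, b}. card V - 3)"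
    using assms by (intro sum.cong refl) (auto simp: card_Diff_subset card_insert_if)
  also have "\<dots> = (\<Sum>a\<in>V. \<Sum>b\<in>V - {a}. (card V - 2) * (card V - 3))"
    using assms by (intro sum.cong refl) (auto simp: card_Diff_subset card_insert_if)
  also have "\<dots> = (\<Sum>a\<in>V. (card V - 1) * ((card V - 2) * (card V - 3)))"
    using assms by (intro sum.cong refl) (auto simp: card_Diff_subset card_insert_if)
  finally show ?thesis by simp
qed

text \<open>Two disjoint arcs already exhaust the four nodes of the tuple, so at most 4^4 tuples
  remain, independently of the size of \<open>V\<close>.\<close>

lemma card_tuples4_two_arcs_disjoint:
  assumes "e \<in> nsets V 2" "f \<in> nsets V 2" "e \<inter> f = {}"
  shows "card {t \<in> tuples4 V. e \<in> arcs4 t \<and> f \<in> arcs4 t} \<le> 256"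
proof -
  have fin: "finite e" "finite f" and c: "card e = 2" "card f = 2" using assms by (auto simp: nsets_def)
  then have cef: "card (e \<union> f) = 4" using assms(3) by (simp add: card_Un_disjoint)
  have "{t \<in> tuples4 V. e \<in> arcs4 t \<and> f \<in> arcs4 t} \<subseteq> (e \<union> f) \<times> (e \<union> f) \<times> (e \<union> f) \<times> (e \<union> f)"
    using assms(3) by (auto simp: tuples4_def)
  then have "card {t \<in> tuples4 V. e \<in> arcs4 t \<and> f \<in> arcs4 t} \<le> card ((e \<union> f) \<times> (e \<union> f) \<times> (e \<union> f) \<times> (e \<union> f))"
    using fin by (intro card_mono) auto
  then show ?thesis by (simp add: card_cartesian_product cef)
qed

text \<open>Two different arcs cover at least three positions of the tuple, so at most one entry is
  free: 4 choices of its position, 4^3 for the other entries. Disjoint arcs have their own bound,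
  because this one for all pairs would lose a factor n in the sum over pairs.\<close>

lemma card_tuples4_two_arcs:
  assumes "finite V" "e \<in> nsets V 2" "f \<in> nsets V 2" "e \<noteq> f"
  shows "card {t \<in> tuples4 V. e \<in> arcs4 t \<and> f \<in> arcs4 t} \<le> 256 * card V"
proof -
  have fin: "finite e" "finite f" and c: "card e = 2" "card f = 2" and sub: "e \<subseteq> V" "f \<subseteq> V"
    using assms by (auto simp: nsets_def)
  define U where "U = e \<union> f"
  have U: "finite U" "card U \<le> 4" using fin c card_Un_le[of e f] by (auto simp: U_def)
  have "{t \<in> tuples4 V. e \<in> arcs4 t \<and> f \<in> arcs4 t} \<subseteq>
      (V \<times> U \<times> U \<times> U) \<union> ((U \<times> V \<times> U \<times> U) \<union> ((U \<times> U \<times> V \<times> U) \<union> (U \<times> U \<times> U \<times> V)))" (is "?L \<subseteq> ?R")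
  proof
    fix t assume "t \<in> ?L"
    then obtain a b c d where t: "t = (a, b, c, d)" "{a, b, c, d} \<subseteq> V"
      "e \<in> {{a, b}, {b, c}, {c, d}, {d, a}}" "f \<in> {{a, b}, {b, c}, {c, d}, {d, a}}"
      unfolding tuples4_def by auto
    have "b \<in> U \<and> c \<in> U \<and> d \<in> U \<or> a \<in> U \<and> c \<in> U \<and> d \<in> U \<or> a \<in> U \<and> b \<in> U \<and> d \<in> U \<or> a \<in> U \<and> b \<in> U \<and> c \<in> U"
      using t(3,4) assms(4) by (elim insertE emptyE) (simp_all add: U_def)
    then show "t \<in> ?R" using t(1,2) by simp
  qed
  then have "card ?L \<le> card ?R" using U assms(1) by (intro card_mono) auto
  also have "\<dots> \<le> card (V \<times> U \<times> U \<times> U) + (card (U \<times> V \<times> U \<times> U) + (card (U \<times> U \<times> V \<times> U) + card (U \<times> U \<times> U \<times> V)))"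
    by (intro order_trans[OF card_Un_le] add_left_mono) simp
  also have "\<dots> = 4 * (card U * card U * card U * card V)" by (simp add: card_cartesian_product)
  also have "\<dots> \<le> 4 * (4 * 4 * 4 * card V)" using U by (intro mult_le_mono) auto
  finally show ?thesis by simp
qed

definition incident :: "'v set \<Rightarrow> 'v set \<Rightarrow> 'v set set" where
  "incident V e = {f \<in> nsets V 2. f \<noteq> e \<and> e \<inter> f \<noteq> {}}"

lemma card_incident_le:
  assumes "finite V" "e \<in> nsets V 2"
  shows "card (incident V e) \<le> 2 * card V"
proof -
  have "incident V e \<subseteq> (\<lambda>(x, y). {x, y}) ` (e \<times> V)"
  proof
    fix f assume "f \<in> incident V e"
    then obtain x y where "f = {x, y}" "x \<in> V" "y \<in> V" "x \<in> e \<or> y \<in> e"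
      unfolding incident_def by (auto elim!: nsets2_E)
    then have "\<exists>z\<in>e \<times> V. f = (\<lambda>(x, y). {x, y}) z"
      by (elim disjE) (force simp: insert_commute[of x y])+
    then show "f \<in> (\<lambda>(x, y). {x, y}) ` (e \<times> V)" by blast
  qed
  then have "card (incident V e) \<le> card (e \<times> V)"
    using assms by (intro surj_card_le) (auto simp: nsets_def)
  then show ?thesis using assms by (simp add: card_cartesian_product nsets_def)
qed

lemma card_dir_arcs:
  assumes "finite V" "E \<subseteq> nsets V 2"
  shows "card {(c, d). {c, d} \<in> E} = 2 * card E"
proof -
  have fE: "finite E" using assms finite_imp_finite_nsets finite_subset by blast
  have "{(c, d). {c, d} \<in> E} = (\<Union>f\<in>E. {(c, d). {c, d} = f})" by auto
  also have "card \<dots> = (\<Sum>f\<in>E. card {(c, d). {c, d} = f})"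
  proof (rule card_UN_disjoint)
    show "\<forall>f\<in>E. finite {(c, d). {c, d} = f}"
    proof
      fix f assume "f \<in> E"
      then have "finite f" using assms by (auto simp: nsets_def)
      moreover have "{(c, d). {c, d} = f} \<subseteq> f \<times> f" by auto
      ultimately show "finite {(c, d). {c, d} = f}" by (blast intro: finite_subset finite_cartesian_product)
    qed
  qed (use fE in auto)
  also have "\<dots> = (\<Sum>f\<in>E. 2)"
  proof (intro sum.cong refl)
    fix f assume "f \<in> E"
    then obtain x y where "f = {x, y}" "x \<noteq> y" using assms by (metis nsets2_E subsetD)
    then have "{(c, d). {c, d} = f} = {(x, y), (y, x)}" by (auto simp: doubleton_eq_iff)
    then show "card {(c, d). {c, d} = f} = 2" using \<open>x \<noteq> y\<close> by simp
  qed
  finally show ?thesis by simp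
qed

lemma finite_dir_arcs: "finite V \<Longrightarrow> E \<subseteq> nsets V 2 \<Longrightarrow> finite {(c, d). {c, d} \<in> E}"
  by (rule finite_subset[of _ "V \<times> V"]) (auto simp: nsets_def)

text \<open>Such a tuple is determined by the position of \<open>e\<close>, its orientation and the
  directed opposite arc, which gives 4 * 2 * (2 * \<open>card E\<close>). A bound linear in
  \<open>card E\<close> for every single \<open>E\<close> reduces moments of the difference to
  moments of the number of arcs.\<close>

lemma card_tuples4_open_le:
  assumes "finite V" "e \<in> nsets V 2" "E \<subseteq> nsets V 2"
  shows "card {t \<in> tuples4 V. e \<in> arcs4 t \<and> arcs4 t - {e} \<subseteq> E} \<le> 16 * card E"
proof -
  obtain x y where e: "e = {x, y}" "x \<noteq> y" using assms(2) by (rule nsets2_E)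
  define D where "D = {(c, d). {c, d} \<in> E}"
  define P where "P = {(x, y), (y, x)}"
  have D: "finite D" "card D = 2 * card E" unfolding D_def using assms finite_dir_arcs card_dir_arcs by blast+
  have PD: "finite (P \<times> D)" "card (P \<times> D) = 4 * card E" using D e by (auto simp: P_def card_cartesian_product)
  let ?f1 = "\<lambda>((a, b), (c, d)). (a, b, c, d)" and ?f2 = "\<lambda>((b, c), (d, a)). (a, b, c, d)"
    and ?f3 = "\<lambda>((c, d), (a, b)). (a, b, c, d)" and ?f4 = "\<lambda>((d, a), (b, c)). (a, b, c, d)"
  have "{t \<in> tuples4 V. e \<in> arcs4 t \<and> arcs4 t - {e} \<subseteq> E}
    \<subseteq> ?f1 ` (P \<times> D) \<union> (?f2 ` (P \<times> D) \<union> (?f3 ` (P \<times> D) \<union> ?f4 ` (P \<times> D)))" (is "?L \<subseteq> ?R")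
  proof
    fix t assume "t \<in> ?L"
    then obtain a b c d where t: "t = (a, b, c, d)" "distinct [a, b, c, d]" "e \<in> arcs4 (a, b, c, d)" "arcs4 (a, b, c, d) - {e} \<subseteq> E"
      by (auto simp: tuples4_def)
    \<comment> \<open>The arc opposite to \<open>e\<close> differs from \<open>e\<close>, hence
      belongs to \<open>E\<close>.\<close>
    have ne: "{a, b} \<noteq> {c, d}" "{b, c} \<noteq> {d, a}" using t(2) by (auto simp: doubleton_eq_iff)
    have 1: "(u, v) \<in> P" if "{u, v} = e" for u v using that by (auto simp: P_def e doubleton_eq_iff)
    have 2: "(u, v) \<in> D" if "{u, v} \<in> arcs4 (a, b, c, d)" "{u, v} \<noteq> e" for u v using that t(4) by (auto simp: D_def)
    consider "{a, b} = e" | "{b, c} = e" | "{c, d} = e" | "{d, a} = e" using t(3) by auto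
    then show "t \<in> ?R"
    proof cases
      case a: 1
      then have "((a, b), (c, d)) \<in> P \<times> D" using 1[OF a] 2[of c d] ne by auto
      then show ?thesis unfolding t(1) by (intro UnI1) (rule image_eqI[rotated], auto)
    next
      case a: 2
      then have "((b, c), (d, a)) \<in> P \<times> D" using 1[OF a] 2[of d a] ne by auto
      then have "t \<in> ?f2 ` (P \<times> D)" unfolding t(1) by (rule image_eqI[rotated]) auto
      then show ?thesis by blast
    next
      case a: 3
      then have "((c, d), (a, b)) \<in> P \<times> D" using 1[OF a] 2[of a b] ne by auto
      then have "t \<in> ?f3 ` (P \<times> D)" unfolding t(1) by (rule image_eqI[rotated]) auto
      then show ?thesis by blast
    next
      case a: 4
      then have "((d, a), (b, c)) \<in> P \<times> D" using 1[OF a] 2[of b c] ne by auto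
      then have "t \<in> ?f4 ` (P \<times> D)" unfolding t(1) by (rule image_eqI[rotated]) auto
      then show ?thesis by blast
    qed
  qed
  then have "card ?L \<le> card ?R" using PD(1) by (intro card_mono) auto
  also have "\<dots> \<le> card (P \<times> D) + (card (P \<times> D) + (card (P \<times> D) + card (P \<times> D)))"
    by (intro order_trans[OF card_Un_le] add_mono card_image_le PD(1))
  finally show ?thesis using PD(2) by simp
qed

section \<open>Paths with two arcs and lone pairs: the effect of adding one arc\<close>

definition path_count :: "'v set \<Rightarrow> 'v set set \<Rightarrow> real" where
  "path_count V E = real (card {(i, j, l). i \<in> V \<and> j \<in> V \<and> l \<in> V \<and> i \<noteq> l \<and> {i, j} \<in> E \<and> {j, l} \<in> E})"

definition lone_pairs :: "'v set \<Rightarrow> 'v set set \<Rightarrow> ('v \<times> 'v) set" where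
  "lone_pairs V E = {(i, l). i \<in> V \<and> l \<in> V \<and> i \<noteq> l \<and> {i, l} \<notin> E \<and> card {j \<in> V. {i, j} \<in> E \<and> {j, l} \<in> E} = 1}"

lemma finite_lone_pairs [simp]: "finite V \<Longrightarrow> finite (lone_pairs V E)"
  by (rule finite_subset[of _ "V \<times> V"]) (auto simp: lone_pairs_def)

lemma abs_card_diff_le:
  assumes "finite A" "finite B" "A - B \<subseteq> C" "B - A \<subseteq> C" "finite C"
  shows "\<bar>real (card A) - real (card B)\<bar> \<le> real (card C)"
proof -
  have "card A \<le> card B + card C" 
    using card_mono[of "B \<union> C" A] card_Un_le[of B C] assms by fastforce
  moreover have "card B \<le> card A + card C" 
    using card_mono[of "A \<union> C" B] card_Un_le[of A C] assms by fastforce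
  ultimately show ?thesis by linarith
qed

context
  fixes V :: "'v set" and e :: "'v set" and F :: "'v set set"
  assumes V: "finite V" and e: "e \<in> nsets V 2" and F: "F \<subseteq> nsets V 2" "e \<notin> F"
begin

text \<open>The paths created by adding \<open>e\<close>, oriented so that \<open>e\<close> comes
  first; those with \<open>e\<close> last are their reversals. Distinct end points and membership in
  \<open>V\<close> follow from the assumptions on \<open>e\<close> and \<open>F\<close>.\<close>

definition "new_paths = {(i, j, l). {i, j} = e \<and> {j, l} \<in> F}"

lemma new_paths_eq: "new_paths = {(i, j, l). {i, j} = e \<and> {j, l} \<in> F \<and> i \<noteq> l \<and> i \<in> V \<and> j \<in> V \<and> l \<in> V}"
  using e F by (auto simp: new_paths_def insert_commute doubleton_in_nsets_2)

lemma finite_new_paths: "finite new_paths"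
  by (rule finite_subset[of _ "V \<times> V \<times> V"]) (auto simp: new_paths_eq V)

text \<open>The second arc determines the path: two paths with the same second arc but different
  middle nodes would force that arc to be \<open>e\<close>, which is not in
  \<open>F\<close>.\<close>

lemma card_new_paths: "card new_paths \<le> card (F \<inter> incident V e)"
proof (rule card_inj_on_le[of "\<lambda>(i, j, l). {j, l}"])
  obtain x y where xy: "e = {x, y}" "x \<noteq> y" using e by (rule nsets2_E)
  show "inj_on (\<lambda>(i, j, l). {j, l}) new_paths"
  proof (rule inj_onI)
    fix s t assume st: "s \<in> new_paths" "t \<in> new_paths" "(\<lambda>(i, j, l). {j, l}) s = (\<lambda>(i, j, l). {j, l}) t"
    obtain i j l where s: "s = (i, j, l)" by (cases s)
    obtain i' j' l' where t: "t = (i', j', l')" by (cases t)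
    have h: "{i, j} = e" "{j, l} \<in> F" "{i', j'} = e" "{j, l} = {j', l'}"
      using st by (simp_all add: s t new_paths_def)
    show "s = t"
    proof (cases "j = j'")
      case True
      then have "l = l'" "i = i'" using h by (metis doubleton_eq_iff)+
      then show ?thesis using True by (simp add: s t)
    next
      case False
      then have "l = j'" using h(4) by (metis doubleton_eq_iff)
      moreover have "i = j'" using h(1,3) False by (metis doubleton_eq_iff)
      ultimately have "{j, l} = e" using h(1) by (simp add: insert_commute)
      then show ?thesis using h(2) F by simp
    qed
  qed
  show "(\<lambda>(i, j, l). {j, l}) ` new_paths \<subseteq> F \<inter> incident V e"
    using F by (auto simp: new_paths_def incident_def)
  show "finite (F \<inter> incident V e)" using F V finite_imp_finite_nsets finite_subset by blast
qed

lemma path_count_diff: "\<bar>path_count V (insert e F) - path_count V F\<bar> \<le> 2 * real (card (F \<inter> incident V e))"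
proof -
  let ?R = "\<lambda>(i, j, l). (l, j, i)"
  have "\<bar>path_count V (insert e F) - path_count V F\<bar> \<le> real (card (new_paths \<union> ?R ` new_paths))"
    unfolding path_count_def
  proof (rule abs_card_diff_le)
    show "{(i, j, l). i \<in> V \<and> j \<in> V \<and> l \<in> V \<and> i \<noteq> l \<and> {i, j} \<in> insert e F \<and> {j, l} \<in> insert e F}
      - {(i, j, l). i \<in> V \<and> j \<in> V \<and> l \<in> V \<and> i \<noteq> l \<and> {i, j} \<in> F \<and> {j, l} \<in> F} \<subseteq> new_paths \<union> ?R ` new_paths"
      (is "?L \<subseteq> _")
    proof
      fix t assume "t \<in> ?L"
      then obtain i j l where t: "t = (i, j, l)" "i \<noteq> l" "{i, j} \<in> insert e F" "{j, l} \<in> insert e F" "\<not> ({i, j} \<in> F \<and> {j, l} \<in> F)"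
        by auto
      then have "{i, j} \<noteq> {j, l}" by (auto simp: doubleton_eq_iff)
      then have "(i, j, l) \<in> new_paths \<or> (l, j, i) \<in> new_paths" using t
        by (auto simp: new_paths_def insert_commute)
      then show "t \<in> new_paths \<union> ?R ` new_paths" unfolding t(1) by (auto simp: image_iff)
    qed
    show "finite {(i, j, l). i \<in> V \<and> j \<in> V \<and> l \<in> V \<and> i \<noteq> l \<and> {i, j} \<in> insert e F \<and> {j, l} \<in> insert e F}"
      "finite {(i, j, l). i \<in> V \<and> j \<in> V \<and> l \<in> V \<and> i \<noteq> l \<and> {i, j} \<in> F \<and> {j, l} \<in> F}"
      by (rule finite_subset[of _ "V \<times> V \<times> V"], auto simp: V)+
  qed (auto simp: finite_new_paths)
  also have "card (new_paths \<union> ?R ` new_paths) \<le> card new_paths + card new_paths"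
    by (intro order_trans[OF card_Un_le] add_left_mono card_image_le finite_new_paths)
  also have "\<dots> \<le> 2 * card (F \<inter> incident V e)" using card_new_paths by simp
  finally show ?thesis by simp
qed

text \<open>Only the end points of \<open>e\<close> and the end points of new paths can change
  status. The bound has no additive constant, so its mean carries a factor p and stays useful for
  sparse graphs.\<close>

lemma lone_pairs_diff:
  "\<bar>real (card (lone_pairs V (insert e F))) - real (card (lone_pairs V F))\<bar> \<le> 4 * real (card (F \<inter> incident V e))"
proof -
  let ?A = "lone_pairs V (insert e F)" and ?B = "lone_pairs V F"
  let ?g = "\<lambda>(i, j, l). (i, l)" and ?h = "\<lambda>(i, j, l). (l, i)"
  define P where "P = {(i, l). {i, l} = e \<and> (i, l) \<in> ?B}"
  define N where "N = ?g ` new_paths \<union> ?h ` new_paths"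
  have same: "(i, l) \<in> ?A \<longleftrightarrow> (i, l) \<in> ?B" if "{i, l} \<noteq> e" "(i, l) \<notin> N" "i \<noteq> l" for i l
  proof -
    have "{j \<in> V. {i, j} \<in> insert e F \<and> {j, l} \<in> insert e F} = {j \<in> V. {i, j} \<in> F \<and> {j, l} \<in> F}"
    proof -
      have "{i, j} \<in> F \<and> {j, l} \<in> F" if j: "{i, j} \<in> insert e F" "{j, l} \<in> insert e F" for j
      proof (rule ccontr)
        assume n: "\<not> ({i, j} \<in> F \<and> {j, l} \<in> F)"
        have "{i, j} \<noteq> {j, l}" using \<open>i \<noteq> l\<close> by (auto simp: doubleton_eq_iff)
        then have "(i, j, l) \<in> new_paths \<or> (l, j, i) \<in> new_paths" using n j
          by (auto simp: new_paths_def insert_commute)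
        then have "(i, l) \<in> N" unfolding N_def by force
        then show False using \<open>(i, l) \<notin> N\<close> by simp
      qed
      then show ?thesis by blast
    qed
    then show ?thesis using that unfolding lone_pairs_def by simp
  qed
  have finP: "finite P" by (rule finite_subset[of _ ?B]) (auto simp: P_def V)
  have finN: "finite N" by (auto simp: N_def finite_new_paths)
  have e_ne: "i \<noteq> l" if "(i, l) \<in> ?A \<or> (i, l) \<in> ?B" for i l using that by (auto simp: lone_pairs_def)
  have notA: "(i, l) \<notin> ?A" if "{i, l} = e" for i l using that by (auto simp: lone_pairs_def)
  have "\<bar>real (card ?A) - real (card ?B)\<bar> \<le> real (card (P \<union> N))"
  proof (rule abs_card_diff_le)
    have "(i, l) \<in> P \<union> N" if "(i, l) \<in> ?A - ?B" for i l
      using that same[of i l] e_ne[of i l] notA[of i l] by blast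
    then show "?A - ?B \<subseteq> P \<union> N" by (rule subrelI)
    have "(i, l) \<in> P \<union> N" if "(i, l) \<in> ?B - ?A" for i l
      using that same[of i l] e_ne[of i l] unfolding P_def by blast
    then show "?B - ?A \<subseteq> P \<union> N" by (rule subrelI)
  qed (use finP finN V in auto)
  also have "real (card (P \<union> N)) \<le> real (card P + card N)" using card_Un_le[of P N] by simp
  also have "card N \<le> 2 * card (F \<inter> incident V e)"
  proof -
    have "card N \<le> card new_paths + card new_paths" unfolding N_def
      by (intro order_trans[OF card_Un_le] add_mono card_image_le finite_new_paths)
    then show ?thesis using card_new_paths by simp
  qed
  \<comment> \<open>If the end points of \<open>e\<close> form a lone pair, their common neighbour
    supplies an arc of \<open>F\<close> meeting \<open>e\<close>; the at most two ordered pairs are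
    thus paid for by incident arcs.\<close>
  also have "card P \<le> 2 * card (F \<inter> incident V e)"
  proof (cases "P = {}")
    case False
    then obtain i l where il: "{i, l} = e" "(i, l) \<in> ?B" by (auto simp: P_def)
    then obtain j where j: "{i, j} \<in> F" unfolding lone_pairs_def by (auto simp: card_1_singleton_iff)
    have "{i, j} \<in> nsets V 2" "{i, j} \<noteq> e" using j F by blast+
    then have "{i, j} \<in> F \<inter> incident V e" using il(1) j unfolding incident_def by blast
    moreover have "finite (F \<inter> incident V e)" using F V finite_imp_finite_nsets finite_subset by blast
    ultimately have "card (F \<inter> incident V e) \<noteq> 0" unfolding card_eq_0_iff by blast
    then have "1 \<le> card (F \<inter> incident V e)" by simp
    moreover have "card P \<le> 2"
    proof -
      have "(a, b) = (i, l) \<or> (a, b) = (l, i)" if "(a, b) \<in> P" for a b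
      proof -
        have "{a, b} = {i, l}" using that il(1) unfolding P_def by blast
        then show ?thesis by (simp add: doubleton_eq_iff)
      qed
      then have "(a, b) \<in> {(i, l), (l, i)}" if "(a, b) \<in> P" for a b using that by blast
      then have "P \<subseteq> {(i, l), (l, i)}" by (rule subrelI)
      then have "card P \<le> card {(i, l), (l, i)}" by (rule card_mono[rotated]) simp
      also have "\<dots> \<le> 2" using card_length[of "[(i, l), (l, i)]"] by simp
      finally show ?thesis .
    qed
    ultimately show ?thesis by simp
  qed simp
  finally show ?thesis by simp
qed

end

lemma ddiff_path_lone_le:
  assumes "finite V" "e \<in> nsets V 2" "E \<subseteq> nsets V 2"
  shows "\<bar>ddiff e (\<lambda>E. real (card (lone_pairs V E)) - path_count V E) E\<bar> \<le> 6 * real (card (E \<inter> incident V e))"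
proof -
  define F where "F = E - {e}"
  have F: "F \<subseteq> nsets V 2" "e \<notin> F" using assms by (auto simp: F_def)
  have i: "insert e E = insert e F" "F \<inter> incident V e = E \<inter> incident V e" by (auto simp: F_def incident_def)
  show ?thesis
    unfolding ddiff_def F_def[symmetric] i(1)
    using path_count_diff[OF assms(1,2) F] lone_pairs_diff[OF assms(1,2) F] unfolding i(2) by linarith
qed

section \<open>Decomposition of the edge count\<close>

lemma real_choose:
  "real (m choose 2) = real m * (real m - 1) / 2"
  "real (m choose 3) = real m * (real m - 1) * (real m - 2) / 6"
  "real (m choose 4) = real m * (real m - 1) * (real m - 2) * (real m - 3) / 24"
  by (simp_all add: binomial_gbinomial gbinomial_prod_rev eval_nat_numeral algebra_simps)

lemma ddiff2_choose:
  assumes "finite E" "e \<noteq> f"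
  shows "ddiff f (ddiff e (\<lambda>E. real (card E choose Suc (Suc k)))) E = real (card (E - {e} - {f}) choose k)"
proof -
  have "ddiff f (ddiff e (\<lambda>E. real (card E choose Suc (Suc k)))) E
    = real (card (insert f E - {e}) choose Suc k) - real (card (E - {f} - {e}) choose Suc k)"
    unfolding ddiff_def[of f] using assms by (simp add: ddiff_choose)
  moreover have "insert f E - {e} = insert f (E - {e})" "E - {f} - {e} = E - {e} - {f}" using assms by auto
  ultimately show ?thesis using assms by (simp add: card_insert_eq_remove)
qed

lemma ddiff_cycle_count:
  "ddiff e (cycle_count V) = (\<lambda>E. \<Sum>t\<in>tuples4 V. of_bool (e \<in> arcs4 t \<and> arcs4 t - {e} \<subseteq> E))"
  unfolding cycle_count_def[abs_def] by (rule ext) (simp only: ddiff_sum ddiff_superset)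

lemma ddiff2_cycle_count:
  assumes "e \<noteq> f"
  shows "ddiff f (ddiff e (cycle_count V)) =
    (\<lambda>E. \<Sum>t\<in>tuples4 V. of_bool (e \<in> arcs4 t \<and> f \<in> arcs4 t \<and> arcs4 t - {e} - {f} \<subseteq> E))"
proof
  fix E
  have "ddiff e (cycle_count V) = (\<lambda>E. \<Sum>t\<in>tuples4 V. ddiff e (\<lambda>E. of_bool (arcs4 t \<subseteq> E)) E)"
    unfolding cycle_count_def[abs_def] by (rule ext) (simp only: ddiff_sum)
  then show "ddiff f (ddiff e (cycle_count V)) E =
    (\<Sum>t\<in>tuples4 V. of_bool (e \<in> arcs4 t \<and> f \<in> arcs4 t \<and> arcs4 t - {e} - {f} \<subseteq> E))"
    by (simp only: ddiff_sum) (intro sum.cong refl ddiff2_superset assms)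
qed

lemma ddiff_lincomb:
  "ddiff e (\<lambda>E. a * F E - b * G E) = (\<lambda>E. a * ddiff e F E - b * ddiff e G E)"
  by (rule ext) (simp add: ddiff_def algebra_simps)

locale random_graph_space =
  fixes V :: "'v set" and p :: real
  assumes finV: "finite V" and p_pos: "0 < p" and p_less: "p < 1"

sublocale random_graph_space \<subseteq> bernoulli_subset "nsets V 2" p
  by unfold_locales (use finV p_pos p_less finite_imp_finite_nsets in auto)

context random_graph_space
begin

declare card_nsets [simp del]

abbreviation I :: "'v set set" where "I \<equiv> nsets V 2"
abbreviation n :: real where "n \<equiv> real (card V)"
abbreviation N :: real where "N \<equiv> real (card I)"

lemma N_eq: "N = n * (n - 1) / 2"
  by (simp add: card_nsets real_choose)

lemma finE: "E \<subseteq> I \<Longrightarrow> finite E" using fin finite_subset by blast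

definition shared :: "'v set \<Rightarrow> 'v set \<Rightarrow> real" where
  "shared e f = real (card {t \<in> tuples4 V. e \<in> arcs4 t \<and> f \<in> arcs4 t})"

lemma sum_of_bool: "finite A \<Longrightarrow> (\<Sum>x\<in>A. of_bool (P x)) = real (card {x \<in> A. P x})"
  by (simp add: of_bool_def sum.If_cases Int_def)

lemmas sum_tuples = sum_of_bool[OF finite_tuples4[OF finV]]

lemma ddiff2_cycle_count_bounds:
  assumes "e \<noteq> f"
  shows "0 \<le> ddiff f (ddiff e (cycle_count V)) E" "ddiff f (ddiff e (cycle_count V)) E \<le> shared e f"
proof -
  show "0 \<le> ddiff f (ddiff e (cycle_count V)) E" unfolding ddiff2_cycle_count[OF assms] by (intro sum_nonneg) simp
  have "ddiff f (ddiff e (cycle_count V)) E \<le> (\<Sum>t\<in>tuples4 V. of_bool (e \<in> arcs4 t \<and> f \<in> arcs4 t))"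
    unfolding ddiff2_cycle_count[OF assms] by (intro sum_mono) simp
  then show "ddiff f (ddiff e (cycle_count V)) E \<le> shared e f"
    by (simp only: shared_def sum_tuples)
qed

text \<open>The second difference lies between 0 and \<open>shared e f\<close>, so its square is at
  most \<open>shared e f\<close> times itself. This keeps the factor \<open>p\<^sup>2\<close> of the
  first moment, the probability of the two remaining arcs.\<close>

lemma Ex_ddiff2_cycle_count_sq:
  assumes "e \<noteq> f"
  shows "Ex (\<lambda>E. (ddiff f (ddiff e (cycle_count V)) E)\<^sup>2) \<le> (shared e f)\<^sup>2 * p\<^sup>2"
proof -
  let ?g = "ddiff f (ddiff e (cycle_count V))"
  have "Ex (\<lambda>E. (?g E)\<^sup>2) \<le> Ex (\<lambda>E. shared e f * ?g E)"
    using ddiff2_cycle_count_bounds[OF assms] by (intro Ex_mono) (simp add: power2_eq_square mult_right_mono)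
  also have "\<dots> = shared e f * Ex ?g" by (rule bexp_cmult)
  also have "Ex ?g = (\<Sum>t\<in>tuples4 V. of_bool (e \<in> arcs4 t \<and> f \<in> arcs4 t) * p\<^sup>2)"
    unfolding ddiff2_cycle_count[OF assms] bexp_sum
  proof (intro sum.cong refl)
    fix t assume t: "t \<in> tuples4 V"
    show "Ex (\<lambda>E. of_bool (e \<in> arcs4 t \<and> f \<in> arcs4 t \<and> arcs4 t - {e} - {f} \<subseteq> E))
      = of_bool (e \<in> arcs4 t \<and> f \<in> arcs4 t) * p\<^sup>2"
    proof (cases "e \<in> arcs4 t \<and> f \<in> arcs4 t")
      case True
      have "card (arcs4 t - {e} - {f}) = 2"
        using True assms card_arcs4[OF t] by (simp add: card_Diff_subset)
      moreover have "arcs4 t - {e} - {f} \<subseteq> I" using arcs4_subset[OF t] by blast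
      ultimately show ?thesis using True Ex_superset[of "arcs4 t - {e} - {f}"] by simp
    qed auto
  qed
  also have "\<dots> = shared e f * p\<^sup>2"
    unfolding sum_distrib_right[symmetric] by (simp only: shared_def sum_tuples)
  finally show ?thesis by (simp add: power2_eq_square mult_ac)
qed

lemma shared_sq_le:
  assumes "e \<in> I" "f \<in> I" "e \<noteq> f"
  shows "(shared e f)\<^sup>2 \<le> 65536 + of_bool (f \<in> incident V e) * (65536 * n\<^sup>2)"
proof (cases "f \<in> incident V e")
  case True
  have "shared e f \<le> 256 * n"
    unfolding shared_def using of_nat_mono[OF card_tuples4_two_arcs[OF finV assms], where 'a = real] by simp
  moreover have "0 \<le> shared e f" by (simp add: shared_def)
  ultimately have "(shared e f)\<^sup>2 \<le> (256 * n)\<^sup>2" by (rule power_mono)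
  then show ?thesis using True by (simp add: power_mult_distrib)
next
  case False
  then have "e \<inter> f = {}" using assms by (auto simp: incident_def)
  then have "shared e f \<le> 256" unfolding shared_def
    using of_nat_mono[OF card_tuples4_two_arcs_disjoint[OF assms(1,2)], where 'a = real] by simp
  moreover have "0 \<le> shared e f" by (simp add: shared_def)
  ultimately have "(shared e f)\<^sup>2 \<le> 256\<^sup>2" by (rule power_mono)
  then show ?thesis using False by simp
qed

lemma N_le: "N \<le> n\<^sup>2 / 2" unfolding N_eq by (simp add: power2_eq_square algebra_simps)

text \<open>Of the order n^4 disjoint pairs each contributes a constant, of the order n^3 incident
  pairs each contributes order n^2. The incident pairs dominate and give the power 5.\<close>

lemma sum_ddiff2_cycle_count_sq:
  assumes "n \<ge> 1"
  shows "(\<Sum>e\<in>I. \<Sum>f\<in>I - {e}. Ex (\<lambda>E. (ddiff f (ddiff e (cycle_count V)) E)\<^sup>2)) \<le> 81920 * n ^ 5 * p\<^sup>2"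
proof -
  have inner: "(\<Sum>f\<in>I - {e}. Ex (\<lambda>E. (ddiff f (ddiff e (cycle_count V)) E)\<^sup>2)) \<le> 163840 * n ^ 3 * p\<^sup>2" if e: "e \<in> I" for e
  proof -
    have "(\<Sum>f\<in>I - {e}. Ex (\<lambda>E. (ddiff f (ddiff e (cycle_count V)) E)\<^sup>2))
      \<le> (\<Sum>f\<in>I - {e}. (65536 + of_bool (f \<in> incident V e) * (65536 * n\<^sup>2)) * p\<^sup>2)"
    proof (intro sum_mono)
      fix f assume "f \<in> I - {e}"
      then have f: "f \<in> I" "e \<noteq> f" by auto
      show "Ex (\<lambda>E. (ddiff f (ddiff e (cycle_count V)) E)\<^sup>2) \<le> (65536 + of_bool (f \<in> incident V e) * (65536 * n\<^sup>2)) * p\<^sup>2"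
        by (rule order_trans[OF Ex_ddiff2_cycle_count_sq[OF f(2)] mult_right_mono[OF shared_sq_le[OF e f]]]) simp
    qed
    also have "\<dots> \<le> (\<Sum>f\<in>I. (65536 + of_bool (f \<in> incident V e) * (65536 * n\<^sup>2)) * p\<^sup>2)"
      by (rule sum_mono2) (use fin in auto)
    also have "\<dots> = (N * 65536 + (\<Sum>f\<in>I. of_bool (f \<in> incident V e)) * (65536 * n\<^sup>2)) * p\<^sup>2"
      by (simp only: sum_distrib_right[symmetric] sum.distrib sum_constant)
    also have "(\<Sum>f\<in>I. of_bool (f \<in> incident V e)) = real (card (incident V e))"
    proof -
      have "{f \<in> I. f \<in> incident V e} = incident V e" by (auto simp: incident_def)
      then show ?thesis by (simp only: sum_of_bool[OF fin])
    qed
    also have "(N * 65536 + real (card (incident V e)) * (65536 * n\<^sup>2)) * p\<^sup>2 \<le> (n\<^sup>2 / 2 * 65536 + 2 * n * (65536 * n\<^sup>2)) * p\<^sup>2"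
    proof -
      have "real (card (incident V e)) \<le> 2 * n" 
        using of_nat_mono[OF card_incident_le[OF finV e], where 'a = real] by simp
      then show ?thesis using N_le by (intro mult_right_mono add_mono) auto
    qed
    also have "\<dots> \<le> 163840 * n ^ 3 * p\<^sup>2"
    proof (rule mult_right_mono)
      \<comment> \<open>65536 / 2 + 2 * 65536 = 163840 once n^2 is replaced by n^3.\<close>
      have "n\<^sup>2 * 1 \<le> n\<^sup>2 * n" using assms by (intro mult_left_mono) auto
      then show "n\<^sup>2 / 2 * 65536 + 2 * n * (65536 * n\<^sup>2) \<le> 163840 * n ^ 3"
        by (simp add: power2_eq_square power3_eq_cube)
    qed simp
    finally show ?thesis .
  qed
  have "(\<Sum>e\<in>I. \<Sum>f\<in>I - {e}. Ex (\<lambda>E. (ddiff f (ddiff e (cycle_count V)) E)\<^sup>2)) \<le> (\<Sum>e\<in>I. 163840 * n ^ 3 * p\<^sup>2)"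
    by (intro sum_mono inner)
  also have "\<dots> = N * (163840 * n ^ 3 * p\<^sup>2)" by simp
  also have "\<dots> \<le> n\<^sup>2 / 2 * (163840 * n ^ 3 * p\<^sup>2)" using N_le by (intro mult_right_mono) auto
  also have "\<dots> = 81920 * n ^ 5 * p\<^sup>2" by (simp add: eval_nat_numeral)
  finally show ?thesis .
qed

text \<open>Double counting: each tuple through \<open>f\<close> is met by exactly four arcs, and
  there are at most 8 * n^2 such tuples.\<close>

lemma sum_shared_le:
  assumes "f \<in> I"
  shows "(\<Sum>e\<in>I. shared e f) \<le> 32 * n\<^sup>2"
proof -
  have "(\<Sum>e\<in>I. shared e f) = (\<Sum>e\<in>I. \<Sum>t\<in>tuples4 V. of_bool (e \<in> arcs4 t) * of_bool (f \<in> arcs4 t))"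
    by (simp only: shared_def sum_tuples[symmetric] of_bool_conj)
  also have "\<dots> = (\<Sum>t\<in>tuples4 V. (\<Sum>e\<in>I. of_bool (e \<in> arcs4 t)) * of_bool (f \<in> arcs4 t))"
    by (subst sum.swap) (simp only: sum_distrib_right)
  also have "\<dots> = (\<Sum>t\<in>tuples4 V. 4 * of_bool (f \<in> arcs4 t))"
  proof (intro sum.cong refl)
    fix t assume t: "t \<in> tuples4 V"
    have "{e \<in> I. e \<in> arcs4 t} = arcs4 t" using arcs4_subset[OF t] by auto
    then show "(\<Sum>e\<in>I. of_bool (e \<in> arcs4 t)) * of_bool (f \<in> arcs4 t) = (4 :: real) * of_bool (f \<in> arcs4 t)"
      by (simp only: sum_of_bool[OF fin] card_arcs4[OF t] of_nat_numeral)
  qed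
  also have "\<dots> = 4 * real (card {t \<in> tuples4 V. f \<in> arcs4 t})"
    unfolding sum_distrib_left[symmetric] by (simp only: sum_tuples)
  also have "\<dots> = 4 * real (8 * ((card V - 2) * (card V - 3)))"
    by (simp only: card_tuples4_arc[OF finV assms])
  also have "\<dots> \<le> 4 * real (8 * (card V * card V))"
    by (intro mult_left_mono iffD2[OF of_nat_le_iff] mult_le_mono) auto
  finally show ?thesis by (simp add: power2_eq_square)
qed

section \<open>Main part and local part of the count, and the radial approximation of the main
  part\<close>

definition main_part :: "'v set set \<Rightarrow> real" where
  "main_part E = 4 * real (card E choose 2) - cycle_count V E / 2"

definition local_part :: "'v set set \<Rightarrow> real" where
  "local_part E = real (card (lone_pairs V E)) - path_count V E"

lemma main_part_lincomb: "main_part = (\<lambda>E. 4 * real (card E choose 2) - 1 / 2 * cycle_count V E)"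
  by (rule ext) (simp add: main_part_def)

lemma ddiff_main_part:
  assumes "finite E"
  shows "ddiff e main_part E = 4 * real (card (E - {e})) - ddiff e (cycle_count V) E / 2"
  using ddiff_choose[OF assms, of e 1] unfolding main_part_lincomb ddiff_lincomb by (simp add: numeral_2_eq_2)

lemma ddiff2_main_part:
  assumes "finite E" "e \<noteq> f"
  shows "ddiff f (ddiff e main_part) E = 4 - ddiff f (ddiff e (cycle_count V)) E / 2"
  using ddiff2_choose[OF assms, of 0] unfolding main_part_lincomb ddiff_lincomb by (simp add: numeral_2_eq_2)

text \<open>Holds for every \<open>E\<close>, not only on average, so that the fourth moment of the
  difference follows from the one of \<open>card E\<close>.\<close>

lemma ddiff_main_part_le:
  assumes "e \<in> I" "E \<subseteq> I"
  shows "\<bar>ddiff e main_part E\<bar> \<le> 12 * real (card E)"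
proof -
  have E: "finite E" using assms finE by blast
  have "ddiff e (cycle_count V) E \<le> 16 * real (card E)"
    unfolding ddiff_cycle_count sum_tuples using of_nat_mono[OF card_tuples4_open_le[OF finV assms], where 'a = real] by simp
  moreover have "0 \<le> ddiff e (cycle_count V) E" unfolding ddiff_cycle_count by (intro sum_nonneg) simp
  moreover have "real (card (E - {e})) \<le> real (card E)" using E by (simp add: card_mono)
  ultimately show ?thesis unfolding ddiff_main_part[OF E] by linarith
qed

lemma card_inter_incident_le: "E \<subseteq> I \<Longrightarrow> real (card (E \<inter> incident V e)) \<le> real (card E)"
  using finE by (simp add: card_mono)

lemma ddiff_local_part_le:
  assumes "e \<in> I" "E \<subseteq> I"
  shows "\<bar>ddiff e local_part E\<bar> \<le> 6 * real (card (E \<inter> incident V e))"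
  unfolding local_part_def[abs_def] by (rule ddiff_path_lone_le[OF finV assms])

lemma Ex_ddiff_local_part_sq:
  assumes "e \<in> I"
  shows "Ex (\<lambda>E. (ddiff e local_part E)\<^sup>2) \<le> 36 * (2 * n * p + (2 * n * p)\<^sup>2)"
proof -
  have sub: "incident V e \<subseteq> I" by (auto simp: incident_def)
  have c: "real (card (incident V e)) \<le> 2 * n"
    using of_nat_mono[OF card_incident_le[OF finV assms], where 'a = real] by simp
  have "Ex (\<lambda>E. (ddiff e local_part E)\<^sup>2) \<le> Ex (\<lambda>E. 36 * (real (card (E \<inter> incident V e)))\<^sup>2)"
  proof (rule Ex_mono)
    fix E assume "E \<subseteq> I"
    from power_mono[OF ddiff_local_part_le[OF assms this], of 2]
    show "(ddiff e local_part E)\<^sup>2 \<le> 36 * (real (card (E \<inter> incident V e)))\<^sup>2"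
      by (simp add: power_mult_distrib)
  qed
  also have "\<dots> \<le> 36 * (real (card (incident V e)) * p + (real (card (incident V e)) * p)\<^sup>2)"
    unfolding bexp_cmult by (intro mult_left_mono Ex_card_inter_sq_le sub) simp
  also have "\<dots> \<le> 36 * (2 * n * p + (2 * n * p)\<^sup>2)"
    using c p_pos by (intro mult_left_mono add_mono power_mono mult_right_mono) auto
  finally show ?thesis .
qed

lemma Ex_abs_ddiff_local_part:
  assumes "e \<in> I"
  shows "Ex (\<lambda>E. \<bar>ddiff e local_part E\<bar>) \<le> 12 * n * p"
proof -
  have sub: "incident V e \<subseteq> I" by (auto simp: incident_def)
  have c: "real (card (incident V e)) \<le> 2 * n"
    using of_nat_mono[OF card_incident_le[OF finV assms], where 'a = real] by simp
  have "Ex (\<lambda>E. \<bar>ddiff e local_part E\<bar>) \<le> Ex (\<lambda>E. 6 * real (card (E \<inter> incident V e)))"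
    by (intro Ex_mono ddiff_local_part_le assms)
  also have "\<dots> = 6 * (real (card (incident V e)) * p)" unfolding bexp_cmult Ex_card_inter[OF sub] ..
  also have "\<dots> \<le> 6 * (2 * n * p)" using c p_pos by (intro mult_left_mono mult_right_mono) auto
  finally show ?thesis by simp
qed

text \<open>A deterministic bound, fed into the Poincare inequality for the variance of the summed
  differences: 4 per arc gives at most 2 * n^2, half of \<open>sum_shared_le\<close> gives 16 *
  n^2.\<close>

lemma ddiff_sum_ddiff_main_part:
  assumes "f \<in> I" "finite E"
  shows "\<bar>ddiff f (\<lambda>E. \<Sum>e\<in>I. ddiff e main_part E) E\<bar> \<le> 18 * n\<^sup>2"
proof -
  have "\<bar>ddiff f (\<lambda>E. \<Sum>e\<in>I. ddiff e main_part E) E\<bar> \<le> (\<Sum>e\<in>I. \<bar>ddiff f (ddiff e main_part) E\<bar>)"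
    unfolding ddiff_sum by (rule sum_abs)
  also have "\<dots> \<le> (\<Sum>e\<in>I. 4 + shared e f / 2)"
  proof (intro sum_mono)
    fix e
    show "\<bar>ddiff f (ddiff e main_part) E\<bar> \<le> 4 + shared e f / 2"
    proof (cases "e = f")
      case True
      then show ?thesis by (simp add: ddiff_def[of f] shared_def)
    next
      case False
      then show ?thesis unfolding ddiff2_main_part[OF assms(2) False]
        using ddiff2_cycle_count_bounds[OF False, of E] by linarith
    qed
  qed
  also have "\<dots> = 4 * N + (\<Sum>e\<in>I. shared e f) / 2"
    by (simp add: sum.distrib sum_divide_distrib)
  also have "\<dots> \<le> 18 * n\<^sup>2" using sum_shared_le[OF assms(1)] N_le by linarith
  finally show ?thesis .
qed

text \<open>Normalised so that \<open>cycle_density * real (card E choose 4)\<close> is the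
  conditional mean of \<open>cycle_count V\<close> given the number of arcs.\<close>

definition cycle_density :: real where
  "cycle_density = real (card (tuples4 V)) / real (card I choose 4)"

text \<open>The conditional mean of \<open>main_part\<close> given \<open>card E\<close>; what
  remains of \<open>main_part\<close> is the \<open>V\<close> of the Berry-Esseen
  decomposition.\<close>

definition radial_part :: "'v set set \<Rightarrow> real" where
  "radial_part E = 4 * real (card E choose 2) - cycle_density * real (card E choose 4) / 2"

text \<open>The mean of \<open>ddiff e radial_part\<close>, that is, the coefficient of
  \<open>cdev\<close> in the linear approximation. To leading order it is 2 * n^2 * p * (1 - 2 *
  p^2).\<close>

definition linear_coeff :: real where
  "linear_coeff = 4 * (N - 1) * p - 4 * (n - 2) * (n - 3) * p ^ 3"

lemma card_tuples4_real: "n \<ge> 4 \<Longrightarrow> real (card (tuples4 V)) = n * (n - 1) * ((n - 2) * (n - 3))"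
  by (simp add: card_tuples4[OF finV] of_nat_diff)

lemma N_ge:
  assumes "n \<ge> 2"
  shows "n\<^sup>2 / 4 \<le> N"
proof -
  have "n * 2 \<le> n * n" using assms by (intro mult_left_mono) auto
  then show ?thesis unfolding N_eq power2_eq_square by (simp add: field_simps)
qed

text \<open>The right side is the number of tuples through a given arc. Hence cycles and their
  radial approximation have first differences of equal mean, as the second-order Poincare inequality
  requires.\<close>

lemma cycle_density_arc:
  assumes "n \<ge> 4"
  shows "cycle_density * real ((card I - 1) choose 3) = 8 * (n - 2) * (n - 3)"
proof -
  have N4: "N \<ge> 4" using N_ge assms power_mono[OF assms, of 2] by simp
  then have "real (card I - 1) = N - 1" by (simp add: of_nat_diff)
  then have c3: "real ((card I - 1) choose 3) = (N - 1) * (N - 2) * (N - 3) / 6" 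
    by (simp only: real_choose) simp
  have gen: "T / (x * (x - 1) * (x - 2) * (x - 3) / 24) * ((x - 1) * (x - 2) * (x - 3) / 6) = 4 * T / x"
    if "x \<ge> 4" for T x :: real
  proof -
    define y where "y = (x - 1) * (x - 2) * (x - 3)"
    have "y \<noteq> 0" "x \<noteq> 0" using that by (auto simp: y_def)
    then have "T / (x * y / 24) * (y / 6) = 4 * T / x" by (simp add: field_simps)
    then show ?thesis by (simp add: y_def mult.assoc)
  qed
  have "cycle_density * real ((card I - 1) choose 3) = 4 * real (card (tuples4 V)) / N"
    unfolding cycle_density_def real_choose(3) c3 by (rule gen[OF N4])
  also have "\<dots> = 8 * (n - 2) * (n - 3)"
    unfolding card_tuples4_real[OF assms] N_eq using assms by (simp add: field_simps)
  finally show ?thesis .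
qed

text \<open>This product is the second difference of the radial cycle term. It is bounded because
  the density is of order n^4 / N^4 and the binomial coefficient at most of order N^2, where N is of
  order n^2.\<close>

lemma cycle_density_pairs:
  assumes "n \<ge> 10" "k \<le> card I"
  shows "0 \<le> cycle_density * real (k choose 2)" "cycle_density * real (k choose 2) \<le> 800"
proof -
  show "0 \<le> cycle_density * real (k choose 2)" unfolding cycle_density_def by simp
  have N: "N \<ge> n\<^sup>2 / 4" "N \<ge> 25" using N_ge assms power_mono[OF assms(1), of 2] by auto
  have T: "real (card (tuples4 V)) \<le> n ^ 4"
  proof -
    have "n * (n - 1) * ((n - 2) * (n - 3)) \<le> n * n * (n * n)" using assms by (intro mult_mono) auto
    then show ?thesis using assms card_tuples4_real by (simp add: eval_nat_numeral mult_ac)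
  qed
  have "real (k choose 2) \<le> real (card I choose 2)" using assms(2) by (simp add: binomial_right_mono)
  then have "cycle_density * real (k choose 2) \<le> cycle_density * (N * (N - 1) / 2)"
    unfolding cycle_density_def real_choose(1)[symmetric] by (intro mult_left_mono) auto
  also have "\<dots> = 12 * real (card (tuples4 V)) / ((N - 2) * (N - 3))"
  proof -
    have "x / (a * y / 24) * (a / 2) = 12 * x / y" if "a \<noteq> 0" "y \<noteq> 0" for a x y :: real
      using that by (simp add: field_simps)
    from this[of "N * (N - 1)" "(N - 2) * (N - 3)"] show ?thesis
      unfolding cycle_density_def real_choose(3) using N(2) by (simp add: mult.assoc)
  qed
  \<comment> \<open>At most n^4 <= 16 * N^2 tuples over a denominator of at least N^2 / 4: 12 * 16 *
    4 = 768.\<close>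
  also have "\<dots> \<le> 800"
  proof -
    have "real (card (tuples4 V)) \<le> 16 * N\<^sup>2"
    proof -
      have "(n\<^sup>2)\<^sup>2 \<le> (4 * N)\<^sup>2" using N(1) by (intro power_mono) auto
      moreover have "(n\<^sup>2)\<^sup>2 = n ^ 4" by simp
      moreover have "(4 * N)\<^sup>2 = 16 * N\<^sup>2" by (simp add: power_mult_distrib)
      ultimately show ?thesis using T by linarith
    qed
    moreover have "N\<^sup>2 / 4 \<le> (N - 2) * (N - 3)"
    proof -
      have "(N / 2) * (N / 2) \<le> (N - 2) * (N - 3)" using N(2) by (intro mult_mono) auto
      then show ?thesis by (simp add: power2_eq_square)
    qed
    moreover have "(N - 2) * (N - 3) > 0" using N(2) by simp
    ultimately show ?thesis by (simp add: pos_divide_le_eq)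
  qed
  finally show "cycle_density * real (k choose 2) \<le> 800" .
qed

lemma Ex_ddiff_choose:
  assumes "e \<in> I"
  shows "Ex (ddiff e (\<lambda>E. real (card E choose Suc k))) = real ((card I - 1) choose k) * p ^ k"
proof -
  have "Ex (ddiff e (\<lambda>E. real (card E choose Suc k))) = Ex (\<lambda>E. real (card (E \<inter> (I - {e})) choose k))"
  proof (rule bexp_cong)
    fix E assume E: "E \<subseteq> I"
    then have "E - {e} = E \<inter> (I - {e})" by auto
    then show "ddiff e (\<lambda>E. real (card E choose Suc k)) E = real (card (E \<inter> (I - {e})) choose k)"
      by (simp only: ddiff_choose[OF finE[OF E]])
  qed
  also have "\<dots> = real (card (I - {e}) choose k) * p ^ k" by (rule Ex_choose) auto
  finally show ?thesis using assms fin by simp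
qed

lemma Ex_ddiff_cycle_count:
  assumes "e \<in> I" "n \<ge> 4"
  shows "Ex (ddiff e (cycle_count V)) = 8 * (n - 2) * (n - 3) * p ^ 3"
proof -
  have "Ex (ddiff e (cycle_count V)) = (\<Sum>t\<in>tuples4 V. of_bool (e \<in> arcs4 t) * p ^ 3)"
    unfolding ddiff_cycle_count bexp_sum
  proof (intro sum.cong refl)
    fix t assume t: "t \<in> tuples4 V"
    show "Ex (\<lambda>E. of_bool (e \<in> arcs4 t \<and> arcs4 t - {e} \<subseteq> E)) = of_bool (e \<in> arcs4 t) * p ^ 3"
    proof (cases "e \<in> arcs4 t")
      case True
      have "card (arcs4 t - {e}) = 3" using True card_arcs4[OF t] by (simp add: card_Diff_subset)
      moreover have "arcs4 t - {e} \<subseteq> I" using arcs4_subset[OF t] by blast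
      ultimately show ?thesis using True Ex_superset[of "arcs4 t - {e}"] by simp
    qed auto
  qed
  also have "\<dots> = real (card {t \<in> tuples4 V. e \<in> arcs4 t}) * p ^ 3"
    unfolding sum_distrib_right[symmetric] by (simp only: sum_tuples)
  also have "\<dots> = 8 * (n - 2) * (n - 3) * p ^ 3"
    using assms by (simp add: card_tuples4_arc[OF finV] of_nat_diff)
  finally show ?thesis .
qed

text \<open>All 4-cycles have four arcs, so by exchangeability their indicators have the same
  correlation with any function of \<open>card E\<close>, and \<open>cycle_density\<close> is the
  matching average.\<close>

lemma Ex_cycle_count_mult:
  assumes "n \<ge> 4"
  shows "Ex (\<lambda>E. (main_part E - radial_part E) * \<phi> (card E)) = 0"
proof -
  have "0 < n * (n - 1) * ((n - 2) * (n - 3))" using assms by (intro mult_pos_pos) auto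
  then have "card (tuples4 V) \<noteq> 0" unfolding card_tuples4_real[OF assms, symmetric] by simp
  then obtain t0 where t0: "t0 \<in> tuples4 V" by (metis card.empty ex_in_conv)
  define m where "m = Ex (\<lambda>E. of_bool (arcs4 t0 \<subseteq> E) * \<phi> (card E))"
  have choose_pos: "real (card I choose 4) \<noteq> 0"
  proof -
    have "4 \<le> card I" using card_mono[OF fin arcs4_subset[OF t0]] card_arcs4[OF t0] by simp
    then show ?thesis by simp
  qed
  have 1: "real (card I choose 4) * m = Ex (\<lambda>E. real (card E choose 4) * \<phi> (card E))"
    unfolding m_def using Ex_choose_mult_card[OF arcs4_subset[OF t0] card_arcs4[OF t0]] by simp
  have "Ex (\<lambda>E. of_bool (arcs4 t \<subseteq> E) * \<phi> (card E)) = m" if t: "t \<in> tuples4 V" for t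
  proof -
    have "real (card I choose 4) * Ex (\<lambda>E. of_bool (arcs4 t \<subseteq> E) * \<phi> (card E)) = real (card I choose 4) * m"
      unfolding 1 using Ex_choose_mult_card[OF arcs4_subset[OF t] card_arcs4[OF t]] by simp
    then show ?thesis using choose_pos by simp
  qed
  then have 2: "Ex (\<lambda>E. cycle_count V E * \<phi> (card E)) = real (card (tuples4 V)) * m"
    unfolding cycle_count_def sum_distrib_right bexp_sum by simp
  have "Ex (\<lambda>E. (main_part E - radial_part E) * \<phi> (card E)) =
    Ex (\<lambda>E. cycle_density / 2 * (real (card E choose 4) * \<phi> (card E)) - 1 / 2 * (cycle_count V E * \<phi> (card E)))"
    by (simp add: main_part_def radial_part_def algebra_simps)
  also have "\<dots> = cycle_density / 2 * (real (card I choose 4) * m) - 1 / 2 * (real (card (tuples4 V)) * m)"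
    unfolding bexp_diff bexp_cmult 1 2 ..
  also have "\<dots> = 0" using choose_pos by (simp add: cycle_density_def)
  finally show ?thesis .
qed

lemma radial_part_lincomb:
  "radial_part = (\<lambda>E. 4 * real (card E choose 2) - cycle_density / 2 * real (card E choose 4))"
  by (rule ext) (simp add: radial_part_def)

lemma ddiff2_radial_part:
  assumes "finite E" "e \<noteq> f"
  shows "ddiff f (ddiff e radial_part) E = 4 - cycle_density * real (card (E - {e} - {f}) choose 2) / 2"
  using ddiff2_choose[OF assms, of 0] ddiff2_choose[OF assms, of 2]
  unfolding radial_part_lincomb ddiff_lincomb by (simp add: eval_nat_numeral)

lemma Ex_ddiff_radial_part:
  assumes "e \<in> I" "n \<ge> 4"
  shows "Ex (ddiff e radial_part) = linear_coeff"
proof -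
  have "ddiff e radial_part = (\<lambda>E. 4 * ddiff e (\<lambda>E. real (card E choose 2)) E - cycle_density / 2 * ddiff e (\<lambda>E. real (card E choose 4)) E)"
    by (simp only: radial_part_lincomb ddiff_lincomb)
  then have "Ex (ddiff e radial_part) = 4 * Ex (ddiff e (\<lambda>E. real (card E choose 2))) - cycle_density / 2 * Ex (ddiff e (\<lambda>E. real (card E choose 4)))"
    by (simp only: bexp_diff bexp_cmult)
  also have "Ex (ddiff e (\<lambda>E. real (card E choose 2))) = real (card I - 1) * p"
    using Ex_ddiff_choose[OF assms(1), of 1] by (simp add: numeral_2_eq_2)
  also have "Ex (ddiff e (\<lambda>E. real (card E choose 4))) = real ((card I - 1) choose 3) * p ^ 3"
    using Ex_ddiff_choose[OF assms(1), of 3] by simp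
  also have "cycle_density / 2 * (real ((card I - 1) choose 3) * p ^ 3) = 4 * (n - 2) * (n - 3) * p ^ 3"
  proof -
    have "cycle_density / 2 * (real ((card I - 1) choose 3) * p ^ 3) = cycle_density * real ((card I - 1) choose 3) / 2 * p ^ 3"
      by simp
    also have "\<dots> = 4 * (n - 2) * (n - 3) * p ^ 3" unfolding cycle_density_arc[OF assms(2)] by simp
    finally show ?thesis .
  qed
  also have "real (card I - 1) = N - 1"
  proof -
    have "card I \<noteq> 0" using assms(1) fin by auto
    then show ?thesis by (simp add: of_nat_diff)
  qed
  finally show ?thesis by (simp add: linear_coeff_def)
qed

end

text \<open>The numerical side of the hypotheses of \<open>berry_esseen_decomposition\<close>, in
  the order H, V, B, differences of B, of A, of K, and divergence of A. \<open>c\<close> stands for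
  the absolute linear coefficient. With k = |1 - sqrt 2 * p|, the assumptions on
  \<open>r * c\<close> and \<open>r * c\<^sup>2\<close> encode c >= n^2 * p * k / 2 and r = 1 / (n *
  w * k^2), so that k itself no longer occurs.\<close>

lemma rate_arithmetic:
  fixes n N p q w r c s :: real
  assumes n: "n \<ge> 1" and N: "n\<^sup>2 / 4 \<le> N" "N \<le> n\<^sup>2 / 2" and p: "0 < p" "p < 1" "q = 1 - p"
    and w: "w > 0" "w\<^sup>2 = p * q" "w \<le> 1 / 2" and r: "r > 0" and c: "c > 0"
    and s: "s = c * sqrt (N * (p * q))"
    and np: "n\<^sup>2 * p \<ge> 1"
    and rc2: "n\<^sup>2 * p \<le> (r * c)\<^sup>2 * (4 * q)" and rcc: "n ^ 3 * p\<^sup>2 \<le> r * c\<^sup>2 * (4 * w)" and rc: "n * p \<le> r * c"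
  defines "\<epsilon> \<equiv> 10 ^ 7 * r"
  shows "(p * q)\<^sup>2 * (N * (N * 160000)) \<le> (\<epsilon> * s)\<^sup>2"
    and "(p * q)\<^sup>2 * (40960 * n ^ 5 * p\<^sup>2 + N * (N * 320000)) \<le> \<epsilon> * s\<^sup>2"
    and "p * q * (N * (36 * (2 * n * p + (2 * n * p)\<^sup>2))) \<le> (\<epsilon> * s)\<^sup>2"
    and "c * (p * q) * (N * (12 * n * p)) \<le> \<epsilon> * s\<^sup>2"
    and "c * (p * q) * sqrt (p * q * (N * (18 * n\<^sup>2)\<^sup>2)) \<le> \<epsilon> * s\<^sup>2"
    and "c * (p * q) * (N * (4860 * (N * p)\<^sup>2)) \<le> \<epsilon> * s ^ 3"
    and "c * sqrt (p * q * (N * (288 * (N * p)\<^sup>2)) + (p * q)\<^sup>2 * (40960 * n ^ 5 * p\<^sup>2 + N * (N * 32))) \<le> \<epsilon> * s\<^sup>2"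
proof -
  have q: "0 < q" "q < 1" using p by auto
  have N0: "N > 0" using N(1) n by (smt (verit) zero_less_power divide_pos_pos)
  have pq: "p * q > 0" "p * q \<le> p" "p * q \<le> 1" 
    using p q by (auto simp: mult_le_one mult_left_le)
  define u where "u = r * c"
  have u: "u > 0" using r c by (simp add: u_def)
  have s2: "s\<^sup>2 = c\<^sup>2 * (N * (p * q))" using N0 pq by (simp add: s power_mult_distrib)
  have es2: "(\<epsilon> * s)\<^sup>2 = 10 ^ 14 * (u\<^sup>2 * (N * (p * q)))"
    unfolding \<epsilon>_def power_mult_distrib s2 u_def by simp
  have es: "\<epsilon> * s\<^sup>2 = 10 ^ 7 * (r * c\<^sup>2 * N * (p * q))"
    unfolding \<epsilon>_def s2 by simp
  have uq: "n\<^sup>2 * p \<le> 4 * (u\<^sup>2 * q)" using rc2 by (simp add: u_def mult_ac)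
  have "u\<^sup>2 * q \<le> u\<^sup>2 * 1" using q by (intro mult_left_mono) auto
  then have b2: "n\<^sup>2 * p \<le> 4 * u\<^sup>2" using uq by linarith
  have b1: "p * q * N \<le> 2 * u\<^sup>2"
  proof -
    have "p * q * N \<le> p * (n\<^sup>2 / 2)" using pq N p q N0 by (intro mult_mono) auto
    then show ?thesis using b2 by (simp add: mult.commute)
  qed
  have npos: "n > 0" using n by simp
  show "(p * q)\<^sup>2 * (N * (N * 160000)) \<le> (\<epsilon> * s)\<^sup>2"
  proof -
    have "(p * q)\<^sup>2 * (N * (N * 160000)) = 160000 * ((p * q * N) * (p * q * N))"
      by (simp add: power2_eq_square)
    also have "\<dots> \<le> 160000 * ((2 * u\<^sup>2) * (p * q * N))"
      using b1 pq N0 by (intro mult_left_mono mult_right_mono) auto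
    also have "\<dots> = 320000 * (u\<^sup>2 * (N * (p * q)))" by simp
    also have "\<dots> \<le> 10 ^ 14 * (u\<^sup>2 * (N * (p * q)))"
      using pq N0 by (intro mult_right_mono) auto
    finally show ?thesis unfolding es2 .
  qed
  show "p * q * (N * (36 * (2 * n * p + (2 * n * p)\<^sup>2))) \<le> (\<epsilon> * s)\<^sup>2"
  proof -
    have "n * p * 1 \<le> n * p * n" using n p by (intro mult_left_mono) auto
    then have "n * p \<le> n\<^sup>2 * p" by (simp add: power2_eq_square mult_ac)
    moreover have "n\<^sup>2 * (p * p) \<le> n\<^sup>2 * (p * 1)" using p by (intro mult_left_mono) auto
    moreover have "(2 * n * p)\<^sup>2 = 4 * (n\<^sup>2 * (p * p))" by (simp add: power2_eq_square)
    ultimately have "2 * n * p + (2 * n * p)\<^sup>2 \<le> 24 * u\<^sup>2" using b2 by linarith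
    then have "p * q * (N * (36 * (2 * n * p + (2 * n * p)\<^sup>2))) \<le> p * q * (N * (36 * (24 * u\<^sup>2)))"
      using pq N0 by (intro mult_left_mono) auto
    also have "\<dots> = 864 * (u\<^sup>2 * (N * (p * q)))" by simp
    also have "\<dots> \<le> 10 ^ 14 * (u\<^sup>2 * (N * (p * q)))"
      using pq N0 by (intro mult_right_mono) auto
    finally show ?thesis unfolding es2 .
  qed
  define v where "v = r * c\<^sup>2 * N"
  have v: "v > 0" using r c N0 by (simp add: v_def)
  have b3: "n ^ 5 * p\<^sup>2 \<le> 16 * w * v"
  proof -
    have "(n ^ 3 * p\<^sup>2) * n\<^sup>2 \<le> (r * c\<^sup>2 * (4 * w)) * (4 * N)"
      using N r w by (intro mult_mono[OF rcc]) auto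
    then show ?thesis by (simp add: v_def eval_nat_numeral mult_ac)
  qed
  \<comment> \<open>Here \<open>np\<close> enters: p * q <= p * (n^2 * p) = (n * p)^2.\<close>
  have b4: "w \<le> n * p"
  proof (rule power2_le_imp_le)
    have "p * q \<le> p * (n\<^sup>2 * p)" using p q np by (intro mult_left_mono) auto
    then have "p * q \<le> (n * p)\<^sup>2" by (simp add: power2_eq_square mult_ac)
    then show "w\<^sup>2 \<le> (n * p)\<^sup>2" unfolding w(2) .
  qed (use n p in auto)
  have b5: "p * q * n ^ 4 \<le> 16 * v"
  proof -
    have "w * (p * q * n ^ 4) \<le> (n * p) * (p * n ^ 4)"
      using b4 pq n p w by (intro mult_mono) (auto intro: mult_right_mono)
    also have "\<dots> = n ^ 5 * p\<^sup>2" by (simp add: eval_nat_numeral mult_ac)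
    also have "\<dots> \<le> w * (16 * v)" using b3 by (simp add: mult_ac)
    finally show ?thesis using w(1) by simp
  qed
  have N2: "N * N \<le> n ^ 4 / 4"
  proof -
    have "N * N \<le> (n\<^sup>2 / 2) * (n\<^sup>2 / 2)" using N N0 by (intro mult_mono) auto
    then show ?thesis by (simp add: eval_nat_numeral)
  qed
  show "(p * q)\<^sup>2 * (40960 * n ^ 5 * p\<^sup>2 + N * (N * 320000)) \<le> \<epsilon> * s\<^sup>2"
  proof -
    have "p * q * (n ^ 5 * p\<^sup>2) \<le> 8 * v"
    proof -
      have "p * q * (n ^ 5 * p\<^sup>2) \<le> 1 * (16 * w * v)" using n by (intro mult_mono[OF pq(3) b3]) auto
      moreover have "w * v \<le> 1 / 2 * v" using w v by (intro mult_right_mono) auto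
      ultimately show ?thesis by linarith
    qed
    moreover have "p * q * (N * N) \<le> 4 * v"
    proof -
      have "p * q * (N * N) \<le> p * q * (n ^ 4 / 4)" using N2 pq by (intro mult_left_mono) auto
      then show ?thesis using b5 by linarith
    qed
    ultimately have "p * q * (40960 * n ^ 5 * p\<^sup>2 + N * (N * 320000)) \<le> 10 ^ 7 * v"
      using v by (simp add: ring_distribs mult.assoc mult.left_commute[of _ 40960] mult.left_commute[of _ 320000])
    then have "p * q * (p * q * (40960 * n ^ 5 * p\<^sup>2 + N * (N * 320000))) \<le> p * q * (10 ^ 7 * v)"
      using pq by (intro mult_left_mono) auto
    then show ?thesis unfolding es v_def by (simp add: power2_eq_square mult_ac)
  qed
  show "c * (p * q) * (N * (12 * n * p)) \<le> \<epsilon> * s\<^sup>2"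
  proof -
    have "c * (p * q) * (N * (12 * n * p)) = 12 * (c * (p * q) * N * (n * p))" by simp
    also have "\<dots> \<le> 12 * (c * (p * q) * N * (r * c))"
      using rc c pq N0 by (intro mult_left_mono) auto
    also have "\<dots> = 12 * (r * c\<^sup>2 * N * (p * q))" by (simp add: power2_eq_square)
    also have "\<dots> \<le> 10 ^ 7 * (r * c\<^sup>2 * N * (p * q))" using r pq N0 by (intro mult_right_mono) auto
    finally show ?thesis unfolding es .
  qed
  have sq: "sqrt (p * q * N) \<le> 2 * u"
  proof (rule real_le_lsqrt[THEN order_trans])
    have "(2 * u)\<^sup>2 = 4 * u\<^sup>2" by (simp add: power_mult_distrib)
    moreover have "0 \<le> u\<^sup>2" by simp
    ultimately show "p * q * N \<le> (2 * u)\<^sup>2" using b1 by linarith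
  qed (use u pq N0 in auto)
  show "c * (p * q) * sqrt (p * q * (N * (18 * n\<^sup>2)\<^sup>2)) \<le> \<epsilon> * s\<^sup>2"
  proof -
    have "sqrt (p * q * (N * (18 * n\<^sup>2)\<^sup>2)) = sqrt (p * q * N) * (18 * n\<^sup>2)"
      by (simp only: mult.assoc[of "p * q", symmetric] real_sqrt_mult[of "p * q * N"] real_sqrt_abs) simp
    also have "\<dots> \<le> (2 * u) * (18 * (4 * N))"
      using sq u N by (intro mult_mono) auto
    finally have "c * (p * q) * sqrt (p * q * (N * (18 * n\<^sup>2)\<^sup>2)) \<le> c * (p * q) * ((2 * u) * (18 * (4 * N)))"
      using c pq by (intro mult_left_mono) auto
    also have "\<dots> = 144 * (r * c\<^sup>2 * N * (p * q))" by (simp add: u_def power2_eq_square)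
    also have "\<dots> \<le> 10 ^ 7 * (r * c\<^sup>2 * N * (p * q))" using r pq N0 by (intro mult_right_mono) auto
    finally show ?thesis unfolding es .
  qed
  show "c * (p * q) * (N * (4860 * (N * p)\<^sup>2)) \<le> \<epsilon> * s ^ 3"
  proof -
    \<comment> \<open>After \<open>rcc\<close> has absorbed n^3 * p^2, one factor n is left over; it
      becomes sqrt N and completes sqrt (N * p * q), that is, s / c.\<close>
    have sN: "n / 2 \<le> sqrt N"
      using N(1) by (intro real_le_rsqrt) (simp add: power_divide)
    have sw: "sqrt (N * (p * q)) = sqrt N * w"
      using w by (simp add: real_sqrt_mult w(2)[symmetric])
    have "(N * p)\<^sup>2 = N * N * p\<^sup>2" by (simp add: power2_eq_square)
    also have "\<dots> \<le> n ^ 4 / 4 * p\<^sup>2" by (intro mult_right_mono N2) simp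
    also have "\<dots> = n / 4 * (n ^ 3 * p\<^sup>2)" by (simp add: eval_nat_numeral)
    also have "\<dots> \<le> n / 4 * (r * c\<^sup>2 * (4 * w))" using rcc n by (intro mult_left_mono) auto
    also have "\<dots> = 2 * (r * c\<^sup>2 * w * (n / 2))" by simp
    also have "\<dots> \<le> 2 * (r * c\<^sup>2 * w * sqrt N)" using sN r w by (intro mult_left_mono) auto
    finally have *: "(N * p)\<^sup>2 \<le> 2 * (r * c\<^sup>2 * sqrt (N * (p * q)))" unfolding sw by (simp add: mult_ac)
    have "c * (p * q) * (N * (4860 * (N * p)\<^sup>2)) = c * (p * q) * N * 4860 * (N * p)\<^sup>2" by simp
    also have "\<dots> \<le> c * (p * q) * N * 4860 * (2 * (r * c\<^sup>2 * sqrt (N * (p * q))))"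
      using * c pq N0 by (intro mult_left_mono) auto
    also have "\<dots> = 9720 * (r * (s * s\<^sup>2))" unfolding s2 by (simp add: s power2_eq_square mult_ac)
    also have "\<dots> \<le> 10 ^ 7 * (r * (s * s\<^sup>2))" using r c pq N0 by (intro mult_right_mono) (auto simp: s)
    finally show ?thesis unfolding \<epsilon>_def by (simp add: power2_eq_square power3_eq_cube mult_ac)
  qed
  show "c * sqrt (p * q * (N * (288 * (N * p)\<^sup>2)) + (p * q)\<^sup>2 * (40960 * n ^ 5 * p\<^sup>2 + N * (N * 32))) \<le> \<epsilon> * s\<^sup>2"
    (is "c * sqrt ?X \<le> _")
  proof -
    \<comment> \<open>A common majorant of the three summands, chosen so that \<open>uq\<close>
      turns it into a perfect square.\<close>
    define Y where "Y = (n\<^sup>2 * p) * (N\<^sup>2 * p\<^sup>2 * q)"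
    have Z: "N\<^sup>2 * p\<^sup>2 * q > 0" using N0 p q by simp
    have Y0: "Y > 0" unfolding Y_def using Z np by (intro mult_pos_pos[of "n\<^sup>2 * p"]) linarith+
    have t1: "p * q * (N * (288 * (N * p)\<^sup>2)) \<le> 144 * Y"
    proof -
      have "p * q * (N * (288 * (N * p)\<^sup>2)) = 288 * p * (N\<^sup>2 * p\<^sup>2 * q) * N" by (simp add: power2_eq_square)
      also have "\<dots> \<le> 288 * p * (N\<^sup>2 * p\<^sup>2 * q) * (n\<^sup>2 / 2)" using N Z p by (intro mult_left_mono) auto
      finally show ?thesis by (simp add: Y_def mult_ac)
    qed
    have t2: "(p * q)\<^sup>2 * (N * (N * 32)) \<le> 32 * Y"
    proof -
      have "(p * q)\<^sup>2 * (N * (N * 32)) = 32 * (q * (N\<^sup>2 * p\<^sup>2 * q))" by (simp add: power2_eq_square)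
      also have "\<dots> \<le> 32 * ((n\<^sup>2 * p) * (N\<^sup>2 * p\<^sup>2 * q))"
        using q np Z by (intro mult_left_mono mult_right_mono) auto
      finally show ?thesis by (simp add: Y_def)
    qed
    have t3: "(p * q)\<^sup>2 * (40960 * n ^ 5 * p\<^sup>2) \<le> 655360 * Y"
    proof -
      have "n ^ 5 \<le> n ^ 6" using n by (intro power_increasing) auto
      also have "n ^ 6 = (n\<^sup>2)\<^sup>2 * n\<^sup>2" by (simp add: power_mult[symmetric] power_add[symmetric])
      also have "\<dots> \<le> (4 * N)\<^sup>2 * n\<^sup>2" using N by (intro mult_right_mono power_mono) auto
      finally have "n ^ 5 \<le> 16 * (N\<^sup>2 * n\<^sup>2)" by (simp add: power_mult_distrib)
      then have "(p * q)\<^sup>2 * (40960 * p\<^sup>2) * n ^ 5 \<le> (p * q)\<^sup>2 * (40960 * p\<^sup>2) * (16 * (N\<^sup>2 * n\<^sup>2))"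
        by (intro mult_left_mono) auto
      also have "\<dots> = 655360 * ((p * q) * Y)" by (simp add: Y_def power2_eq_square)
      also have "\<dots> \<le> 655360 * (1 * Y)" using pq Y0 by (intro mult_left_mono mult_right_mono) auto
      finally show ?thesis by (simp add: mult_ac)
    qed
    have "?X \<le> 1000000 * Y" unfolding distrib_left using t1 t2 t3 Y0 by linarith
    then have "?X \<le> 10 ^ 6 * Y" by simp
    also have "\<dots> \<le> 10 ^ 6 * (4 * (u\<^sup>2 * q) * (N\<^sup>2 * p\<^sup>2 * q))"
      unfolding Y_def using uq Z by (intro mult_left_mono mult_right_mono) auto
    also have "\<dots> = (2000 * (u * (N * (p * q))))\<^sup>2" by (simp add: power2_eq_square)
    finally have "sqrt ?X \<le> 2000 * (u * (N * (p * q)))"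
      using u N0 pq by (intro real_le_lsqrt) auto
    then have "c * sqrt ?X \<le> c * (2000 * (u * (N * (p * q))))" using c by (intro mult_left_mono) auto
    also have "\<dots> = 2000 * (r * c\<^sup>2 * N * (p * q))" by (simp add: u_def power2_eq_square)
    also have "\<dots> \<le> 10 ^ 7 * (r * c\<^sup>2 * N * (p * q))" using r pq N0 by (intro mult_right_mono) auto
    finally show ?thesis unfolding es .
  qed
qed

section \<open>Second moments of the parts and the rate for any count given by the edge
  formula\<close>

context random_graph_space
begin

lemma Ex_sq_bound:
  assumes "\<And>E. E \<subseteq> I \<Longrightarrow> \<bar>F E\<bar> \<le> b"
  shows "Ex (\<lambda>E. (F E)\<^sup>2) \<le> b\<^sup>2"
proof -
  have "Ex (\<lambda>E. (F E)\<^sup>2) \<le> Ex (\<lambda>E. b\<^sup>2)"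
  proof (rule Ex_mono)
    fix E assume "E \<subseteq> I"
    from power_mono[OF assms[OF this], of 2] show "(F E)\<^sup>2 \<le> b\<^sup>2" by simp
  qed
  then show ?thesis by simp
qed

lemma sum_pairs_le:
  assumes "\<And>e f. e \<in> I \<Longrightarrow> f \<in> I \<Longrightarrow> e \<noteq> f \<Longrightarrow> a e f \<le> b" "0 \<le> b"
  shows "(\<Sum>e\<in>I. \<Sum>f\<in>I - {e}. a e f) \<le> N * (N * b)"
proof -
  have "(\<Sum>f\<in>I - {e}. a e f) \<le> N * b" if "e \<in> I" for e
  proof -
    have "(\<Sum>f\<in>I - {e}. a e f) \<le> (\<Sum>f\<in>I - {e}. b)" using assms that by (intro sum_mono) auto
    also have "\<dots> \<le> (\<Sum>f\<in>I. b)" using assms fin by (intro sum_mono2) auto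
    finally show ?thesis by simp
  qed
  then have "(\<Sum>e\<in>I. \<Sum>f\<in>I - {e}. a e f) \<le> (\<Sum>e\<in>I. N * b)" by (intro sum_mono) auto
  then show ?thesis by simp
qed

text \<open>Subtracting the mean and the linear term makes the function and its first differences
  centred, so the second-order Poincare inequality applies. Second differences have the form 4 - a /
  2 with a in [0, 800], hence the bound 400.\<close>

lemma Ex_radial_sq_le:
  assumes "n \<ge> 10"
  shows "Ex (\<lambda>E. (radial_part E - Ex radial_part - linear_coeff * cdev E)\<^sup>2) \<le> (p * q)\<^sup>2 * (N * (N * 160000))"
proof -
  define H where "H E = radial_part E - Ex radial_part - linear_coeff * cdev E" for E
  have "ddiff e (\<lambda>_. 1 :: real) = (\<lambda>_. 0)" for e :: "'v set" by (rule ext) (simp add: ddiff_def)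
  then have "Ex (\<lambda>E. cdev E) = 0" using Ex_cdev_mult[of "\<lambda>_. 1"] by simp
  then have ExH: "Ex H = 0" unfolding H_def[abs_def] by (simp add: bexp_diff bexp_cmult)
  have dH: "ddiff e H E = ddiff e radial_part E - linear_coeff" if "finite E" for e E
    using that unfolding H_def[abs_def] ddiff_def by (simp add: card_insert_eq_remove algebra_simps)
  have ExdH: "Ex (ddiff e H) = 0" if "e \<in> I" for e
  proof -
    have "Ex (ddiff e H) = Ex (\<lambda>E. ddiff e radial_part E - linear_coeff)"
      by (rule bexp_cong) (simp add: dH finE)
    then show ?thesis using Ex_ddiff_radial_part[OF that] assms by (simp add: bexp_diff)
  qed
  have "Ex (\<lambda>E. (H E)\<^sup>2) \<le> (p * q)\<^sup>2 * (\<Sum>e\<in>I. \<Sum>f\<in>I - {e}. Ex (\<lambda>E. (ddiff f (ddiff e H) E)\<^sup>2))"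
    by (rule Ex_poincare2[OF ExH ExdH])
  also have "\<dots> \<le> (p * q)\<^sup>2 * (N * (N * 160000))"
  proof (intro mult_left_mono sum_pairs_le)
    fix e f assume ef: "e \<in> I" "f \<in> I" "e \<noteq> f"
    have "Ex (\<lambda>E. (ddiff f (ddiff e H) E)\<^sup>2) \<le> 400\<^sup>2"
    proof (rule Ex_sq_bound)
      fix E assume E: "E \<subseteq> I"
      have "ddiff f (ddiff e H) E = ddiff f (ddiff e radial_part) E"
        using finE[OF E] unfolding ddiff_def[of f] by (simp add: dH)
      also have "\<dots> = 4 - cycle_density * real (card (E - {e} - {f}) choose 2) / 2"
        by (rule ddiff2_radial_part[OF finE[OF E] ef(3)])
      finally have eq: "ddiff f (ddiff e H) E = 4 - cycle_density * real (card (E - {e} - {f}) choose 2) / 2" .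
      have "card (E - {e} - {f}) \<le> card I" using E by (intro card_mono fin) auto
      from cycle_density_pairs[OF assms this] show "\<bar>ddiff f (ddiff e H) E\<bar> \<le> 400"
        unfolding eq by linarith
    qed
    then show "Ex (\<lambda>E. (ddiff f (ddiff e H) E)\<^sup>2) \<le> 160000" by simp
  qed auto
  finally show ?thesis unfolding H_def .
qed

text \<open>Both parts have the same mean and the same mean first differences, so the second-order
  Poincare inequality applies to their difference. The radial contribution to the second differences
  is bounded, 800^2 / 2 = 320000; the cycles give the power n^5.\<close>

lemma Ex_transversal_sq_le:
  assumes "n \<ge> 10"
  shows "Ex (\<lambda>E. (main_part E - radial_part E)\<^sup>2)
    \<le> (p * q)\<^sup>2 * (40960 * n ^ 5 * p\<^sup>2 + N * (N * 320000))"
proof -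
  define F where "F E = main_part E - radial_part E" for E
  have F_eq: "F = (\<lambda>E. cycle_density / 2 * real (card E choose 4) - 1 / 2 * cycle_count V E)"
    by (rule ext) (simp add: F_def main_part_def radial_part_def)
  have ExF: "Ex F = 0" using Ex_cycle_count_mult[of "\<lambda>_. 1"] assms unfolding F_def[abs_def] by simp
  have ExdF: "Ex (ddiff e F) = 0" if "e \<in> I" for e
  proof -
    have "Ex (ddiff e F) = cycle_density / 2 * (real ((card I - 1) choose 3) * p ^ 3) - 1 / 2 * (8 * (n - 2) * (n - 3) * p ^ 3)"
      unfolding F_eq ddiff_lincomb bexp_diff bexp_cmult
      using Ex_ddiff_choose[OF that, of 3] Ex_ddiff_cycle_count[OF that] assms by simp
    also have "\<dots> = (cycle_density * real ((card I - 1) choose 3) - 8 * (n - 2) * (n - 3)) * (p ^ 3 / 2)"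
      by (simp add: algebra_simps)
    also have "\<dots> = 0" using cycle_density_arc assms by simp
    finally show ?thesis .
  qed
  have ddF: "Ex (\<lambda>E. (ddiff f (ddiff e F) E)\<^sup>2) \<le> 1 / 2 * Ex (\<lambda>E. (ddiff f (ddiff e (cycle_count V)) E)\<^sup>2) + 320000"
    if ef: "e \<noteq> f" for e f
  proof -
    have "Ex (\<lambda>E. (ddiff f (ddiff e F) E)\<^sup>2) \<le> Ex (\<lambda>E. 1 / 2 * (ddiff f (ddiff e (cycle_count V)) E)\<^sup>2 + 320000)"
    proof (rule Ex_mono)
      fix E assume E: "E \<subseteq> I"
      define a where "a = cycle_density * real (card (E - {e} - {f}) choose 2)"
      define b where "b = ddiff f (ddiff e (cycle_count V)) E"
      have le: "card (E - {e} - {f}) \<le> card I" using E by (intro card_mono fin) auto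
      have "0 \<le> a" "a \<le> 800" unfolding a_def
        using cycle_density_pairs[OF assms le] by blast+
      then have "a\<^sup>2 \<le> 800\<^sup>2" by (intro power_mono) auto
      have "ddiff f (ddiff e F) E = a / 2 - b / 2"
        unfolding F_eq ddiff_lincomb a_def b_def using ddiff2_choose[OF finE[OF E] ef, of 2] by (simp add: eval_nat_numeral)
      then have "(ddiff f (ddiff e F) E)\<^sup>2 = (a / 2 - b / 2)\<^sup>2" by simp
      also have "\<dots> \<le> a\<^sup>2 / 2 + b\<^sup>2 / 2"
      proof -
        have "a\<^sup>2 / 2 + b\<^sup>2 / 2 - (a / 2 - b / 2)\<^sup>2 = (a / 2 + b / 2)\<^sup>2" by (simp add: power2_eq_square field_simps)
        moreover have "0 \<le> (a / 2 + b / 2)\<^sup>2" by simp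
        ultimately show ?thesis by linarith
      qed
      finally show "(ddiff f (ddiff e F) E)\<^sup>2 \<le> 1 / 2 * b\<^sup>2 + 320000" using \<open>a\<^sup>2 \<le> 800\<^sup>2\<close> by simp
    qed
    then show ?thesis by (simp only: bexp_add bexp_cmult Ex_const)
  qed
  have "(\<Sum>e\<in>I. \<Sum>f\<in>I - {e}. Ex (\<lambda>E. (ddiff f (ddiff e F) E)\<^sup>2))
    \<le> (\<Sum>e\<in>I. \<Sum>f\<in>I - {e}. 1 / 2 * Ex (\<lambda>E. (ddiff f (ddiff e (cycle_count V)) E)\<^sup>2) + 320000)"
    by (intro sum_mono ddF) auto
  also have "\<dots> = 1 / 2 * (\<Sum>e\<in>I. \<Sum>f\<in>I - {e}. Ex (\<lambda>E. (ddiff f (ddiff e (cycle_count V)) E)\<^sup>2)) + (\<Sum>e\<in>I. \<Sum>f\<in>I - {e}. 320000)"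
    by (simp only: sum.distrib sum_distrib_left)
  also have "\<dots> \<le> 1 / 2 * (81920 * n ^ 5 * p\<^sup>2) + N * (N * 320000)"
    using assms by (intro add_mono mult_left_mono sum_ddiff2_cycle_count_sq sum_pairs_le) auto
  also have "\<dots> = 40960 * n ^ 5 * p\<^sup>2 + N * (N * 320000)" by (simp add: mult_ac)
  finally have "(\<Sum>e\<in>I. \<Sum>f\<in>I - {e}. Ex (\<lambda>E. (ddiff f (ddiff e F) E)\<^sup>2)) \<le> 40960 * n ^ 5 * p\<^sup>2 + N * (N * 320000)" .
  then have "(p * q)\<^sup>2 * (\<Sum>e\<in>I. \<Sum>f\<in>I - {e}. Ex (\<lambda>E. (ddiff f (ddiff e F) E)\<^sup>2))
    \<le> (p * q)\<^sup>2 * (40960 * n ^ 5 * p\<^sup>2 + N * (N * 320000))" by (rule mult_left_mono) simp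
  then show ?thesis using Ex_poincare2[OF ExF ExdF] unfolding F_def by linarith
qed

text \<open>The isometry for the divergence; since differences commute, its cross terms are squares
  of second differences. The assumption on \<open>N * p\<close> lets the linear part of the second
  moment of \<open>card E\<close> be absorbed by the quadratic one.\<close>

lemma Ex_main_divergence_le:
  assumes "n \<ge> 1" "N * p \<ge> 1"
  shows "Ex (\<lambda>E. (\<Sum>e\<in>I. dev e E * ddiff e main_part E)\<^sup>2)
    \<le> p * q * (N * (288 * (N * p)\<^sup>2)) + (p * q)\<^sup>2 * (40960 * n ^ 5 * p\<^sup>2 + N * (N * 32))"
proof -
  have first: "Ex (\<lambda>E. (ddiff e main_part E)\<^sup>2) \<le> 288 * (N * p)\<^sup>2" if e: "e \<in> I" for e
  proof -
    have "Ex (\<lambda>E. (ddiff e main_part E)\<^sup>2) \<le> Ex (\<lambda>E. 144 * (real (card (E \<inter> I)))\<^sup>2)"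
    proof (rule Ex_mono)
      fix E assume E: "E \<subseteq> I"
      then have "E \<inter> I = E" by auto
      then show "(ddiff e main_part E)\<^sup>2 \<le> 144 * (real (card (E \<inter> I)))\<^sup>2"
        using power_mono[OF ddiff_main_part_le[OF e E], of 2] by (simp add: power_mult_distrib)
    qed
    also have "\<dots> \<le> 144 * (N * p + (N * p)\<^sup>2)" unfolding bexp_cmult by (intro mult_left_mono Ex_card_inter_sq_le) auto
    also have "\<dots> \<le> 144 * ((N * p)\<^sup>2 + (N * p)\<^sup>2)"
      using self_le_power[OF assms(2), of 2] by (intro mult_left_mono add_mono) auto
    finally show ?thesis by simp
  qed
  have second: "Ex (\<lambda>E. ddiff f (ddiff e main_part) E * ddiff e (ddiff f main_part) E)
    \<le> 1 / 2 * Ex (\<lambda>E. (ddiff f (ddiff e (cycle_count V)) E)\<^sup>2) + 32" if ef: "e \<noteq> f" for e f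
  proof -
    have "Ex (\<lambda>E. ddiff f (ddiff e main_part) E * ddiff e (ddiff f main_part) E) \<le>
      Ex (\<lambda>E. 1 / 2 * (ddiff f (ddiff e (cycle_count V)) E)\<^sup>2 + 32)"
    proof (rule Ex_mono)
      fix E assume E: "E \<subseteq> I"
      define b where "b = ddiff f (ddiff e (cycle_count V)) E"
      have "ddiff f (ddiff e main_part) E * ddiff e (ddiff f main_part) E = (4 - b / 2)\<^sup>2"
        unfolding ddiff_commute[of e f] ddiff2_main_part[OF finE[OF E] ef] b_def by (simp add: power2_eq_square)
      also have "\<dots> \<le> 1 / 2 * b\<^sup>2 + 32"
      proof -
        have "1 / 2 * b\<^sup>2 + 32 - (4 - b / 2)\<^sup>2 = (4 + b / 2)\<^sup>2" by (simp add: power2_eq_square field_simps)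
        moreover have "0 \<le> (4 + b / 2)\<^sup>2" by simp
        ultimately show ?thesis by linarith
      qed
      finally show "ddiff f (ddiff e main_part) E * ddiff e (ddiff f main_part) E \<le> 1 / 2 * b\<^sup>2 + 32" .
    qed
    then show ?thesis by (simp only: bexp_add bexp_cmult Ex_const)
  qed
  have "(\<Sum>e\<in>I. \<Sum>f\<in>I - {e}. Ex (\<lambda>E. ddiff f (ddiff e main_part) E * ddiff e (ddiff f main_part) E))
    \<le> (\<Sum>e\<in>I. \<Sum>f\<in>I - {e}. 1 / 2 * Ex (\<lambda>E. (ddiff f (ddiff e (cycle_count V)) E)\<^sup>2) + 32)"
    by (intro sum_mono second) auto
  also have "\<dots> = 1 / 2 * (\<Sum>e\<in>I. \<Sum>f\<in>I - {e}. Ex (\<lambda>E. (ddiff f (ddiff e (cycle_count V)) E)\<^sup>2)) + (\<Sum>e\<in>I. \<Sum>f\<in>I - {e}. 32)"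
    by (simp only: sum.distrib sum_distrib_left)
  also have "\<dots> \<le> 1 / 2 * (81920 * n ^ 5 * p\<^sup>2) + N * (N * 32)"
    using assms by (intro add_mono mult_left_mono sum_ddiff2_cycle_count_sq sum_pairs_le) auto
  also have "\<dots> = 40960 * n ^ 5 * p\<^sup>2 + N * (N * 32)" by (simp add: mult_ac)
  finally have s2: "(\<Sum>e\<in>I. \<Sum>f\<in>I - {e}. Ex (\<lambda>E. ddiff f (ddiff e main_part) E * ddiff e (ddiff f main_part) E))
     \<le> 40960 * n ^ 5 * p\<^sup>2 + N * (N * 32)" .
  have s1: "(\<Sum>e\<in>I. Ex (\<lambda>E. (ddiff e main_part E)\<^sup>2)) \<le> N * (288 * (N * p)\<^sup>2)"
    using sum_mono[OF first, of I "\<lambda>e. e"] by simp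
  have "Ex (\<lambda>E. (\<Sum>e\<in>I. dev e E * ddiff e main_part E)\<^sup>2) = p * q * (\<Sum>e\<in>I. Ex (\<lambda>E. (ddiff e main_part E)\<^sup>2))
     + (p * q)\<^sup>2 * (\<Sum>e\<in>I. \<Sum>f\<in>I - {e}. Ex (\<lambda>E. ddiff f (ddiff e main_part) E * ddiff e (ddiff f main_part) E))"
    by (rule Ex_divergence_sq) (simp add: ddiff_def)
  also have "\<dots> \<le> p * q * (N * (288 * (N * p)\<^sup>2)) + (p * q)\<^sup>2 * (40960 * n ^ 5 * p\<^sup>2 + N * (N * 32))"
    using s1 s2 pq_pos by (intro add_mono mult_left_mono) auto
  finally show ?thesis .
qed

text \<open>The coefficient factors as 2 * p * (n - 2) * ((n - 3) * (1 - 2 * p^2) + 4), and 1 - 2 *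
  p^2 is a multiple of 1 - sqrt 2 * p. The shift by 4 could cancel the main term near p = 1 / sqrt
  2; the assumption keeps n * |1 - sqrt 2 * p| well above it.\<close>

lemma abs_linear_coeff_ge:
  assumes "n * \<bar>1 - sqrt 2 * p\<bar> \<ge> 400"
  shows "n\<^sup>2 * p * \<bar>1 - sqrt 2 * p\<bar> / 2 \<le> \<bar>linear_coeff\<bar>"
proof -
  define k where "k = \<bar>1 - sqrt 2 * p\<bar>"
  have sqrt2: "sqrt 2 \<le> 2" by (rule real_le_lsqrt) auto
  have k1: "k \<le> 1"
  proof -
    have "sqrt 2 * p \<le> 2 * 1" using sqrt2 p_pos p_less by (intro mult_mono) auto
    moreover have "0 \<le> sqrt 2 * p" using p_pos by simp
    ultimately show ?thesis unfolding k_def by linarith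
  qed
  have k0: "k \<ge> 0" by (simp add: k_def)
  have nk: "n * k \<ge> 400" using assms by (simp add: k_def)
  then have n: "n \<ge> 400" using mult_left_mono[OF k1, of n] by simp
  have fac: "\<bar>1 - 2 * p\<^sup>2\<bar> \<ge> k"
  proof -
    have "1 - 2 * p\<^sup>2 = (1 - sqrt 2 * p) * (1 + sqrt 2 * p)" by (simp add: power2_eq_square algebra_simps)
    then have "\<bar>1 - 2 * p\<^sup>2\<bar> = k * (1 + sqrt 2 * p)" using p_pos by (simp add: abs_mult k_def)
    moreover have "k * 1 \<le> k * (1 + sqrt 2 * p)" using k0 p_pos by (intro mult_left_mono) auto
    ultimately show ?thesis by simp
  qed
  have "linear_coeff = 2 * p * (n - 2) * ((n - 3) * (1 - 2 * p\<^sup>2) + 4)"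
    unfolding linear_coeff_def N_eq by (simp add: power2_eq_square power3_eq_cube field_simps)
  then have "\<bar>linear_coeff\<bar> = 2 * p * (n - 2) * \<bar>(n - 3) * (1 - 2 * p\<^sup>2) + 4\<bar>"
    using n p_pos by (simp add: abs_mult)
  moreover have "n * k / 2 \<le> \<bar>(n - 3) * (1 - 2 * p\<^sup>2) + 4\<bar>"
  proof -
    have "(n - 3) * k \<le> (n - 3) * \<bar>1 - 2 * p\<^sup>2\<bar>" using fac n by (intro mult_left_mono) auto
    also have "\<dots> = \<bar>(n - 3) * (1 - 2 * p\<^sup>2)\<bar>" using n by (simp add: abs_mult)
    finally have "(n - 3) * k \<le> \<bar>(n - 3) * (1 - 2 * p\<^sup>2)\<bar>" .
    moreover have "(n - 3) * k = n * k - 3 * k" by (simp add: left_diff_distrib)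
    ultimately show ?thesis using k1 nk by linarith
  qed
  moreover have "2 * p * (n / 2) * (n * k / 2) \<le> 2 * p * (n - 2) * \<bar>(n - 3) * (1 - 2 * p\<^sup>2) + 4\<bar>"
    using calculation(2) n p_pos k0 by (intro mult_mono) auto
  ultimately show ?thesis unfolding k_def[symmetric] by (simp add: power2_eq_square mult_ac)
qed

text \<open>For r > 1/200 the claim is trivial. Otherwise n * w * k^2 is at least 200, and since w
  <= 1/2 and k <= 1 every largeness condition on n and p follows from this one inequality.\<close>

theorem edge_formula_rate:
  fixes K :: "'v set set \<Rightarrow> real" and z :: real
  defines "r \<equiv> 1 / (n * sqrt (p * q) * (1 - sqrt 2 * p)\<^sup>2)"
  assumes n1: "n \<ge> 1" and p_ne: "p \<noteq> 1 / sqrt 2"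
    and K: "\<And>E. E \<subseteq> I \<Longrightarrow> K E = main_part E + local_part E"
  shows "\<bar>Ex (\<lambda>E. of_bool ((K E - Ex K) / sqrt (Ex (\<lambda>E. (K E - Ex K)\<^sup>2)) \<le> z)) - gauss_cdf z\<bar>
    \<le> 10 ^ 10 * r"
proof (cases "r \<le> 1 / 200")
  case False
  have "0 \<le> Ex (\<lambda>E. of_bool ((K E - Ex K) / sqrt (Ex (\<lambda>E. (K E - Ex K)\<^sup>2)) \<le> z))" by (rule Ex_nonneg) simp
  moreover have "Ex (\<lambda>E. of_bool ((K E - Ex K) / sqrt (Ex (\<lambda>E. (K E - Ex K)\<^sup>2)) \<le> z)) \<le> Ex (\<lambda>_. 1)" by (rule Ex_mono) simp
  ultimately have "\<bar>Ex (\<lambda>E. of_bool ((K E - Ex K) / sqrt (Ex (\<lambda>E. (K E - Ex K)\<^sup>2)) \<le> z)) - gauss_cdf z\<bar> \<le> 1"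
    using gauss_cdf_bounds[of z] by simp
  moreover have "1 \<le> 10 ^ 10 * r" using False by simp
  ultimately show ?thesis by linarith
next
  case True
  define k where "k = \<bar>1 - sqrt 2 * p\<bar>"
  define w where "w = sqrt (p * q)"
  define c where "c = \<bar>linear_coeff\<bar>"
  define s where "s = c * sqrt (N * (p * q))"
  have w: "w > 0" "w\<^sup>2 = p * q" using pq_pos by (simp_all add: w_def)
  have w_half: "w \<le> 1 / 2"
  proof -
    have "(1 / 2)\<^sup>2 - p * q = (p - 1 / 2)\<^sup>2" by (simp add: power2_eq_square field_simps)
    then have "p * q \<le> (1 / 2)\<^sup>2" by (metis zero_le_power2 diff_ge_0_iff_ge)
    then show ?thesis unfolding w_def by (intro real_le_lsqrt) (use pq_pos in auto)
  qed
  have k0: "k > 0" using p_ne unfolding k_def by (auto simp: field_simps)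
  have k1: "k \<le> 1"
  proof -
    have "sqrt 2 \<le> 2" by (rule real_le_lsqrt) auto
    then have "sqrt 2 * p \<le> 2 * 1" using p_pos p_less by (intro mult_mono) auto
    moreover have "0 \<le> sqrt 2 * p" using p_pos by simp
    ultimately show ?thesis unfolding k_def by linarith
  qed
  have r_eq: "r = 1 / (n * w * k\<^sup>2)" by (simp add: r_def w_def k_def)
  have r0: "r > 0" using n1 w k0 by (simp add: r_eq)
  have rw: "r * (n * w * k\<^sup>2) = 1" using n1 w k0 by (simp add: r_eq)
  have big: "n * w * k\<^sup>2 \<ge> 200"
  proof -
    have "n * w * k\<^sup>2 > 0" using n1 w k0 by simp
    then show ?thesis using True unfolding r_eq by (simp add: field_simps)
  qed
  have k2: "k\<^sup>2 \<le> k" using k0 k1 by (simp add: power2_eq_square)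
  \<comment> \<open>Use w <= 1/2 and k^2 <= k in n * w * k^2 >= 200.\<close>
  have nk: "n * k \<ge> 400"
  proof -
    have "n * w * k\<^sup>2 \<le> n * (1 / 2) * k" using n1 w w_half k2 by (intro mult_mono) auto
    then show ?thesis using big by linarith
  qed
  have n: "n \<ge> 400" using nk mult_left_mono[OF k1, of n] by simp
  have nw: "n * w \<ge> 200"
  proof -
    have "n * w * k\<^sup>2 \<le> n * w * 1" using n1 w k1 k2 by (intro mult_left_mono) auto
    then show ?thesis using big by simp
  qed
  have np: "n\<^sup>2 * p \<ge> 40000"
  proof -
    have "200\<^sup>2 \<le> (n * w)\<^sup>2" using nw by (intro power_mono) auto
    also have "\<dots> = n\<^sup>2 * p * q" by (simp add: power_mult_distrib w)
    also have "\<dots> \<le> n\<^sup>2 * p * 1" using p_pos by (intro mult_left_mono) auto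
    finally show ?thesis by simp
  qed
  have c_ge: "n\<^sup>2 * p * k / 2 \<le> c" unfolding c_def k_def by (rule abs_linear_coeff_ge) (use nk in \<open>simp add: k_def\<close>)
  have c0: "c > 0"
  proof -
    have "0 < n\<^sup>2 * p * k / 2" using n p_pos k0 by simp
    then show ?thesis using c_ge by linarith
  qed
  have N: "n\<^sup>2 / 4 \<le> N" "N \<le> n\<^sup>2 / 2" using N_ge N_le n by auto
  \<comment> \<open>Multiply by \<open>rw\<close>, which is 1, and regroup so that the lower bound
    for \<open>c\<close> appears.\<close>
  have rc1: "n * p \<le> r * c * (2 * w * k)"
  proof -
    have "n * p = r * (n * w * k\<^sup>2) * (n * p)" using rw by simp
    also have "\<dots> = r * (n\<^sup>2 * p * k / 2) * (2 * w * k)" by (simp add: power2_eq_square)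
    also have "\<dots> \<le> r * c * (2 * w * k)" using c_ge r0 w k0 by (intro mult_right_mono mult_left_mono) auto
    finally show ?thesis .
  qed
  have rc: "n * p \<le> r * c"
  proof -
    have "w * k \<le> 1 / 2 * 1" using w w_half k0 k1 by (intro mult_mono) auto
    then have "r * c * (2 * w * k) \<le> r * c * 1" using r0 c0 by (intro mult_left_mono) auto
    then show ?thesis using rc1 by simp
  qed
  have rc2: "n\<^sup>2 * p \<le> (r * c)\<^sup>2 * (4 * q)"
  proof -
    have "(n * p)\<^sup>2 \<le> (r * c * (2 * w * k))\<^sup>2" using rc1 n p_pos by (intro power_mono) auto
    also have "\<dots> = (r * c)\<^sup>2 * (4 * (p * q)) * k\<^sup>2" by (simp add: power_mult_distrib w)
    also have "\<dots> \<le> (r * c)\<^sup>2 * (4 * (p * q)) * 1" using k1 k2 pq_pos by (intro mult_left_mono) auto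
    finally have "p * (n\<^sup>2 * p) \<le> p * ((r * c)\<^sup>2 * (4 * q))" by (simp add: power2_eq_square mult_ac)
    then show ?thesis using p_pos by simp
  qed
  have rcc: "n ^ 3 * p\<^sup>2 \<le> r * c\<^sup>2 * (4 * w)"
  proof -
    have "n ^ 3 * p\<^sup>2 = r * (n * w * k\<^sup>2) * (n ^ 3 * p\<^sup>2)" using rw by simp
    also have "\<dots> = r * (n\<^sup>2 * p * k / 2)\<^sup>2 * (4 * w)" by (simp add: power2_eq_square power3_eq_cube)
    also have "\<dots> \<le> r * c\<^sup>2 * (4 * w)" using c_ge r0 w k0 n p_pos by (intro mult_right_mono mult_left_mono power_mono) auto
    finally show ?thesis .
  qed
  have np1: "n\<^sup>2 * p \<ge> 1" using np by simp
  note ar = rate_arithmetic[OF n1 N p_pos p_less refl w w_half r0 c0 s_def np1 rc2 rcc rc]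
  have Np: "N * p \<ge> 1"
  proof -
    have "n\<^sup>2 / 4 * p \<le> N * p" using N p_pos by (intro mult_right_mono) auto
    then show ?thesis using np by simp
  qed
  have s0: "s > 0"
  proof -
    have "0 < n\<^sup>2 / 4" using n by simp
    then have "N > 0" using N by linarith
    then show ?thesis using c0 pq_pos by (simp add: s_def)
  qed
  define H where "H E = radial_part E - Ex radial_part - linear_coeff * cdev E" for E
  define T where "T E = main_part E - radial_part E" for E
  have n4: "n \<ge> 4" "n \<ge> 10" using n by auto
  have ExT: "Ex T = 0" using Ex_cycle_count_mult[OF n4(1), of "\<lambda>_. 1"] unfolding T_def[abs_def] by simp
  then have ExA: "Ex main_part = Ex radial_part" unfolding T_def[abs_def] bexp_diff by simp
  have "\<bar>Ex (\<lambda>E. of_bool ((K E - Ex K) / sqrt (Ex (\<lambda>E. (K E - Ex K)\<^sup>2)) \<le> z)) - gauss_cdf z\<bar> \<le> 120 * (10 ^ 7 * r)"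
  proof (rule berry_esseen_decomposition[where A = main_part and B = local_part and H = H and V = T and ?c0.0 = linear_coeff and s = s])
    show "K E = main_part E + local_part E" if "E \<subseteq> I" for E by (rule K[OF that])
    show "main_part E - Ex main_part = linear_coeff * cdev E + H E + T E" for E
      by (simp add: H_def T_def ExA)
    show "s = \<bar>linear_coeff\<bar> * sqrt (N * (p * q))" by (simp add: s_def c_def)
    show "0 < s" by (rule s0)
    show "0 \<le> 10 ^ 7 * r" using r0 by simp
    show "Ex (\<lambda>E. T E * \<phi> (card E)) = 0" for \<phi> unfolding T_def by (rule Ex_cycle_count_mult[OF n4(1)])
    show "Ex (\<lambda>E. (H E)\<^sup>2) \<le> (10 ^ 7 * r * s)\<^sup>2"
      unfolding H_def by (rule order_trans[OF Ex_radial_sq_le[OF n4(2)] ar(1)])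
    show "Ex (\<lambda>E. (T E)\<^sup>2) \<le> 10 ^ 7 * r * s\<^sup>2"
      unfolding T_def by (rule order_trans[OF Ex_transversal_sq_le[OF n4(2)] ar(2)])
    show "Ex (\<lambda>E. (local_part E - Ex local_part)\<^sup>2) \<le> (10 ^ 7 * r * s)\<^sup>2"
    proof -
      have "Ex (\<lambda>E. (local_part E - Ex local_part)\<^sup>2) = Ex (\<lambda>E. (local_part E)\<^sup>2 - 2 * Ex local_part * local_part E + (Ex local_part)\<^sup>2)"
        by (rule bexp_cong) (simp add: power2_eq_square algebra_simps)
      also have "\<dots> = Ex (\<lambda>E. (local_part E)\<^sup>2) - (Ex local_part)\<^sup>2"
        unfolding bexp_add bexp_diff bexp_cmult by (simp add: power2_eq_square)
      also have "\<dots> \<le> p * q * (\<Sum>e\<in>I. Ex (\<lambda>E. (ddiff e local_part E)\<^sup>2))" by (rule Ex_poincare)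
      also have "\<dots> \<le> p * q * (\<Sum>e\<in>I. 36 * (2 * n * p + (2 * n * p)\<^sup>2))"
        using pq_pos by (intro mult_left_mono sum_mono Ex_ddiff_local_part_sq) auto
      also have "\<dots> = p * q * (N * (36 * (2 * n * p + (2 * n * p)\<^sup>2)))" by simp
      finally show ?thesis using ar(3) by linarith
    qed
    show "\<bar>linear_coeff\<bar> * (p * q) * (\<Sum>e\<in>I. Ex (\<lambda>E. \<bar>ddiff e local_part E\<bar>)) \<le> 10 ^ 7 * r * s\<^sup>2"
    proof -
      have "(\<Sum>e\<in>I. Ex (\<lambda>E. \<bar>ddiff e local_part E\<bar>)) \<le> (\<Sum>e\<in>I. 12 * n * p)" by (intro sum_mono Ex_abs_ddiff_local_part)
      also have "\<dots> = N * (12 * n * p)" by simp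
      finally have "c * (p * q) * (\<Sum>e\<in>I. Ex (\<lambda>E. \<bar>ddiff e local_part E\<bar>)) \<le> c * (p * q) * (N * (12 * n * p))"
        using c0 pq_pos by (intro mult_left_mono) auto
      then show ?thesis using ar(4) unfolding c_def by linarith
    qed
    show "\<bar>linear_coeff\<bar> * (p * q) * sqrt (Ex (\<lambda>E. ((\<Sum>e\<in>I. ddiff e main_part E) - Ex (\<lambda>E. \<Sum>e\<in>I. ddiff e main_part E))\<^sup>2)) \<le> 10 ^ 7 * r * s\<^sup>2"
    proof -
      define S where "S E = (\<Sum>e\<in>I. ddiff e main_part E)" for E
      have "Ex (\<lambda>E. (S E - Ex S)\<^sup>2) = Ex (\<lambda>E. (S E)\<^sup>2 - 2 * Ex S * S E + (Ex S)\<^sup>2)"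
        by (rule bexp_cong) (simp add: power2_eq_square algebra_simps)
      also have "\<dots> = Ex (\<lambda>E. (S E)\<^sup>2) - (Ex S)\<^sup>2"
        unfolding bexp_add bexp_diff bexp_cmult by (simp add: power2_eq_square)
      also have "\<dots> \<le> p * q * (\<Sum>e\<in>I. Ex (\<lambda>E. (ddiff e S E)\<^sup>2))" by (rule Ex_poincare)
      also have "\<dots> \<le> p * q * (\<Sum>e\<in>I. (18 * n\<^sup>2)\<^sup>2)"
        using pq_pos unfolding S_def[abs_def]
        by (intro mult_left_mono sum_mono Ex_sq_bound ddiff_sum_ddiff_main_part finE) auto
      also have "\<dots> = p * q * (N * (18 * n\<^sup>2)\<^sup>2)" by simp
      finally have "c * (p * q) * sqrt (Ex (\<lambda>E. (S E - Ex S)\<^sup>2)) \<le> c * (p * q) * sqrt (p * q * (N * (18 * n\<^sup>2)\<^sup>2))"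
        using c0 pq_pos by (intro mult_left_mono real_sqrt_le_mono) auto
      then show ?thesis using ar(5) unfolding c_def S_def[abs_def] by linarith
    qed
    show "\<bar>linear_coeff\<bar> * (p * q) * (\<Sum>e\<in>I. sqrt (Ex (\<lambda>E. (ddiff e K E) ^ 4))) \<le> 10 ^ 7 * r * s ^ 3"
    proof -
      have each: "sqrt (Ex (\<lambda>E. (ddiff e K E) ^ 4)) \<le> 4860 * (N * p)\<^sup>2" if e: "e \<in> I" for e
      proof -
        have "Ex (\<lambda>E. (ddiff e K E) ^ 4) \<le> Ex (\<lambda>E. 18 ^ 4 * real (card E) ^ 4)"
        proof (rule Ex_mono)
          fix E assume E: "E \<subseteq> I"
          have "insert e E \<subseteq> I" "E - {e} \<subseteq> I" using E e by auto
          then have "ddiff e K E = ddiff e main_part E + ddiff e local_part E" by (simp add: K ddiff_def)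
          then have "\<bar>ddiff e K E\<bar> \<le> 18 * real (card E)"
            using ddiff_main_part_le[OF e E] ddiff_local_part_le[OF e E] card_inter_incident_le[OF E, of e] by linarith
          then have "\<bar>ddiff e K E\<bar> ^ 4 \<le> (18 * real (card E)) ^ 4" by (intro power_mono) auto
          then show "(ddiff e K E) ^ 4 \<le> 18 ^ 4 * real (card E) ^ 4" by (simp add: power_mult_distrib)
        qed
        also have "\<dots> \<le> 18 ^ 4 * (24 * exp 2 * (N * p) ^ 4)"
          unfolding bexp_cmult using Ex_card_pow4[OF Np] by (intro mult_left_mono) auto
        \<comment> \<open>24 * exp 2 is at most 24 * 9 = 216; 225 is the next square, so the root is
          18^2 * 15 = 4860.\<close>
        also have "\<dots> \<le> 18 ^ 4 * (225 * (N * p) ^ 4)"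
        proof -
          have "exp (2::real) = exp 1 * exp 1" by (simp add: exp_add[symmetric])
          also have "\<dots> \<le> 3 * 3" by (intro mult_mono exp_le) auto
          finally have "24 * exp (2::real) \<le> 225" by simp
          then show ?thesis by (intro mult_left_mono mult_right_mono) auto
        qed
        also have "\<dots> = (4860 * (N * p)\<^sup>2)\<^sup>2" by (simp add: power_mult_distrib power_mult[symmetric])
        finally show ?thesis by (rule real_le_lsqrt[rotated 1]) simp
      qed
      have "(\<Sum>e\<in>I. sqrt (Ex (\<lambda>E. (ddiff e K E) ^ 4))) \<le> (\<Sum>e\<in>I. 4860 * (N * p)\<^sup>2)" by (intro sum_mono each)
      also have "\<dots> = N * (4860 * (N * p)\<^sup>2)" by simp
      finally have "c * (p * q) * (\<Sum>e\<in>I. sqrt (Ex (\<lambda>E. (ddiff e K E) ^ 4))) \<le> c * (p * q) * (N * (4860 * (N * p)\<^sup>2))"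
        using c0 pq_pos by (intro mult_left_mono) auto
      then show ?thesis using ar(6) unfolding c_def by linarith
    qed
    show "\<bar>linear_coeff\<bar> * sqrt (Ex (\<lambda>E. (\<Sum>e\<in>I. dev e E * ddiff e main_part E)\<^sup>2)) \<le> 10 ^ 7 * r * s\<^sup>2"
    proof -
      have "c * sqrt (Ex (\<lambda>E. (\<Sum>e\<in>I. dev e E * ddiff e main_part E)\<^sup>2)) \<le>
        c * sqrt (p * q * (N * (288 * (N * p)\<^sup>2)) + (p * q)\<^sup>2 * (40960 * n ^ 5 * p\<^sup>2 + N * (N * 32)))"
        using c0 by (intro mult_left_mono real_sqrt_le_mono Ex_main_divergence_le[OF n1 Np]) auto
      then show ?thesis using ar(7) unfolding c_def by linarith
    qed
  qed
  then show ?thesis using r0 by simp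
qed

end

section \<open>Edges of the symmetric edge polytope\<close>

lemma lookup_scaleR: "Poly_Mapping.lookup (c *\<^sub>R x) i = c * Poly_Mapping.lookup x i"
proof -
  have "finite {i. c *\<^sub>R Poly_Mapping.lookup x i \<noteq> 0}"
    by (rule finite_subset[OF _ finite_lookup[of x]]) auto
  then show ?thesis by (simp add: scaleR_poly_mapping_def Abs_poly_mapping_inverse)
qed

lemma linear_linear_form: "linear (linear_form V a)"
  by (rule linearI)
     (simp_all add: linear_form_def lookup_add lookup_scaleR sum.distrib sum_distrib_left algebra_simps)

fun arc_vec :: "'v \<times> 'v \<Rightarrow> 'v \<Rightarrow>\<^sub>0 real" where
  "arc_vec (i, j) = basis_vec i - basis_vec j"

fun slope :: "('v \<Rightarrow> real) \<Rightarrow> 'v \<times> 'v \<Rightarrow> real" where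
  "slope a (i, j) = a i - a j"

lemma lookup_arc_vec:
  "Poly_Mapping.lookup (arc_vec (i, j)) k = (if k = i then 1 else 0) - (if k = j then 1 else 0)"
  by (auto simp: basis_vec_def lookup_minus lookup_single when_def)

definition dir_arcs :: "'v set set \<Rightarrow> ('v \<times> 'v) set" where
  "dir_arcs E = {(i, j). {i, j} \<in> E}"

text \<open>Ordered pairs, so each edge of the polytope occurs twice. The common slope 1 is a
  normalisation: a supporting form of a proper face takes a positive value there, because the
  generators come in opposite pairs.\<close>

definition spanning_pairs :: "'v set set \<Rightarrow> (('v \<times> 'v) \<times> ('v \<times> 'v)) set" where
  "spanning_pairs E = {(d, d'). d \<in> dir_arcs E \<and> d' \<in> dir_arcs E \<and> d \<noteq> d' \<and>
     (\<exists>a. slope a d = 1 \<and> slope a d' = 1 \<and> (\<forall>x\<in>dir_arcs E - {d, d'}. slope a x < 1))}"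

lemma sym_edge_polytope_eq: "sym_edge_polytope E = convex hull (arc_vec ` dir_arcs E)"
proof -
  have "(\<Union>(i, j)\<in>{(i, j). {i, j} \<in> E}. {basis_vec i - basis_vec j, - (basis_vec i - basis_vec j)}) = arc_vec ` dir_arcs E"
  proof (intro equalityI subsetI)
    fix x :: "'a \<Rightarrow>\<^sub>0 real"
    assume "x \<in> (\<Union>(i, j)\<in>{(i, j). {i, j} \<in> E}. {basis_vec i - basis_vec j, - (basis_vec i - basis_vec j)})"
    then obtain i j where ij: "{i, j} \<in> E" "x = basis_vec i - basis_vec j \<or> x = basis_vec j - basis_vec i" by auto
    then have "(i, j) \<in> dir_arcs E" "(j, i) \<in> dir_arcs E" by (auto simp: dir_arcs_def insert_commute)
    moreover have "x = arc_vec (i, j) \<or> x = arc_vec (j, i)" using ij by simp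
    ultimately show "x \<in> arc_vec ` dir_arcs E" by blast
  next
    fix x assume "x \<in> arc_vec ` dir_arcs E"
    then show "x \<in> (\<Union>(i, j)\<in>{(i, j). {i, j} \<in> E}. {basis_vec i - basis_vec j, - (basis_vec i - basis_vec j)})"
      unfolding dir_arcs_def by force
  qed
  then show ?thesis by (simp add: sym_edge_polytope_def)
qed

locale edge_polytope =
  fixes V :: "'v set" and E :: "'v set set"
  assumes finV: "finite V" and E: "E \<subseteq> nsets V 2"
begin

abbreviation gens :: "('v \<Rightarrow>\<^sub>0 real) set" where "gens \<equiv> arc_vec ` dir_arcs E"
abbreviation P :: "('v \<Rightarrow>\<^sub>0 real) set" where "P \<equiv> sym_edge_polytope E"

lemma dir_arcsD: "(i, j) \<in> dir_arcs E \<Longrightarrow> i \<in> V \<and> j \<in> V \<and> i \<noteq> j"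
proof -
  assume "(i, j) \<in> dir_arcs E"
  then have "{i, j} \<in> nsets V 2" using E unfolding dir_arcs_def by blast
  then show ?thesis by (subst (asm) doubleton_in_nsets_2)
qed

lemma dir_arcs_rev: "(i, j) \<in> dir_arcs E \<Longrightarrow> (j, i) \<in> dir_arcs E"
  by (simp add: dir_arcs_def insert_commute)

lemma finite_dir: "finite (dir_arcs E)"
  unfolding dir_arcs_def by (rule finite_dir_arcs[OF finV E])

lemma linear_form_arc_vec: "d \<in> dir_arcs E \<Longrightarrow> linear_form V a (arc_vec d) = slope a d"
proof (cases d)
  case (Pair i j)
  assume "d \<in> dir_arcs E"
  then have "i \<in> V" "j \<in> V" using dir_arcsD Pair by auto
  then show ?thesis unfolding Pair linear_form_def lookup_arc_vec
    using finV by (simp add: right_diff_distrib sum_subtractf if_distrib[of "(*) _"] cong: if_cong)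
qed

lemma inj_on_arc_vec: "inj_on arc_vec (dir_arcs E)"
proof (rule inj_onI)
  fix d d' assume d: "d \<in> dir_arcs E" "d' \<in> dir_arcs E" "arc_vec d = arc_vec d'"
  obtain i j where ij: "d = (i, j)" by (cases d)
  obtain k l where kl: "d' = (k, l)" by (cases d')
  have ne: "i \<noteq> j" "k \<noteq> l" using d dir_arcsD ij kl by auto
  have eq: "Poly_Mapping.lookup (arc_vec (i, j)) x = Poly_Mapping.lookup (arc_vec (k, l)) x" for x
    using d(3) ij kl by simp
  have "i = k" using eq[of i] ne unfolding lookup_arc_vec by (auto split: if_splits)
  moreover have "j = l" using eq[of j] ne unfolding lookup_arc_vec by (auto split: if_splits)
  ultimately show "d = d'" by (simp add: ij kl)
qed

lemma arc_vec_coord_space: "d \<in> dir_arcs E \<Longrightarrow> arc_vec d \<in> coord_space V"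
proof (cases d)
  case (Pair i j)
  assume "d \<in> dir_arcs E"
  then have "i \<in> V" "j \<in> V" using dir_arcsD Pair by auto
  then show ?thesis unfolding Pair coord_space_def
    by (auto simp: in_keys_iff lookup_arc_vec simp del: arc_vec.simps split: if_splits)
qed

lemma convex_coord_space: "convex (coord_space V)"
  unfolding convex_def coord_space_def
  by (auto simp: in_keys_iff lookup_add lookup_scaleR subset_iff) (metis add.right_neutral mult_zero_right)

lemma P_subset: "P \<subseteq> coord_space V"
  unfolding sym_edge_polytope_eq
  by (rule hull_minimal) (use convex_coord_space arc_vec_coord_space in auto)

lemma sum_sq_arc_vec: "d \<in> dir_arcs E \<Longrightarrow> (\<Sum>i\<in>V. (Poly_Mapping.lookup (arc_vec d) i)\<^sup>2) = 2"
proof (cases d)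
  case (Pair i j)
  assume "d \<in> dir_arcs E"
  then have ij: "i \<in> V" "j \<in> V" "i \<noteq> j" using dir_arcsD Pair by auto
  have "(\<Sum>k\<in>V. (Poly_Mapping.lookup (arc_vec d) k)\<^sup>2) = (\<Sum>k\<in>V. (if k = i then 1 else 0) + (if k = j then 1 else 0))"
    unfolding Pair lookup_arc_vec using ij by (intro sum.cong) auto
  then show ?thesis using ij finV by (simp add: sum.distrib)
qed

text \<open>All generators lie on a common sphere, so no three of them are collinear.\<close>

lemma gens_line:
  assumes "u \<in> gens" "v \<in> gens" "w \<in> gens" "v \<noteq> w" "u = v + t *\<^sub>R (w - v)"
  shows "u = v \<or> u = w"
proof -
  let ?l = Poly_Mapping.lookup
  define d where "d i = ?l w i - ?l v i" for i
  have q: "(\<Sum>i\<in>V. (?l u i)\<^sup>2) = 2" "(\<Sum>i\<in>V. (?l v i)\<^sup>2) = 2" "(\<Sum>i\<in>V. (?l w i)\<^sup>2) = 2"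
    using assms sum_sq_arc_vec by auto
  have lu: "?l u i = ?l v i + t * d i" for i
    unfolding assms(5) d_def by (simp add: lookup_add lookup_scaleR lookup_minus)
  have lw: "?l w i = ?l v i + d i" for i by (simp add: d_def)
  define m where "m = (\<Sum>i\<in>V. ?l v i * d i)"
  define D where "D = (\<Sum>i\<in>V. (d i)\<^sup>2)"
  have eu: "2 = 2 + 2 * t * m + t\<^sup>2 * D"
  proof -
    have "(\<Sum>i\<in>V. (?l u i)\<^sup>2) = (\<Sum>i\<in>V. (?l v i)\<^sup>2 + 2 * t * (?l v i * d i) + t\<^sup>2 * (d i)\<^sup>2)"
      unfolding lu by (intro sum.cong refl) (simp add: power2_eq_square algebra_simps)
    then show ?thesis unfolding sum.distrib sum_distrib_left[symmetric] q m_def D_def .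
  qed
  have ew: "2 = 2 + 2 * m + D"
  proof -
    have "(\<Sum>i\<in>V. (?l w i)\<^sup>2) = (\<Sum>i\<in>V. (?l v i)\<^sup>2 + 2 * (?l v i * d i) + (d i)\<^sup>2)"
      unfolding lw by (intro sum.cong refl) (simp add: power2_eq_square algebra_simps)
    then show ?thesis unfolding sum.distrib sum_distrib_left[symmetric] q m_def D_def .
  qed
  have "D \<noteq> 0"
  proof
    assume "D = 0"
    then have z: "d i = 0" if "i \<in> V" for i using that finV unfolding D_def by (simp add: sum_nonneg_eq_0_iff)
    have "?l w i = ?l v i" for i
    proof (cases "i \<in> V")
      case True then show ?thesis using z by (simp add: d_def)
    next
      case False
      moreover have "Poly_Mapping.keys v \<subseteq> V" "Poly_Mapping.keys w \<subseteq> V"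
        using assms arc_vec_coord_space by (auto simp: coord_space_def)
      ultimately show ?thesis by (metis in_keys_iff subsetD)
    qed
    then have "w = v" by (simp add: poly_mapping_eq_iff fun_eq_iff)
    then show False using assms(4) by simp
  qed
  \<comment> \<open>All three points lie on one sphere; eliminating \<open>m\<close> from the two
    norm equations leaves a quadratic in \<open>t\<close> with roots 0 and 1.\<close>
  moreover have "t * (t - 1) * D = 0"
  proof -
    have "2 * t * m = t * (2 * m)" by simp
    also have "2 * m = - D" using ew by simp
    finally show ?thesis using eu by (simp add: power2_eq_square algebra_simps)
  qed
  ultimately have "t = 0 \<or> t = 1" by simp
  then show ?thesis using assms(5) by auto
qed

lemma hull_pair_gens:
  assumes "u \<in> gens" "v \<in> gens" "w \<in> gens" "u \<in> convex hull {v, w}"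
  shows "u = v \<or> u = w"
proof (cases "v = w")
  case True then show ?thesis using assms(4) by simp
next
  case False
  then show ?thesis using gens_line[OF assms(1-3)] assms(4) unfolding convex_hull_2_alt by blast
qed

text \<open>A convex combination attains the maximum only if every generator of positive weight
  does.\<close>

lemma face_eq_hull:
  assumes "\<And>v. v \<in> gens \<Longrightarrow> linear_form V a v \<le> b"
  shows "{x \<in> P. linear_form V a x = b} = convex hull {v \<in> gens. linear_form V a v = b}"
proof (intro equalityI subsetI)
  have fin: "finite gens" using finite_dir by simp
  fix x assume "x \<in> {x \<in> P. linear_form V a x = b}"
  then have x: "x \<in> convex hull gens" "linear_form V a x = b" by (auto simp: sym_edge_polytope_eq)
  obtain u where u: "\<And>v. v \<in> gens \<Longrightarrow> 0 \<le> u v" "sum u gens = 1" "(\<Sum>v\<in>gens. u v *\<^sub>R v) = x"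
    using x(1) unfolding convex_hull_finite[OF fin] by blast
  have "b = (\<Sum>v\<in>gens. u v * linear_form V a v)"
    using x(2) u(3) linear_sum[OF linear_linear_form[of V a], of "\<lambda>v. u v *\<^sub>R v" gens]
    by (simp add: linear_scale[OF linear_linear_form])
  then have "(\<Sum>v\<in>gens. u v * (b - linear_form V a v)) = 0"
    using u(2) by (simp add: right_diff_distrib sum_subtractf sum_distrib_right[symmetric])
  then have z: "u v * (b - linear_form V a v) = 0" if "v \<in> gens" for v
    using that fin u(1) assms by (subst (asm) sum_nonneg_eq_0_iff) auto
  let ?S = "{v \<in> gens. linear_form V a v = b}"
  have "sum u ?S = sum u gens" "(\<Sum>v\<in>?S. u v *\<^sub>R v) = (\<Sum>v\<in>gens. u v *\<^sub>R v)"
    using z by (intro sum.mono_neutral_left fin; force)+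
  then show "x \<in> convex hull ?S"
    unfolding convex_hull_finite[OF finite_subset[OF _ fin], of ?S, simplified] using u by (intro CollectI exI[of _ u]) auto
next
  fix x assume x: "x \<in> convex hull {v \<in> gens. linear_form V a v = b}"
  have "convex {x. linear_form V a x = b}"
    unfolding convex_def
    by (auto simp: linear_add[OF linear_linear_form] linear_scale[OF linear_linear_form] distrib_right[symmetric])
  then have "convex hull {v \<in> gens. linear_form V a v = b} \<subseteq> {x. linear_form V a x = b}"
    by (intro hull_minimal) auto
  moreover have "convex hull {v \<in> gens. linear_form V a v = b} \<subseteq> P"
    unfolding sym_edge_polytope_eq by (rule hull_mono) auto
  ultimately show "x \<in> {x \<in> P. linear_form V a x = b}" using x by auto
qed

lemma affine_line_points:
  fixes x y u v w :: "'a::real_vector"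
  assumes "u \<in> affine hull {x, y}" "v \<in> affine hull {x, y}" "w \<in> affine hull {x, y}" "v \<noteq> w"
  shows "\<exists>t. u = v + t *\<^sub>R (w - v)"
proof -
  have *: "\<exists>s. z = x + s *\<^sub>R (y - x)" if z: "z \<in> affine hull {x, y}" for z
  proof -
    obtain a b where ab: "z = a *\<^sub>R x + b *\<^sub>R y" "a + b = 1" using z unfolding affine_hull_2 by blast
    then have a: "a = 1 - b" by simp
    have "z = x + b *\<^sub>R (y - x)" unfolding ab(1) a by (simp add: algebra_simps)
    then show ?thesis by blast
  qed
  obtain r s t where rst: "u = x + r *\<^sub>R (y - x)" "v = x + s *\<^sub>R (y - x)" "w = x + t *\<^sub>R (y - x)"
    using *[OF assms(1)] *[OF assms(2)] *[OF assms(3)] by auto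
  then have "t \<noteq> s" using assms(4) by auto
  have "w - v = (t - s) *\<^sub>R (y - x)" unfolding rst by (simp add: algebra_simps)
  then have "((r - s) / (t - s)) *\<^sub>R (w - v) = (r - s) *\<^sub>R (y - x)" using \<open>t \<noteq> s\<close> by simp
  then have "u = v + ((r - s) / (t - s)) *\<^sub>R (w - v)" unfolding rst by (simp add: algebra_simps)
  then show ?thesis by blast
qed

lemma linear_form_minus: "linear_form V a (- x) = - linear_form V a x"
  by (rule linear_neg[OF linear_linear_form])

lemma gens_uminus: "v \<in> gens \<Longrightarrow> - v \<in> gens"
proof -
  assume "v \<in> gens"
  then obtain i j where "v = arc_vec (i, j)" "(i, j) \<in> dir_arcs E" by auto
  then have "- v = arc_vec (j, i)" "(j, i) \<in> dir_arcs E" using dir_arcs_rev by auto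
  then show ?thesis by blast
qed

text \<open>A face is the hull of the generators on it. If it is one-dimensional, these are
  collinear and hence exactly two. Conversely, the potential is itself the form that cuts out the
  segment.\<close>

lemma polytope_edges_eq: "polytope_edges V P = (\<lambda>(d, d'). convex hull {arc_vec d, arc_vec d'}) ` spanning_pairs E"
proof (intro equalityI subsetI)
  fix F assume "F \<in> polytope_edges V P"
  then have F: "F \<noteq> P" "has_aff_dim F 1" and "\<exists>H. supporting_hyperplane V P H \<and> F = P \<inter> H"
    by (auto simp: polytope_edges_def polytope_face_def)
  then obtain a b where ab: "\<And>x. x \<in> P \<Longrightarrow> linear_form V a x \<le> b"
    "P \<inter> {x \<in> coord_space V. linear_form V a x = b} \<noteq> {}" "F = P \<inter> {x \<in> coord_space V. linear_form V a x = b}"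
    unfolding supporting_hyperplane_def by blast
  have gP: "gens \<subseteq> P" unfolding sym_edge_polytope_eq by (rule hull_subset)
  then have le: "linear_form V a v \<le> b" if "v \<in> gens" for v using ab(1) that by auto
  define S where "S = {v \<in> gens. linear_form V a v = b}"
  have "F = {x \<in> P. linear_form V a x = b}" using ab(3) P_subset by auto
  then have FS: "F = convex hull S" unfolding S_def using face_eq_hull[OF le] by simp
  have finS: "finite S" unfolding S_def using finite_dir by simp
  obtain B where B: "finite B" "affine hull B = affine hull F" "\<not> affine_dependent B" "card B = 2"
    using F(2) unfolding has_aff_dim_def by auto
  then obtain x y where xy: "B = {x, y}" "x \<noteq> y" by (auto simp: card_2_iff)
  have aff: "affine hull S = affine hull {x, y}" using B xy FS by simp
  have "\<exists>v w. S = {v, w} \<and> v \<noteq> w"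
  proof -
    have xyS: "x \<in> affine hull S" "y \<in> affine hull S" unfolding aff by (auto intro: hull_inc)
    have "S \<noteq> {}" using xyS by auto
    then obtain v where v: "v \<in> S" by auto
    have "affine hull {v} = {v}" by (simp add: hull_same)
    then have "S \<noteq> {v}" using xyS xy(2) by (metis singletonD)
    then obtain w where w: "w \<in> S" "w \<noteq> v" using v by auto
    have "u = v \<or> u = w" if u: "u \<in> S" for u
    proof -
      have "u \<in> affine hull {x, y}" "v \<in> affine hull {x, y}" "w \<in> affine hull {x, y}"
        using u v w unfolding aff[symmetric] by (auto intro: hull_inc)
      then obtain t where "u = v + t *\<^sub>R (w - v)" using affine_line_points w(2) by metis
      then show ?thesis using gens_line[of u v w t] u v w unfolding S_def by auto
    qed
    then have "S = {v, w}" using v w by auto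
    then show ?thesis using w by auto
  qed
  then obtain v w where vw: "S = {v, w}" "v \<noteq> w" by auto
  \<comment> \<open>If \<open>b\<close> were not positive, a generator and its negative would both
    have value at most \<open>b\<close> only when both values equal \<open>b\<close>, so the face
    would be all of \<open>P\<close>.\<close>
  have bpos: "b > 0"
  proof (rule ccontr)
    assume "\<not> b > 0"
    then have b: "b \<le> 0" by simp
    have all: "linear_form V a u = b" if "u \<in> gens" for u
      using le[OF that] le[OF gens_uminus[OF that]] b unfolding linear_form_minus by linarith
    then have "S = gens" unfolding S_def by auto
    then show False using F(1) FS by (simp add: sym_edge_polytope_eq)
  qed
  obtain d d' where d: "v = arc_vec d" "w = arc_vec d'" "d \<in> dir_arcs E" "d' \<in> dir_arcs E"
    using vw unfolding S_def by blast
  define a' where "a' i = a i / b" for i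
  have slope': "slope a' x = linear_form V a (arc_vec x) / b" if "x \<in> dir_arcs E" for x
    unfolding linear_form_arc_vec[OF that] by (cases x) (simp add: a'_def diff_divide_distrib)
  have "(d, d') \<in> spanning_pairs E"
  proof -
    have vb: "linear_form V a v = b" "linear_form V a w = b" using vw(1) unfolding S_def by auto
    have "slope a' d = 1" "slope a' d' = 1" using slope'[OF d(3)] slope'[OF d(4)] vb d bpos by auto
    moreover have "slope a' x < 1" if x: "x \<in> dir_arcs E - {d, d'}" for x
    proof -
      have "arc_vec x \<notin> {v, w}" using x d inj_on_arc_vec by (auto dest: inj_onD)
      then have "linear_form V a (arc_vec x) \<noteq> b" using x unfolding vw(1)[symmetric] S_def by auto
      then have "linear_form V a (arc_vec x) < b" using le[of "arc_vec x"] x by fastforce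
      then show ?thesis using slope'[of x] x bpos by simp
    qed
    ultimately have "\<exists>a. slope a d = 1 \<and> slope a d' = 1 \<and> (\<forall>x\<in>dir_arcs E - {d, d'}. slope a x < 1)" by blast
    moreover have "d \<noteq> d'" using vw(2) d by auto
    ultimately show ?thesis unfolding spanning_pairs_def using d(3,4) by blast
  qed
  then show "F \<in> (\<lambda>(d, d'). convex hull {arc_vec d, arc_vec d'}) ` spanning_pairs E"
    unfolding FS vw(1) d(1,2) by force
next
  fix F assume "F \<in> (\<lambda>(d, d'). convex hull {arc_vec d, arc_vec d'}) ` spanning_pairs E"
  then obtain y where y: "y \<in> spanning_pairs E" "F = (\<lambda>(d, d'). convex hull {arc_vec d, arc_vec d'}) y" by blast
  obtain d d' where dd': "y = (d, d')" by (cases y)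
  have "F = convex hull {arc_vec d, arc_vec d'}" using y(2) dd' by simp
  moreover obtain a where "d \<in> dir_arcs E" "d' \<in> dir_arcs E" "d \<noteq> d'"
    and a: "slope a d = 1" "slope a d' = 1" "\<And>x. x \<in> dir_arcs E - {d, d'} \<Longrightarrow> slope a x < 1"
    using y(1) unfolding dd' spanning_pairs_def by blast
  ultimately have d: "F = convex hull {arc_vec d, arc_vec d'}" "d \<in> dir_arcs E" "d' \<in> dir_arcs E" "d \<noteq> d'" by simp_all
  have le: "linear_form V a v \<le> 1" if v: "v \<in> gens" for v
  proof -
    obtain x where x: "v = arc_vec x" "x \<in> dir_arcs E" using v by blast
    have "slope a x \<le> 1"
    proof (cases "x = d \<or> x = d'")
      case True then show ?thesis using a by auto
    next
      case False then show ?thesis using a(3)[of x] x(2) by simp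
    qed
    then show ?thesis unfolding x(1) linear_form_arc_vec[OF x(2)] .
  qed
  have "{v \<in> gens. linear_form V a v = 1} = {arc_vec d, arc_vec d'}"
  proof (intro equalityI subsetI)
    fix v assume v: "v \<in> {v \<in> gens. linear_form V a v = 1}"
    then obtain x where x: "v = arc_vec x" "x \<in> dir_arcs E" by blast
    have "slope a x = 1" using v linear_form_arc_vec[OF x(2)] x(1) by simp
    then have "x = d \<or> x = d'" using a(3)[of x] x(2) by (cases "x = d \<or> x = d'") simp_all
    then show "v \<in> {arc_vec d, arc_vec d'}" using x(1) by blast
  next
    fix v assume "v \<in> {arc_vec d, arc_vec d'}"
    then show "v \<in> {v \<in> gens. linear_form V a v = 1}"
      using a(1,2) d(2,3) linear_form_arc_vec by (elim insertE emptyE) simp_all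
  qed
  then have Feq: "F = {x \<in> P. linear_form V a x = 1}" unfolding d(1) using face_eq_hull[OF le] by simp
  have leP: "linear_form V a x \<le> 1" if "x \<in> P" for x
  proof -
    have "convex {x. linear_form V a x \<le> 1}"
      unfolding convex_def
    proof (clarify, simp add: linear_add[OF linear_linear_form] linear_scale[OF linear_linear_form])
      fix x y u v assume h: "linear_form V a x \<le> 1" "linear_form V a y \<le> 1" "0 \<le> u" "0 \<le> v" "u + v = (1::real)"
      have "u * linear_form V a x + v * linear_form V a y \<le> u * 1 + v * 1"
        using h by (intro add_mono mult_left_mono) auto
      then show "u * linear_form V a x + v * linear_form V a y \<le> 1" using h by simp
    qed
    then have "P \<subseteq> {x. linear_form V a x \<le> 1}" unfolding sym_edge_polytope_eq
      using le by (intro hull_minimal) auto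
    then show ?thesis using that by auto
  qed
  have dP: "arc_vec d \<in> P" unfolding sym_edge_polytope_eq using d(2) by (intro hull_inc) auto
  define H where "H = {x \<in> coord_space V. linear_form V a x = 1}"
  have FPH: "F = P \<inter> H" unfolding Feq H_def using P_subset by auto
  obtain i j where ij: "d = (i, j)" by (cases d)
  have "supporting_hyperplane V P H"
    unfolding supporting_hyperplane_def
  proof (intro exI[of _ a] exI[of _ 1] conjI ballI)
    have "a i \<noteq> 0 \<or> a j \<noteq> 0" using a(1) ij by auto
    then show "\<exists>i\<in>V. a i \<noteq> 0" using dir_arcsD d(2) ij by blast
    show "P \<inter> H \<noteq> {}" unfolding FPH[symmetric] d(1) by simp
  qed (use leP in \<open>auto simp: H_def\<close>)
  moreover have "F \<noteq> P"
  proof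
    assume "F = P"
    moreover have "- arc_vec d \<in> P" unfolding sym_edge_polytope_eq
      using d(2) gens_uminus by (intro hull_inc) auto
    ultimately have "linear_form V a (- arc_vec d) = 1" unfolding Feq by blast
    then show False using a(1) linear_form_arc_vec[OF d(2)] by (simp add: linear_form_minus)
  qed
  moreover have "has_aff_dim F 1"
    unfolding has_aff_dim_def
  proof (intro exI[of _ "{arc_vec d, arc_vec d'}"] conjI)
    have "arc_vec d \<noteq> arc_vec d'" using d inj_on_arc_vec by (auto dest: inj_onD)
    then show "int (card {arc_vec d, arc_vec d'}) = 1 + 1" by simp
  qed (use d(1) in auto)
  ultimately show "F \<in> polytope_edges V P"
    unfolding polytope_edges_def polytope_face_def using FPH by auto
qed

lemma spanning_pairs_sym: "(d, d') \<in> spanning_pairs E \<longleftrightarrow> (d', d) \<in> spanning_pairs E"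
  unfolding spanning_pairs_def by (auto simp: insert_commute)

text \<open>A segment contains no generators except its ends, so an edge determines its pair of
  directed arcs. The factor 2 comes from \<open>card_dir_arcs\<close>, reused with directed arcs in
  the role of nodes.\<close>

lemma card_polytope_edges: "2 * card (polytope_edges V P) = card (spanning_pairs E)"
proof -
  define EP where "EP = (\<lambda>(d, d'). {d, d'}) ` spanning_pairs E"
  have EP: "EP \<subseteq> nsets (dir_arcs E) 2" unfolding EP_def spanning_pairs_def
    by (auto simp: doubleton_in_nsets_2)
  have mem: "{d, d'} \<in> EP \<longleftrightarrow> (d, d') \<in> spanning_pairs E" for d d'
  proof
    assume "{d, d'} \<in> EP"
    then obtain x y where "(x, y) \<in> spanning_pairs E" "{d, d'} = {x, y}" unfolding EP_def by auto
    then show "(d, d') \<in> spanning_pairs E" using spanning_pairs_sym by (metis doubleton_eq_iff)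
  qed (force simp: EP_def)
  have "polytope_edges V P = (\<lambda>S. convex hull (arc_vec ` S)) ` EP"
    unfolding polytope_edges_eq EP_def image_image by (intro image_cong refl) auto
  moreover have "inj_on (\<lambda>S. convex hull (arc_vec ` S)) EP"
  proof (rule inj_onI)
    fix S T assume ST: "S \<in> EP" "T \<in> EP" "convex hull (arc_vec ` S) = convex hull (arc_vec ` T)"
    have sub: "S \<subseteq> T" if h: "S \<in> EP" "T \<in> EP" "convex hull (arc_vec ` S) = convex hull (arc_vec ` T)" for S T
    proof
      fix x assume x: "x \<in> S"
      have SD: "S \<subseteq> dir_arcs E" "T \<subseteq> dir_arcs E" using h EP by (auto simp: nsets_def)
      obtain d d' where T: "T = {d, d'}" using h(2) unfolding EP_def by auto
      have "arc_vec x \<in> convex hull {arc_vec d, arc_vec d'}"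
        using hull_inc[of "arc_vec x" "arc_vec ` S" convex] x h(3) unfolding T by simp
      then have "arc_vec x = arc_vec d \<or> arc_vec x = arc_vec d'"
        using x SD T by (intro hull_pair_gens) auto
      then show "x \<in> T" using inj_on_arc_vec x SD T by (auto dest: inj_onD)
    qed
    show "S = T" using sub[OF ST] sub[OF ST(2,1) ST(3)[symmetric]] by blast
  qed
  ultimately have "card (polytope_edges V P) = card EP" by (simp add: card_image)
  moreover have "card {(d, d'). {d, d'} \<in> EP} = 2 * card EP"
    by (rule card_dir_arcs[OF finite_dir EP])
  moreover have "{(d, d'). {d, d'} \<in> EP} = spanning_pairs E" using mem by auto
  ultimately show ?thesis by simp
qed

end

section \<open>Which pairs of directed arcs span an edge\<close>

context edge_polytope
begin

abbreviation D :: "('v \<times> 'v) set" where "D \<equiv> dir_arcs E"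

lemma spanning_pairsI:
  assumes "(i, j) \<in> D" "(k, l) \<in> D" "(i, j) \<noteq> (k, l)" "a i - a j = 1" "a k - a l = (1::real)"
    and "\<And>x y. (x, y) \<in> D \<Longrightarrow> (x, y) \<noteq> (i, j) \<Longrightarrow> (x, y) \<noteq> (k, l) \<Longrightarrow> a x - a y < 1"
  shows "((i, j), (k, l)) \<in> spanning_pairs E"
proof -
  have "slope a z < 1" if "z \<in> D - {(i, j), (k, l)}" for z
    using that assms(6) by (cases z) auto
  then have "\<exists>a. slope a (i, j) = 1 \<and> slope a (k, l) = 1 \<and> (\<forall>z\<in>D - {(i, j), (k, l)}. slope a z < 1)"
    using assms(4,5) by (intro exI[of _ a]) simp
  then show ?thesis using assms(1-3) unfolding spanning_pairs_def by blast
qed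

lemma spanning_pairsE:
  assumes "((i, j), (k, l)) \<in> spanning_pairs E"
  obtains a :: "'v \<Rightarrow> real" where "a i - a j = 1" "a k - a l = 1"
    "\<And>x y. (x, y) \<in> D \<Longrightarrow> (x, y) \<noteq> (i, j) \<Longrightarrow> (x, y) \<noteq> (k, l) \<Longrightarrow> a x - a y < 1"
    "(i, j) \<in> D" "(k, l) \<in> D" "(i, j) \<noteq> (k, l)"
proof -
  have h: "(i, j) \<in> D" "(k, l) \<in> D" "(i, j) \<noteq> (k, l)"
    and "\<exists>a. slope a (i, j) = 1 \<and> slope a (k, l) = 1 \<and> (\<forall>z\<in>D - {(i, j), (k, l)}. slope a z < 1)"
    using assms unfolding spanning_pairs_def by blast+
  then obtain a where a: "slope a (i, j) = 1" "slope a (k, l) = 1" "\<forall>z\<in>D - {(i, j), (k, l)}. slope a z < 1" by blast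
  have "a x - a y < 1" if "(x, y) \<in> D" "(x, y) \<noteq> (i, j)" "(x, y) \<noteq> (k, l)" for x y
    using bspec[OF a(3), of "(x, y)"] that by simp
  then show thesis using that[of a] a(1,2) h by simp
qed

lemma spanning_same_tail:
  assumes "(i, j) \<in> D" "(i, l) \<in> D" "j \<noteq> l"
  shows "((i, j), (i, l)) \<in> spanning_pairs E"
proof -
  \<comment> \<open>Values in [0, 1]: a slope of 1 is attained only from \<open>i\<close> to
    \<open>j\<close> or \<open>l\<close>.\<close>
  define a :: "'v \<Rightarrow> real" where "a m = (if m = i then 1 else if m = j \<or> m = l then 0 else 1 / 2)" for m
  have ne: "i \<noteq> j" "i \<noteq> l" using assms dir_arcsD by blast+
  show ?thesis
  proof (rule spanning_pairsI[where a = a])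
    fix x y assume "(x, y) \<in> D" "(x, y) \<noteq> (i, j)" "(x, y) \<noteq> (i, l)"
    moreover have "x \<noteq> y" using calculation dir_arcsD by blast
    ultimately show "a x - a y < 1" by (auto simp: a_def)
  qed (use assms ne in \<open>auto simp: a_def\<close>)
qed

lemma spanning_same_head:
  assumes "(i, j) \<in> D" "(k, j) \<in> D" "i \<noteq> k"
  shows "((i, j), (k, j)) \<in> spanning_pairs E"
proof -
  define a :: "'v \<Rightarrow> real" where "a m = (if m = j then - 1 else if m = i \<or> m = k then 0 else - 1 / 2)" for m
  have ne: "i \<noteq> j" "k \<noteq> j" using assms dir_arcsD by blast+
  show ?thesis
  proof (rule spanning_pairsI[where a = a])
    fix x y assume "(x, y) \<in> D" "(x, y) \<noteq> (i, j)" "(x, y) \<noteq> (k, j)"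
    moreover have "x \<noteq> y" using calculation dir_arcsD by blast
    ultimately show "a x - a y < 1" by (auto simp: a_def)
  qed (use assms ne in \<open>auto simp: a_def\<close>)
qed

text \<open>Along the path the potential drops by 2 from \<open>i\<close> to \<open>l\<close>. A
  direct arc would have slope 2, and a second path with two arcs would have an arc of slope at least
  1; these are the only obstructions.\<close>

lemma spanning_path_iff:
  assumes "(i, j) \<in> D" "(j, l) \<in> D" "i \<noteq> l"
  shows "((i, j), (j, l)) \<in> spanning_pairs E \<longleftrightarrow>
    (i, l) \<notin> D \<and> (\<forall>m. (i, m) \<in> D \<longrightarrow> (m, l) \<in> D \<longrightarrow> m = j)"
proof
  have ne: "i \<noteq> j" "j \<noteq> l" using assms dir_arcsD by blast+
  assume "((i, j), (j, l)) \<in> spanning_pairs E"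
  then obtain a :: "'v \<Rightarrow> real" where a: "a i - a j = 1" "a j - a l = 1"
    "\<And>x y. (x, y) \<in> D \<Longrightarrow> (x, y) \<noteq> (i, j) \<Longrightarrow> (x, y) \<noteq> (j, l) \<Longrightarrow> a x - a y < 1"
    by (rule spanning_pairsE) (rule that)
  have "(i, l) \<notin> D" using a(1,2) a(3)[of i l] ne by auto
  moreover have "m = j" if m: "(i, m) \<in> D" "(m, l) \<in> D" for m
  proof (rule ccontr)
    assume "m \<noteq> j"
    then have "a i - a m < 1" "a m - a l < 1" using a(3)[OF m(1)] a(3)[OF m(2)] ne by auto
    then show False using a(1,2) by simp
  qed
  ultimately show "(i, l) \<notin> D \<and> (\<forall>m. (i, m) \<in> D \<longrightarrow> (m, l) \<in> D \<longrightarrow> m = j)" by blast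
next
  have ne: "i \<noteq> j" "j \<noteq> l" using assms dir_arcsD by blast+
  assume h: "(i, l) \<notin> D \<and> (\<forall>m. (i, m) \<in> D \<longrightarrow> (m, l) \<in> D \<longrightarrow> m = j)"
  \<comment> \<open>Neighbours of \<open>i\<close> must lie strictly above 0 and neighbours of
    \<open>l\<close> strictly below 0; by assumption no node other than \<open>j\<close> is both.
    With 1/4 as offset the slopes among the remaining nodes stay at most 1/2.\<close>
  define a :: "'v \<Rightarrow> real" where "a m = (if m = i then 1 else if m = j then 0 else if m = l then - 1
    else if (i, m) \<in> D then 1 / 4 else if (m, l) \<in> D then - 1 / 4 else 0)" for m
  have ai: "a i = 1" "a j = 0" "a l = - 1" using ne assms(3) by (auto simp: a_def)
  have ao: "a m \<le> 1 / 4" "- 1 / 4 \<le> a m" if "m \<noteq> i" "m \<noteq> j" "m \<noteq> l" for m using that by (auto simp: a_def)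
  show "((i, j), (j, l)) \<in> spanning_pairs E"
  proof (rule spanning_pairsI[where a = a])
    fix x y assume xy: "(x, y) \<in> D" "(x, y) \<noteq> (i, j)" "(x, y) \<noteq> (j, l)"
    have "x \<noteq> y" using xy dir_arcsD by blast
    consider "x = i" | "x = j" | "x = l" | "x \<noteq> i" "x \<noteq> j" "x \<noteq> l" by blast
    then show "a x - a y < 1"
    proof cases
      case 1
      then have "y \<noteq> i" "y \<noteq> j" "y \<noteq> l" "(i, y) \<in> D" using xy h \<open>x \<noteq> y\<close> by auto
      then have "a y = 1 / 4" by (simp add: a_def)
      then show ?thesis using 1 ai by simp
    next
      case 2
      then have "y \<noteq> l" using xy by auto
      then have "- 1 / 4 \<le> a y" using ai ao(2)[of y] 2 \<open>x \<noteq> y\<close> by (cases "y = i") auto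
      then show ?thesis using 2 ai by simp
    next
      case 3
      then have "- 1 \<le> a y" using ai ao(2)[of y] \<open>x \<noteq> y\<close> by (cases "y = i \<or> y = j") auto
      then show ?thesis using 3 ai by simp
    next
      case 4
      show ?thesis
      proof (cases "y = l")
        case True
        then have "(i, x) \<notin> D" using h xy 4 by blast
        then have "a x = - 1 / 4" using 4 xy True by (simp add: a_def)
        then show ?thesis using True ai by simp
      next
        case False
        then have "- 1 / 4 \<le> a y" using ai ao(2)[of y] by (cases "y = i \<or> y = j") auto
        then show ?thesis using ao(1)[OF 4] by simp
      qed
    qed
  qed (use assms ne ai in auto)
qed

lemma spanning_disjoint:
  assumes "(i, j) \<in> D" "(k, l) \<in> D" "distinct [i, j, k, l]" "(k, j) \<notin> D"
  shows "((i, j), (k, l)) \<in> spanning_pairs E"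
proof -
  \<comment> \<open>Besides the two given arcs, the only slope reaching 1 is 3/2 from
    \<open>k\<close> to \<open>j\<close>, where there is no arc.\<close>
  define a :: "'v \<Rightarrow> real" where "a m = (if m = i then 1 else if m = j then 0 else if m = k then 3 / 2
    else if m = l then 1 / 2 else 3 / 4)" for m
  show ?thesis
  proof (rule spanning_pairsI[where a = a])
    fix x y assume "(x, y) \<in> D" "(x, y) \<noteq> (i, j)" "(x, y) \<noteq> (k, l)"
    moreover have "x \<noteq> y" using calculation dir_arcsD by blast
    moreover have "(x, y) \<noteq> (k, j)" using calculation(1) assms(4) by auto
    ultimately show "a x - a y < 1" by (auto simp: a_def)
  qed (use assms in \<open>auto simp: a_def\<close>)
qed

text \<open>Exchanging the heads preserves the total slope 2, so the arcs from \<open>k\<close> to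
  \<open>j\<close> and from \<open>i\<close> to \<open>l\<close> cannot both be present with slope
  below 1. If one of them is missing, \<open>spanning_disjoint\<close> applies, possibly with the
  two given arcs swapped.\<close>

lemma spanning_disjoint_iff:
  assumes "(i, j) \<in> D" "(k, l) \<in> D" "distinct [i, j, k, l]"
  shows "((i, j), (k, l)) \<in> spanning_pairs E \<longleftrightarrow> \<not> ((j, k) \<in> D \<and> (l, i) \<in> D)"
proof
  assume "((i, j), (k, l)) \<in> spanning_pairs E"
  then obtain a :: "'v \<Rightarrow> real" where a: "a i - a j = 1" "a k - a l = 1"
    "\<And>x y. (x, y) \<in> D \<Longrightarrow> (x, y) \<noteq> (i, j) \<Longrightarrow> (x, y) \<noteq> (k, l) \<Longrightarrow> a x - a y < 1"
    by (rule spanning_pairsE) (rule that)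
  show "\<not> ((j, k) \<in> D \<and> (l, i) \<in> D)"
  proof
    assume "(j, k) \<in> D \<and> (l, i) \<in> D"
    then have "(k, j) \<in> D" "(i, l) \<in> D" using dir_arcs_rev by auto
    then have "a k - a j < 1" "a i - a l < 1" using a(3)[of k j] a(3)[of i l] assms(3) by auto
    then show False using a(1,2) by simp
  qed
next
  assume "\<not> ((j, k) \<in> D \<and> (l, i) \<in> D)"
  then have "(k, j) \<notin> D \<or> (i, l) \<notin> D" using dir_arcs_rev by blast
  then show "((i, j), (k, l)) \<in> spanning_pairs E"
  proof
    assume "(k, j) \<notin> D"
    then show ?thesis by (rule spanning_disjoint[OF assms])
  next
    assume "(i, l) \<notin> D"
    then have "((k, l), (i, j)) \<in> spanning_pairs E" using assms by (intro spanning_disjoint) auto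
    then show ?thesis using spanning_pairs_sym by blast
  qed
qed

lemma not_spanning_reverse: "((i, j), (j, i)) \<notin> spanning_pairs E"
proof
  assume "((i, j), (j, i)) \<in> spanning_pairs E"
  then obtain a :: "'v \<Rightarrow> real" where "a i - a j = 1" "a j - a i = 1" by (rule spanning_pairsE)
  then show False by simp
qed

section \<open>Counting pairs of directed arcs by their relative position\<close>

definition "cherries = {(i, j, l). (i, j) \<in> D \<and> (j, l) \<in> D \<and> i \<noteq> l}"
definition "lone_paths = {((i, j), (k, l)). (i, j) \<in> D \<and> (k, l) \<in> D \<and> j = k \<and> i \<noteq> l \<and>
  (i, l) \<notin> D \<and> (\<forall>m. (i, m) \<in> D \<longrightarrow> (m, l) \<in> D \<longrightarrow> m = j)}"
definition "disjoint_pairs = {((i, j), (k, l)). (i, j) \<in> D \<and> (k, l) \<in> D \<and> distinct [i, j, k, l]}"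
definition "cycle_pairs = {((i, j), (k, l)). (i, j) \<in> D \<and> (k, l) \<in> D \<and> distinct [i, j, k, l] \<and> (j, k) \<in> D \<and> (l, i) \<in> D}"
definition "tail_pairs = {((i, j), (k, l)). (i, j) \<in> D \<and> (k, l) \<in> D \<and> i = k \<and> j \<noteq> l}"
definition "head_pairs = {((i, j), (k, l)). (i, j) \<in> D \<and> (k, l) \<in> D \<and> j = l \<and> i \<noteq> k}"
definition "path_pairs = {((i, j), (k, l)). (i, j) \<in> D \<and> (k, l) \<in> D \<and> j = k \<and> i \<noteq> l}"
definition "equal_pairs = {((i, j), (k, l)). (i, j) \<in> D \<and> (k, l) \<in> D \<and> i = k \<and> j = l}"
definition "reverse_pairs = {((i, j), (k, l)). (i, j) \<in> D \<and> (k, l) \<in> D \<and> i = l \<and> j = k}"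

lemmas type_defs = tail_pairs_def head_pairs_def path_pairs_def equal_pairs_def reverse_pairs_def
  disjoint_pairs_def cycle_pairs_def
lemmas pair_defs = type_defs lone_paths_def

lemma card_tail_pairs: "card tail_pairs = card cherries"
proof -
  have "bij_betw (\<lambda>(a, b, c). ((b, a), (b, c))) cherries tail_pairs"
    by (rule bij_betwI[where g = "\<lambda>((i, j), (k, l)). (j, i, l)"])
       (auto simp: tail_pairs_def cherries_def intro: dir_arcs_rev)
  then show ?thesis by (rule bij_betw_same_card[symmetric])
qed

lemma card_head_pairs: "card head_pairs = card cherries"
proof -
  have "bij_betw (\<lambda>(a, b, c). ((a, b), (c, b))) cherries head_pairs"
    by (rule bij_betwI[where g = "\<lambda>((i, j), (k, l)). (i, j, k)"])
       (auto simp: head_pairs_def cherries_def intro: dir_arcs_rev)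
  then show ?thesis by (rule bij_betw_same_card[symmetric])
qed

lemma card_path_pairs: "card path_pairs = card cherries"
proof -
  have "bij_betw (\<lambda>(a, b, c). ((a, b), (b, c))) cherries path_pairs"
    by (rule bij_betwI[where g = "\<lambda>((i, j), (k, l)). (i, j, l)"])
       (auto simp: path_pairs_def cherries_def)
  then show ?thesis by (rule bij_betw_same_card[symmetric])
qed

lemma card_equal_pairs: "card equal_pairs = card D"
proof -
  have "bij_betw (\<lambda>d. (d, d)) D equal_pairs"
    by (rule bij_betwI[where g = fst]) (auto simp: equal_pairs_def)
  then show ?thesis by (rule bij_betw_same_card[symmetric])
qed

lemma card_reverse_pairs: "card reverse_pairs = card D"
proof -
  have "bij_betw (\<lambda>(i, j). ((i, j), (j, i))) D reverse_pairs"
    by (rule bij_betwI[where g = fst]) (auto simp: reverse_pairs_def intro: dir_arcs_rev)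
  then show ?thesis by (rule bij_betw_same_card[symmetric])
qed

lemma card_swap: "card (prod.swap ` A) = card A"
  by (rule card_image) (auto simp: inj_on_def)

lemma card_cycle_pairs: "real (card cycle_pairs) = cycle_count V E"
proof -
  have "bij_betw (\<lambda>(a, b, c, d). ((a, b), (c, d))) {t \<in> tuples4 V. arcs4 t \<subseteq> E} cycle_pairs"
  proof (rule bij_betwI[where g = "\<lambda>((a, b), (c, d)). (a, b, c, d)"])
    show "(\<lambda>((a, b), (c, d)). (a, b, c, d)) \<in> cycle_pairs \<rightarrow> {t \<in> tuples4 V. arcs4 t \<subseteq> E}"
    proof
      fix x assume x: "x \<in> cycle_pairs"
      then obtain a b c d where abcd: "x = ((a, b), (c, d))" "(a, b) \<in> D" "(c, d) \<in> D" "distinct [a, b, c, d]" "(b, c) \<in> D" "(d, a) \<in> D"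
        unfolding cycle_pairs_def by blast
      have "a \<in> V" "b \<in> V" "c \<in> V" "d \<in> V" using abcd dir_arcsD by blast+
      then show "(\<lambda>((a, b), (c, d)). (a, b, c, d)) x \<in> {t \<in> tuples4 V. arcs4 t \<subseteq> E}"
        using abcd by (simp add: tuples4_def dir_arcs_def)
    qed
  qed (auto simp: cycle_pairs_def tuples4_def dir_arcs_def)
  then have "card cycle_pairs = card {t \<in> tuples4 V. arcs4 t \<subseteq> E}" by (rule bij_betw_same_card[symmetric])
  moreover have "tuples4 V \<inter> {t. arcs4 t \<subseteq> E} = {t \<in> tuples4 V. arcs4 t \<subseteq> E}" by blast
  ultimately show ?thesis unfolding cycle_count_def
    using finV by (simp add: of_bool_def sum.If_cases)
qed

lemma card_cherries: "real (card cherries) = path_count V E"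
proof -
  have "cherries = {(i, j, l). i \<in> V \<and> j \<in> V \<and> l \<in> V \<and> i \<noteq> l \<and> {i, j} \<in> E \<and> {j, l} \<in> E}"
    unfolding cherries_def using dir_arcsD by (auto simp: dir_arcs_def)
  then show ?thesis by (simp add: path_count_def)
qed

text \<open>Forgetting the middle node loses nothing, because it is the unique common
  neighbour.\<close>

lemma card_lone_paths: "card lone_paths = card (lone_pairs V E)"
proof (rule bij_betw_same_card, rule bij_betw_imageI)
  show "inj_on (\<lambda>((i, j), (k, l)). (i, l)) lone_paths"
    by (rule inj_onI) (auto simp: lone_paths_def)
  have mem: "(i, l) \<in> lone_pairs V E" if "((i, j), (j, l)) \<in> lone_paths" for i j l
  proof -
    have h: "(i, j) \<in> D" "(j, l) \<in> D" "i \<noteq> l" "(i, l) \<notin> D" "\<And>m. (i, m) \<in> D \<Longrightarrow> (m, l) \<in> D \<Longrightarrow> m = j"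
      using that unfolding lone_paths_def by auto
    have V: "i \<in> V" "j \<in> V" "l \<in> V" using h dir_arcsD by blast+
    have "{i, m} \<in> E \<and> {m, l} \<in> E \<longleftrightarrow> m = j" for m
      using h(1,2) h(5)[of m] unfolding dir_arcs_def by blast
    then have "{m \<in> V. {i, m} \<in> E \<and> {m, l} \<in> E} = {j}" using V by auto
    then show ?thesis using h(3,4) V by (simp add: lone_pairs_def dir_arcs_def)
  qed
  show "(\<lambda>((i, j), (k, l)). (i, l)) ` lone_paths = lone_pairs V E"
  proof (intro equalityI subsetI)
    fix x assume "x \<in> (\<lambda>((i, j), (k, l)). (i, l)) ` lone_paths"
    then obtain y where y: "y \<in> lone_paths" "x = (\<lambda>((i, j), (k, l)). (i, l)) y" by blast
    obtain i j k l where ijkl: "y = ((i, j), (k, l))" by (metis surj_pair)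
    moreover have "j = k" using y(1) unfolding ijkl lone_paths_def by simp
    ultimately show "x \<in> lone_pairs V E" using y mem[of i j l] ijkl by simp
  next
    fix x assume x: "x \<in> lone_pairs V E"
    obtain i l where il: "x = (i, l)" by (cases x)
    obtain j where j: "{m \<in> V. {i, m} \<in> E \<and> {m, l} \<in> E} = {j}"
      using x unfolding il lone_pairs_def by (auto simp: card_1_singleton_iff)
    have inV: "m \<in> V" if "(i, m) \<in> D" for m using that dir_arcsD by blast
    have jE: "{i, j} \<in> E" "{j, l} \<in> E" using j by blast+
    have uniq: "m = j" if "(i, m) \<in> D" "(m, l) \<in> D" for m
    proof -
      have "m \<in> {m \<in> V. {i, m} \<in> E \<and> {m, l} \<in> E}" using that inV by (simp add: dir_arcs_def)
      then show ?thesis unfolding j by simp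
    qed
    have "((i, j), (j, l)) \<in> lone_paths" 
    proof -
      have "(i, j) \<in> D" "(j, l) \<in> D" using jE by (simp_all add: dir_arcs_def)
      moreover have "i \<noteq> l" "(i, l) \<notin> D" using x by (simp_all add: il lone_pairs_def dir_arcs_def)
      ultimately show ?thesis unfolding lone_paths_def using uniq by blast
    qed
    then show "x \<in> (\<lambda>((i, j), (k, l)). (i, l)) ` lone_paths" unfolding il by force
  qed
qed

lemma finite_pairs: "A \<subseteq> D \<times> D \<Longrightarrow> finite A"
  by (rule finite_subset) (use finite_dir in auto)

lemma all_pairs_partition:
  "D \<times> D = equal_pairs \<union> (reverse_pairs \<union> (tail_pairs \<union> (head_pairs \<union> (path_pairs \<union> (prod.swap ` path_pairs \<union> disjoint_pairs)))))"
  (is "_ = ?R")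
proof (intro equalityI subsetI)
  fix x assume "x \<in> D \<times> D"
  then obtain i j k l where x: "x = ((i, j), (k, l))" "(i, j) \<in> D" "(k, l) \<in> D" by auto
  have "i \<noteq> j" "k \<noteq> l" using x dir_arcsD by blast+
  moreover have "x \<in> prod.swap ` path_pairs" if "i = l" "j \<noteq> k"
    using that x by (intro image_eqI[of _ _ "((k, l), (i, j))"]) (auto simp: path_pairs_def)
  ultimately show "x \<in> ?R" using x by (auto simp: pair_defs)
qed (auto simp: pair_defs)

lemma spanning_pairs_partition:
  "spanning_pairs E = tail_pairs \<union> (head_pairs \<union> (lone_paths \<union> (prod.swap ` lone_paths \<union> (disjoint_pairs - cycle_pairs))))"
  (is "_ = ?R")
proof -
  have "((i, j), (k, l)) \<in> spanning_pairs E \<longleftrightarrow> ((i, j), (k, l)) \<in> ?R" for i j k l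
  proof (cases "(i, j) \<in> D \<and> (k, l) \<in> D")
    case False
    then show ?thesis by (auto simp: spanning_pairs_def pair_defs)
  next
    case True
    then have ij: "(i, j) \<in> D" and kl: "(k, l) \<in> D" by auto
    have ne: "i \<noteq> j" "k \<noteq> l" using ij kl dir_arcsD by blast+
    have sw: "((i, j), (k, l)) \<in> prod.swap ` lone_paths \<longleftrightarrow> ((k, l), (i, j)) \<in> lone_paths"
      by (auto simp: image_iff) (metis swap_simp)
    consider "i = k" "j = l" | "i = k" "j \<noteq> l" | "j = l" "i \<noteq> k" | "j = k" "i = l" | "j = k" "i \<noteq> l"
      | "i = l" "j \<noteq> k" | "distinct [i, j, k, l]" using ne by auto
    then show ?thesis
    proof cases
      case 1
      then show ?thesis unfolding Un_iff sw using ne by (auto simp: spanning_pairs_def pair_defs)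
    next
      case 2
      then show ?thesis using spanning_same_tail[of i j l] ij kl by (auto simp: tail_pairs_def)
    next
      case 3
      then show ?thesis using spanning_same_head[of i j k] ij kl by (auto simp: head_pairs_def)
    next
      case 4
      then show ?thesis unfolding Un_iff sw using not_spanning_reverse[of i j] ne by (auto simp: pair_defs)
    next
      case 5
      then show ?thesis unfolding Un_iff sw using spanning_path_iff[of i j l] ij kl ne by (auto simp: pair_defs)
    next
      case 6
      then show ?thesis unfolding Un_iff sw using spanning_path_iff[of k l j] spanning_pairs_sym[of "(i, j)" "(k, l)"] ij kl ne
        by (auto simp: pair_defs)
    next
      case 7
      then show ?thesis unfolding Un_iff sw using spanning_disjoint_iff[of i j k l] ij kl by (auto simp: pair_defs)
    qed
  qed
  then show ?thesis by (intro set_eqI) (metis surj_pair)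
qed

text \<open>Write D for the number of disjoint pairs. Counting all pairs by type gives 4 * S^2 = 4 *
  S + 4 * C + D, counting the spanning ones gives 2 * C + 2 * L + D - T. Eliminate D and
  halve.\<close>

theorem card_polytope_edges_formula:
  "real (card (polytope_edges V (sym_edge_polytope E)))
    = 4 * real (card E choose 2) - cycle_count V E / 2 + real (card (lone_pairs V E)) - path_count V E"
proof -
  let ?sw = "\<lambda>A. prod.swap ` A :: (('v \<times> 'v) \<times> ('v \<times> 'v)) set"
  have lone: "lone_paths \<subseteq> path_pairs" unfolding lone_paths_def path_pairs_def by blast
  have sub: "equal_pairs \<subseteq> D \<times> D" "reverse_pairs \<subseteq> D \<times> D" "tail_pairs \<subseteq> D \<times> D" "head_pairs \<subseteq> D \<times> D"
    "path_pairs \<subseteq> D \<times> D" "?sw path_pairs \<subseteq> D \<times> D" "disjoint_pairs \<subseteq> D \<times> D" "cycle_pairs \<subseteq> D \<times> D"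
    by (auto simp: type_defs)
  note fin = sub[THEN finite_pairs]
  have fin_lone: "finite lone_paths" using finite_subset[OF lone fin(5)] .
  have irrefl: "(i, i) \<notin> D" for i using dir_arcsD by blast
  have cE: "real (card D) = 2 * real (card E)"
    unfolding dir_arcs_def card_dir_arcs[OF finV E] by simp
  have total_disjoint:
    "equal_pairs \<inter> (reverse_pairs \<union> (tail_pairs \<union> (head_pairs \<union> (path_pairs \<union> (?sw path_pairs \<union> disjoint_pairs))))) = {}"
    "reverse_pairs \<inter> (tail_pairs \<union> (head_pairs \<union> (path_pairs \<union> (?sw path_pairs \<union> disjoint_pairs)))) = {}"
    "tail_pairs \<inter> (head_pairs \<union> (path_pairs \<union> (?sw path_pairs \<union> disjoint_pairs))) = {}"
    "head_pairs \<inter> (path_pairs \<union> (?sw path_pairs \<union> disjoint_pairs)) = {}"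
    "path_pairs \<inter> (?sw path_pairs \<union> disjoint_pairs) = {}"
    "?sw path_pairs \<inter> disjoint_pairs = {}"
    by (auto simp: type_defs irrefl)
  have "real (card (D \<times> D)) = real (card equal_pairs) + (real (card reverse_pairs) + (real (card tail_pairs) +
    (real (card head_pairs) + (real (card path_pairs) + (real (card (?sw path_pairs)) + real (card disjoint_pairs))))))"
    unfolding all_pairs_partition using fin total_disjoint by (simp add: card_Un_disjoint)
  then have total: "4 * (real (card E))\<^sup>2 = 4 * real (card E) + 4 * path_count V E + real (card disjoint_pairs)"
    by (simp add: card_cartesian_product card_swap card_tail_pairs card_head_pairs card_path_pairs
        card_equal_pairs card_reverse_pairs card_cherries cE power2_eq_square)
  have "cycle_pairs \<subseteq> disjoint_pairs" by (auto simp: type_defs)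
  then have diff: "real (card (disjoint_pairs - cycle_pairs)) = real (card disjoint_pairs) - cycle_count V E"
    unfolding card_cycle_pairs[symmetric] using fin by (simp add: card_Diff_subset card_mono of_nat_diff)
  have disjoint_mono: "A' \<inter> B' = {}" if "A \<inter> B = {}" "A' \<subseteq> A" "B' \<subseteq> B"
    for A B A' B' :: "(('v \<times> 'v) \<times> ('v \<times> 'v)) set"
    using that by blast
  have span_disjoint:
    "tail_pairs \<inter> (head_pairs \<union> (lone_paths \<union> (?sw lone_paths \<union> (disjoint_pairs - cycle_pairs)))) = {}"
    "head_pairs \<inter> (lone_paths \<union> (?sw lone_paths \<union> (disjoint_pairs - cycle_pairs))) = {}"
    "lone_paths \<inter> (?sw lone_paths \<union> (disjoint_pairs - cycle_pairs)) = {}"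
    "?sw lone_paths \<inter> (disjoint_pairs - cycle_pairs) = {}"
    by (rule disjoint_mono[OF total_disjoint(3)] disjoint_mono[OF total_disjoint(4)]
          disjoint_mono[OF total_disjoint(5)] disjoint_mono[OF total_disjoint(6)];
        intro Un_mono subset_refl lone image_mono Diff_subset)+
  have "real (card (spanning_pairs E)) = real (card tail_pairs) + (real (card head_pairs) + (real (card lone_paths)
    + (real (card (?sw lone_paths)) + real (card (disjoint_pairs - cycle_pairs)))))"
    unfolding spanning_pairs_partition using fin fin_lone span_disjoint by (simp add: card_Un_disjoint)
  then have span: "real (card (spanning_pairs E)) = 2 * path_count V E + 2 * real (card (lone_pairs V E))
      + real (card disjoint_pairs) - cycle_count V E"
    unfolding diff by (simp add: card_swap card_tail_pairs card_head_pairs card_lone_paths card_cherries)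
  have "real (card E choose 2) = real (card E) * (real (card E) - 1) / 2"
    by (simp add: binomial_gbinomial gbinomial_prod_rev eval_nat_numeral algebra_simps)
  moreover have "2 * real (card (polytope_edges V (sym_edge_polytope E))) = real (card (spanning_pairs E))"
    unfolding card_polytope_edges[symmetric] by simp
  ultimately show ?thesis using span total by (simp add: power2_eq_square algebra_simps)
qed

end

section \<open>The random symmetric edge polytope\<close>

text \<open>The bridge from the product measure to finite sums: an outcome is almost surely false
  off the arcs of the complete graph, hence the indicator function of a set of arcs.\<close>

lemma expectation_random_graph:
  assumes "0 \<le> p" "p \<le> 1"
  shows "measure_pmf.expectation (random_graph n p) F = bexp (nsets {1..n} 2) p F"
proof -
  define I where "I = nsets {1..n} 2"
  have fin: "finite I" unfolding I_def by (rule finite_imp_finite_nsets) simp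
  let ?P = "Pi_pmf I False (\<lambda>_. bernoulli_pmf p)"
  let ?c = "\<lambda>E e. e \<in> E"
  have inj: "inj_on ?c (Pow I)" by (auto simp: inj_on_def fun_eq_iff)
  have "measure_pmf.expectation (random_graph n p) F = measure_pmf.expectation ?P (\<lambda>\<omega>. F {e \<in> I. \<omega> e})"
    unfolding random_graph_def I_def by simp
  also have "\<dots> = (\<Sum>\<omega>\<in>?c ` Pow I. F {e \<in> I. \<omega> e} * pmf ?P \<omega>)"
  proof (rule integral_measure_pmf_real)
    show "finite (?c ` Pow I)" using fin by simp
    fix \<omega> assume "\<omega> \<in> set_pmf ?P"
    then have outside: "\<forall>e. e \<notin> I \<longrightarrow> \<omega> e = False" using subsetD[OF set_Pi_pmf_subset[OF fin]] by fast
    have "\<omega> = ?c {e \<in> I. \<omega> e}" by (rule ext) (use outside in simp, metis)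
    then show "\<omega> \<in> ?c ` Pow I" by (rule image_eqI) simp
  qed
  also have "\<dots> = (\<Sum>E\<in>Pow I. F {e \<in> I. e \<in> E} * pmf ?P (?c E))"
    by (simp add: sum.reindex[OF inj])
  also have "\<dots> = (\<Sum>E\<in>Pow I. p ^ card E * (1 - p) ^ card (I - E) * F E)"
  proof (intro sum.cong refl)
    fix E assume E: "E \<in> Pow I"
    have "pmf ?P (?c E) = (\<Prod>e\<in>I. pmf (bernoulli_pmf p) (e \<in> E))"
      using E by (intro pmf_Pi' fin) auto
    also have "\<dots> = (\<Prod>e\<in>I. if e \<in> E then p else 1 - p)"
      using assms by (intro prod.cong) auto
    also have "\<dots> = p ^ card E * (1 - p) ^ card (I - E)"
      using E fin by (simp add: prod.If_cases Int_absorb1 Diff_eq)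
    finally have "pmf ?P (?c E) = p ^ card E * (1 - p) ^ card (I - E)" .
    moreover have "{e \<in> I. e \<in> E} = E" using E by auto
    ultimately show "F {e \<in> I. e \<in> E} * pmf ?P (?c E) = p ^ card E * (1 - p) ^ card (I - E) * F E" by simp
  qed
  finally show ?thesis by (simp add: bexp_def I_def)
qed

lemma prob_std_edge_count_le:
  assumes "0 < p" "p < 1"
  shows "measure (measure_pmf (random_graph n p)) {E. std_edge_count n p E \<le> z} =
    bexp (nsets {1..n} 2) p (\<lambda>E. of_bool ((edge_count n E - bexp (nsets {1..n} 2) p (edge_count n)) /
      sqrt (bexp (nsets {1..n} 2) p (\<lambda>E. (edge_count n E - bexp (nsets {1..n} 2) p (edge_count n))\<^sup>2)) \<le> z))"
proof -
  have p: "0 \<le> p" "p \<le> 1" using assms by auto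
  have "measure (measure_pmf (random_graph n p)) {E. std_edge_count n p E \<le> z} =
    measure_pmf.expectation (random_graph n p) (indicator {E. std_edge_count n p E \<le> z})" by simp
  also have "\<dots> = bexp (nsets {1..n} 2) p (indicator {E. std_edge_count n p E \<le> z})"
    by (rule expectation_random_graph[OF p])
  also have "\<dots> = bexp (nsets {1..n} 2) p (\<lambda>E. of_bool (std_edge_count n p E \<le> z))"
    by (rule bexp_cong) (simp add: indicator_def)
  finally show ?thesis unfolding std_edge_count_def expectation_random_graph[OF p] .
qed

lemma edge_count_rate:
  assumes n: "n \<ge> 1" and p: "0 < p" "p < 1" "p \<noteq> 1 / sqrt 2"
  shows "\<bar>measure (measure_pmf (random_graph n p)) {E. std_edge_count n p E \<le> z} - gauss_cdf z\<bar>
    \<le> 10 ^ 10 * (1 / (real n * sqrt (p * (1 - p)) * (1 - sqrt 2 * p)\<^sup>2))"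
proof -
  interpret random_graph_space "{1..n}" p by unfold_locales (use p in auto)
  have "edge_count n E = main_part E + local_part E" if "E \<subseteq> nsets {1..n} 2" for E
  proof -
    interpret edge_polytope "{1..n}" E by unfold_locales (use that in auto)
    show ?thesis unfolding edge_count_def card_polytope_edges_formula main_part_def local_part_def by simp
  qed
  from edge_formula_rate[OF _ p(3) this, of z] n show ?thesis
    unfolding prob_std_edge_count_le[OF p(1,2)] by simp
qed

section \<open>Kolmogorov distance, asymptotic relations and the final statement\<close>

lemma prob_gauss_le:
  assumes "prob_space M" "distributed M lborel N (\<lambda>x. ennreal (std_normal_density x))"
  shows "measure M {\<omega> \<in> space M. N \<omega> \<le> z} = gauss_cdf z"
proof -
  have N: "N \<in> measurable M lborel" using assms(2) by (rule distributed_measurable)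
  have "gauss_cdf z = measure (distr M lborel N) {..z}"
    unfolding cdf_def distributed_distr_eq_density[OF assms(2)] ..
  also have "\<dots> = measure M (N -` {..z} \<inter> space M)"
    by (rule measure_distr[OF N]) simp
  also have "N -` {..z} \<inter> space M = {\<omega> \<in> space M. N \<omega> \<le> z}" by auto
  finally show ?thesis by simp
qed

lemma kolmogorov_dist_bounds:
  assumes "prob_space M" "prob_space M'"
  shows "0 \<le> kolmogorov_dist M X M' Y" "kolmogorov_dist M X M' Y \<le> 1"
    "\<bar>measure M {\<omega> \<in> space M. X \<omega> \<le> z} - measure M' {\<omega> \<in> space M'. Y \<omega> \<le> z}\<bar> \<le> kolmogorov_dist M X M' Y"
proof -
  interpret M: prob_space M by fact
  interpret M': prob_space M' by fact
  let ?f = "\<lambda>z. \<bar>measure M {\<omega> \<in> space M. X \<omega> \<le> z} - measure M' {\<omega> \<in> space M'. Y \<omega> \<le> z}\<bar>"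
  have le: "?f z \<le> 1" for z
    using M.prob_le_1[of "{\<omega> \<in> space M. X \<omega> \<le> z}"] M'.prob_le_1[of "{\<omega> \<in> space M'. Y \<omega> \<le> z}"]
      measure_nonneg[of M "{\<omega> \<in> space M. X \<omega> \<le> z}"] measure_nonneg[of M' "{\<omega> \<in> space M'. Y \<omega> \<le> z}"]
    by linarith
  then have bdd: "bdd_above (range ?f)" by (intro bdd_aboveI2[of _ _ 1]) auto
  show upper: "?f z \<le> kolmogorov_dist M X M' Y" for z
    unfolding kolmogorov_dist_def by (rule cSUP_upper[OF _ bdd]) simp
  show "0 \<le> kolmogorov_dist M X M' Y" using upper[of 0] by linarith
  show "kolmogorov_dist M X M' Y \<le> 1" unfolding kolmogorov_dist_def by (rule cSUP_least) (use le in auto)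
qed

lemma much_greaterD:
  assumes "much_greater a b"
  shows "\<forall>\<^sub>F n in sequentially. K < \<bar>a n / b n\<bar>"
proof -
  have "ereal K < liminf (\<lambda>n. ereal \<bar>a n / b n\<bar>)" using assms by (simp add: much_greater_def)
  then have "\<forall>\<^sub>F n in sequentially. ereal K < ereal \<bar>a n / b n\<bar>" by (rule less_LiminfD)
  then show ?thesis by simp
qed

text \<open>The factors p, 1 - p and 1 - sqrt 2 * p are small in different ranges of p, so at most
  one is small at a time and each range needs a single lower bound. The constant comes from p >=
  3/4, where sqrt 2 * p - 1 >= 7/5 * 3/4 - 1 = 1/20 is squared and halved.\<close>

lemma rate_denominator_ge:
  fixes p K n :: real
  assumes n: "n \<ge> 1" and p: "0 < p" "p < 1" and K: "K \<ge> 1"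
    and hp: "K\<^sup>2 \<le> n\<^sup>2 * p" and hq: "K\<^sup>2 \<le> n\<^sup>2 * (1 - p)" and hd: "K \<le> \<bar>p - 1 / sqrt 2\<bar> * sqrt n"
  shows "K / 800 \<le> n * sqrt (p * (1 - p)) * (1 - sqrt 2 * p)\<^sup>2"
proof -
  have "7 / 5 \<le> sqrt 2" by (rule real_le_rsqrt) (simp add: power_divide)
  moreover have "sqrt 2 \<le> 3 / 2" by (rule real_le_lsqrt) (simp_all add: power_divide)
  ultimately have sq2: "7 / 5 \<le> sqrt 2" "sqrt 2 \<le> 3 / 2" .
  have Kp: "K \<le> n * sqrt x" if "0 < x" "K\<^sup>2 \<le> n\<^sup>2 * x" for x
  proof (rule power2_le_imp_le)
    show "K\<^sup>2 \<le> (n * sqrt x)\<^sup>2" using that by (simp add: power_mult_distrib)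
    show "0 \<le> n * sqrt x" using n that by simp
  qed
  consider "p \<le> 1 / 4" | "3 / 4 \<le> p" | "1 / 4 \<le> p" "p \<le> 3 / 4" by linarith
  then show ?thesis
  proof cases
    case 1
    have "sqrt 2 * p \<le> 3 / 2 * (1 / 4)" using sq2 1 p by (intro mult_mono) auto
    then have "(1 / 2)\<^sup>2 \<le> (1 - sqrt 2 * p)\<^sup>2" by (intro power_mono) auto
    moreover have "1 / 2 * sqrt p \<le> sqrt (p * (1 - p))"
    proof -
      have "1 / 2 \<le> sqrt (1 - p)" by (rule real_le_rsqrt) (use 1 in \<open>simp add: power_divide\<close>)
      then have "1 / 2 * sqrt p \<le> sqrt (1 - p) * sqrt p" using p by (intro mult_right_mono) auto
      then show ?thesis by (simp add: real_sqrt_mult mult.commute)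
    qed
    ultimately have "n * (1 / 2 * sqrt p) * (1 / 2)\<^sup>2 \<le> n * sqrt (p * (1 - p)) * (1 - sqrt 2 * p)\<^sup>2"
      using n p by (intro mult_mono) auto
    moreover have "K / 8 \<le> n * (1 / 2 * sqrt p) * (1 / 2)\<^sup>2" using Kp[OF p(1) hp] by (simp add: power_divide)
    ultimately show ?thesis using K by linarith
  next
    case 2
    have "7 / 5 * (3 / 4) \<le> sqrt 2 * p" using sq2 2 p by (intro mult_mono) auto
    then have "(1 / 20)\<^sup>2 \<le> (sqrt 2 * p - 1)\<^sup>2" by (intro power_mono) auto
    then have "(1 / 20)\<^sup>2 \<le> (1 - sqrt 2 * p)\<^sup>2" by (simp only: power2_commute)
    moreover have "1 / 2 * sqrt (1 - p) \<le> sqrt (p * (1 - p))"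
    proof -
      have "1 / 2 \<le> sqrt p" by (rule real_le_rsqrt) (use 2 in \<open>simp add: power_divide\<close>)
      then have "1 / 2 * sqrt (1 - p) \<le> sqrt p * sqrt (1 - p)" using p by (intro mult_right_mono) auto
      then show ?thesis by (simp add: real_sqrt_mult)
    qed
    ultimately have "n * (1 / 2 * sqrt (1 - p)) * (1 / 20)\<^sup>2 \<le> n * sqrt (p * (1 - p)) * (1 - sqrt 2 * p)\<^sup>2"
      using n p by (intro mult_mono) auto
    moreover have "K / 800 \<le> n * (1 / 2 * sqrt (1 - p)) * (1 / 20)\<^sup>2" using Kp[OF _ hq] p by (simp add: power_divide)
    ultimately show ?thesis by linarith
  next
    case 3
    define \<delta> where "\<delta> = \<bar>p - 1 / sqrt 2\<bar>"
    have "\<bar>1 - sqrt 2 * p\<bar> = sqrt 2 * \<delta>"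
    proof -
      have "1 - sqrt 2 * p = sqrt 2 * (1 / sqrt 2 - p)" by (simp add: right_diff_distrib)
      then show ?thesis by (simp add: abs_mult \<delta>_def abs_minus_commute)
    qed
    moreover have "1 * \<delta> \<le> sqrt 2 * \<delta>" using sq2 by (intro mult_right_mono) (auto simp: \<delta>_def)
    ultimately have "\<delta>\<^sup>2 \<le> \<bar>1 - sqrt 2 * p\<bar>\<^sup>2" by (intro power_mono) (auto simp: \<delta>_def)
    then have d: "\<delta>\<^sup>2 \<le> (1 - sqrt 2 * p)\<^sup>2" by simp
    have "(1 / 4) * (1 / 4) \<le> p * (1 - p)" using 3 by (intro mult_mono) auto
    then have w: "1 / 4 \<le> sqrt (p * (1 - p))" by (intro real_le_rsqrt) (simp add: power2_eq_square)
    have "K\<^sup>2 \<le> (\<delta> * sqrt n)\<^sup>2" using hd K unfolding \<delta>_def by (intro power_mono) auto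
    then have "K\<^sup>2 \<le> \<delta>\<^sup>2 * n" using n by (simp add: power_mult_distrib)
    moreover have "K \<le> K\<^sup>2" using K by (simp add: power2_eq_square)
    moreover have "n * (1 / 4) * \<delta>\<^sup>2 \<le> n * sqrt (p * (1 - p)) * (1 - sqrt 2 * p)\<^sup>2"
      using n d w p by (intro mult_mono) auto
    moreover have "n * (1 / 4) * \<delta>\<^sup>2 = \<delta>\<^sup>2 * n / 4" by simp
    ultimately show ?thesis using K by linarith
  qed
qed

theorem theorem3p9:
  fixes p :: "nat \<Rightarrow> real" and M :: "'a measure" and N :: "'a \<Rightarrow> real"
  assumes p_range: "\<And>n. n \<ge> 1 \<Longrightarrow> 0 < p n \<and> p n < 1"
    and gauss_space: "prob_space M"
    and gauss: "distributed M lborel N (\<lambda>x. ennreal (std_normal_density x))"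
    and p_large: "much_greater p (\<lambda>n. 1 / (real n)\<^sup>2)"
  shows "asymp_bounded_by
           (\<lambda>n. kolmogorov_dist (measure_pmf (random_graph n (p n))) (std_edge_count n (p n)) M N)
           (\<lambda>n. rate_bound n (p n))
    \<and> (much_greater (\<lambda>n. 1 - p n) (\<lambda>n. 1 / (real n)\<^sup>2)
         \<and> much_greater (\<lambda>n. \<bar>p n - 1 / sqrt 2\<bar>) (\<lambda>n. 1 / sqrt (real n))
       \<longrightarrow> weak_conv_m
             (\<lambda>n. distr (measure_pmf (random_graph n (p n))) borel (std_edge_count n (p n)))
             std_normal_distribution)"
proof
  define d where "d n = kolmogorov_dist (measure_pmf (random_graph n (p n))) (std_edge_count n (p n)) M N" for n
  define r where "r n = real n * sqrt (p n * (1 - p n)) * (1 - sqrt 2 * p n)\<^sup>2" for n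
  note kb = kolmogorov_dist_bounds[OF prob_space_measure_pmf gauss_space]
  have d_le: "d n \<le> 10 ^ 10 * (1 / r n)" if "n \<ge> 1" "p n \<noteq> 1 / sqrt 2" for n
    unfolding d_def kolmogorov_dist_def
  proof (rule cSUP_least)
    fix z
    show "\<bar>measure (measure_pmf (random_graph n (p n))) {\<omega> \<in> space (measure_pmf (random_graph n (p n))). std_edge_count n (p n) \<omega> \<le> z}
      - measure M {\<omega> \<in> space M. N \<omega> \<le> z}\<bar> \<le> 10 ^ 10 * (1 / r n)"
      using edge_count_rate[of n "p n" z] that p_range[of n]
      unfolding prob_gauss_le[OF gauss_space gauss] r_def by simp
  qed simp
  have d01: "0 \<le> d n" "d n \<le> 1" for n unfolding d_def by (rule kb)+
  have ratio: "\<bar>d n / rate_bound n (p n)\<bar> \<le> 10 ^ 10" if n: "n \<ge> 1" for n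
  proof -
    have p: "0 < p n" "p n < 1" using p_range n by auto
    define w where "w = sqrt (p n * (1 - p n))"
    have w: "0 < w" "w \<le> 1" using p by (auto simp: w_def mult_le_one)
    \<comment> \<open>This gives the second entry of the minimum, and the whole bound if p = 1 /
      sqrt 2.\<close>
    have le1: "d n \<le> 10 ^ 10 * (1 / w)"
    proof -
      have "1 \<le> 1 / w" using w by simp
      then show ?thesis using d01(2)[of n] by simp
    qed
    have "d n \<le> 10 ^ 10 * rate_bound n (p n) \<and> 0 < rate_bound n (p n)"
    proof (cases "p n = 1 / sqrt 2")
      case True
      then have "rate_bound n (p n) = 1 / w" by (simp add: rate_bound_def w_def)
      then show ?thesis using le1 w by simp
    next
      case False
      then have eq: "rate_bound n (p n) = min (1 / r n) (1 / w)" by (simp add: rate_bound_def w_def r_def)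
      have "sqrt 2 * p n \<noteq> 1" using False by (auto simp: field_simps)
      then have "r n > 0" using n w unfolding r_def w_def[symmetric] by simp
      then show ?thesis using le1 d_le[OF n False] w unfolding eq by (simp add: min_def)
    qed
    then show ?thesis using d01(1)[of n] by (simp add: divide_le_eq)
  qed
  \<comment> \<open>An eventual bound suffices, which avoids n = 0, where p is not
    constrained.\<close>
  have "limsup (\<lambda>n. ereal \<bar>d n / rate_bound n (p n)\<bar>) \<le> ereal (10 ^ 10)"
    by (rule Limsup_bounded, rule eventually_mono[OF eventually_ge_at_top[of 1]]) (simp only: ereal_less_eq ratio)
  then show "asymp_bounded_by
           (\<lambda>n. kolmogorov_dist (measure_pmf (random_graph n (p n))) (std_edge_count n (p n)) M N)
           (\<lambda>n. rate_bound n (p n))"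
    unfolding d_def[symmetric]
    unfolding asymp_bounded_by_def by (rule le_less_trans) simp
  show "much_greater (\<lambda>n. 1 - p n) (\<lambda>n. 1 / (real n)\<^sup>2)
         \<and> much_greater (\<lambda>n. \<bar>p n - 1 / sqrt 2\<bar>) (\<lambda>n. 1 / sqrt (real n))
       \<longrightarrow> weak_conv_m
             (\<lambda>n. distr (measure_pmf (random_graph n (p n))) borel (std_edge_count n (p n)))
             std_normal_distribution"
  proof
    assume h: "much_greater (\<lambda>n. 1 - p n) (\<lambda>n. 1 / (real n)\<^sup>2)
         \<and> much_greater (\<lambda>n. \<bar>p n - 1 / sqrt 2\<bar>) (\<lambda>n. 1 / sqrt (real n))"
    have "d \<longlonglongrightarrow> 0"
    proof (rule LIMSEQ_I)
      fix \<eta> :: real assume \<eta>: "\<eta> > 0"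
      \<comment> \<open>The summand 800 makes \<open>10 ^ 10 / \<eta> < K / 800\<close> strict; the
        maximum with 1 meets the assumption of \<open>rate_denominator_ge\<close>.\<close>
      define K where "K = max 1 (800 * (10 ^ 10 / \<eta>) + 800)"
      have K1: "K \<ge> 1" by (simp add: K_def)
      have "\<forall>\<^sub>F n in sequentially. norm (d n - 0) < \<eta>"
        using eventually_ge_at_top[of 1] much_greaterD[OF p_large, of "K\<^sup>2"]
          much_greaterD[OF conjunct1[OF h], of "K\<^sup>2"] much_greaterD[OF conjunct2[OF h], of K]
      proof eventually_elim
        fix n :: nat
        assume n: "1 \<le> n" and hp: "K\<^sup>2 < \<bar>p n / (1 / (real n)\<^sup>2)\<bar>"
          and hq: "K\<^sup>2 < \<bar>(1 - p n) / (1 / (real n)\<^sup>2)\<bar>"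
          and hd: "K < \<bar>\<bar>p n - 1 / sqrt 2\<bar> / (1 / sqrt (real n))\<bar>"
        have p: "0 < p n" "p n < 1" using p_range n by auto
        have "K / 800 \<le> r n"
          unfolding r_def
        proof (rule rate_denominator_ge[OF _ p K1])
          show "1 \<le> real n" using n by simp
          show "K\<^sup>2 \<le> (real n)\<^sup>2 * p n" using hp p by (simp add: abs_mult mult.commute)
          show "K\<^sup>2 \<le> (real n)\<^sup>2 * (1 - p n)" using hq p by (simp add: abs_mult mult.commute)
          show "K \<le> \<bar>p n - 1 / sqrt 2\<bar> * sqrt (real n)" using hd by (simp add: abs_mult)
        qed
        moreover have "p n \<noteq> 1 / sqrt 2" using hd K1 by auto
        moreover have "10 ^ 10 / \<eta> < K / 800" by (simp add: K_def)
        ultimately have *: "10 ^ 10 / \<eta> < r n" "d n \<le> 10 ^ 10 * (1 / r n)" using d_le[OF n] by auto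
        have "0 < 10 ^ 10 / \<eta>" using \<eta> by simp
        then have "r n > 0" using *(1) by linarith
        then have "10 ^ 10 * (1 / r n) < \<eta>" using *(1) \<eta> by (simp add: field_simps)
        then show "norm (d n - 0) < \<eta>" using *(2) d01(1)[of n] by simp
      qed
      then show "\<exists>n0. \<forall>n\<ge>n0. norm (d n - 0) < \<eta>" by (simp add: eventually_sequentially)
    qed
    show "weak_conv_m (\<lambda>n. distr (measure_pmf (random_graph n (p n))) borel (std_edge_count n (p n))) std_normal_distribution"
      unfolding weak_conv_m_def weak_conv_def
    proof (intro allI impI)
      fix z
      have "cdf (distr (measure_pmf (random_graph n (p n))) borel (std_edge_count n (p n))) z
        = measure (measure_pmf (random_graph n (p n))) {E \<in> space (measure_pmf (random_graph n (p n))). std_edge_count n (p n) E \<le> z}" for n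
        unfolding cdf_def by (subst measure_distr) (auto intro!: arg_cong2[where f = measure])
      then have "\<bar>cdf (distr (measure_pmf (random_graph n (p n))) borel (std_edge_count n (p n))) z - gauss_cdf z\<bar> \<le> d n" for n
        using kb(3)[of "random_graph n (p n)" "std_edge_count n (p n)" z N]
        unfolding d_def prob_gauss_le[OF gauss_space gauss] by simp
      then have "(\<lambda>n. cdf (distr (measure_pmf (random_graph n (p n))) borel (std_edge_count n (p n))) z - gauss_cdf z) \<longlonglongrightarrow> 0"
        by (intro Lim_null_comparison[OF _ \<open>d \<longlonglongrightarrow> 0\<close>] always_eventually allI) (simp only: real_norm_def)
      then show "(\<lambda>n. cdf (distr (measure_pmf (random_graph n (p n))) borel (std_edge_count n (p n))) z) \<longlonglongrightarrow> gauss_cdf z"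
        by (rule LIM_zero_cancel)
    qed
  qed
qed

end
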